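(* Let $\boldsymbol{\zeta}$ be a fluid model solution (for fluid model parameters $(\boldsymbol\alpha,\boldsymbol\mu,\boldsymbol p,\boldsymbol\vartheta)$ with $\varrho>1$) with a nonzero initial condition $\boldsymbol{\zeta}_0$, and let $T>0$. For each finite collection of functions $f_1,\ldots,f_n\in\mathscr C$ there exists a unique in distribution, continuous multiparameter $\mathbb R^{n(J+J^2K)}$-valued process $$\left\{\hat Y_{f_a}^{A_j,j}(r,t),\ \hat Y_{f_a}^{V_j^k,i}(r,t):\ a\in[n],\ j,i\in[J],\ k\in[K],\ 0\le r\le t\le T\right\}$$ whose finite dimensional distributions are those of the mean-zero Gaussian process with covariances $$\mathrm{Cov}\big(\hat Y_{f_a}^{A_j,j}(r_1,t_1),\hat Y_{f_b}^{A_j,j}(r_2,t_2)\big)=\int_0^{r_1\wedge r_2}\alpha_j\Big(\langle t_{t_1-u}f_a\,t_{t_2-u}f_b,\vartheta_j\rangle-\langle t_{t_1-u}f_a,\vartheta_j\rangle\langle t_{t_2-u}f_b,\vartheta_j\rangle\Big)du,$$ $$\mathrm{Cov}\big(\hat Y_{f_a}^{V_j^k,c}(r_1,t_1),\hat Y_{f_b}^{V_j^k,d}(r_2,t_2)\big)=\int_0^{r_1\wedge r_2}\left(1_{\{c=d\}}\frac{p_c\langle t_{t_1-u}f_a\,t_{t_2-u}f_b,\zeta_c(u)\rangle}{L(\boldsymbol z(u))}-\frac{p_cp_d\langle t_{t_1-u}f_a,\zeta_c(u)\rangle\langle t_{t_2-u}f_b,\zeta_d(u)\rangle}{L(\boldsymbol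 z(u))^2}\right)\frac{p_jz_j(u)}{\mathcal L(\boldsymbol z(u))}\,du,$$ and all other covariances equal to zero. Furthermore, if $\vartheta_j$ and $\zeta_j(0)$ have Hölder continuous CDFs for each $j\in[J]$, the same construction applies to finite collections $f_1,\ldots,f_n\in\mathscr C\cup\{1\}$ (where $1$ is the constant function).
   Context: Fix $J,K\in\mathbb N$, $[n]=\{1,\dots,n\}$. $\mathbf M$ is the set of finite Borel measures on $\mathbb R_+=[0,\infty)$ with the topology of weak convergence; $\langle f,\xi\rangle=\int f\,d\xi$. $\mathbf C_b^1(\mathbb R_+)$ is the set of bounded continuous real functions on $\mathbb R_+$ with bounded continuous derivative, and $\mathscr C=\{f\in\mathbf C_b^1(\mathbb R_+): f(0)=0\}$. For $x\ge0$ and $f:\mathbb R_+\to\mathbb R$ the translate is $t_xf(y)=f(y-x)$ if $y>x$ and $t_xf(y)=0$ if $y\le x$. Fluid model parameters: $(\boldsymbol\alpha,\boldsymbol\mu,\boldsymbol p,\boldsymbol\vartheta)\in\mathbb R_+^J\times\mathbb R_+^J\times(0,1)^J\times\mathbf M^J$ with all $\alpha_j>0$, $\mu_j>0$, $\sum_jp_j=1$, and each $\vartheta_j$ a probability measure with $\vartheta_j(\{0\})=0$. Put $\varrho=\sum_{j=1}^J\frac{\alpha_j}{K\mu_j}$, and for $\boldsymbol z\in\mathbb R_+^J$, $L(\boldsymbol z)=\sum_jp_jz_j$, $\mathcal L(\boldsymbol z)=\sum_j\frac{p_j}{\mu_j}z_j$. Fluid model solution: a continuous $\boldsymbol\zeta:[0,\infty)\to\mathbf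 M^J$ with initial condition $\boldsymbol\zeta_0$ (a vector of continuous, i.e. atomless, measures) such that (i) $\boldsymbol\zeta(0)=\boldsymbol\zeta_0$; (ii) $\langle1_{\{0\}},\zeta_j(t)\rangle=0$ for all $t\ge0$, $j$; (iii) for all $f\in\mathscr C$, $j\in[J]$, $t\ge0$, $$\langle f,\zeta_j(t)\rangle=\langle f,\zeta_j(0)\rangle-\int_0^t\langle f',\zeta_j(s)\rangle ds-\int_0^tK1_{\{\boldsymbol\zeta(s)\ne\boldsymbol0\}}\frac{p_j\langle f,\zeta_j(s)\rangle}{\sum_{i}\frac{p_i}{\mu_i}\langle1,\zeta_i(s)\rangle}ds+\alpha_j\langle f,\vartheta_j\rangle\int_0^t1_{\{\boldsymbol\zeta(s)\ne\boldsymbol0\}}ds;$$ (iv) when $\varrho>1$, for each $t>0$, $\langle1,\zeta_j(t)\rangle>0$ for some $j$. Write $z_j(t)=\langle1,\zeta_j(t)\rangle$. *)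

theory Defs
  imports "HOL-Probability.Probability"
begin

(* Classes are indexed by j in {1..J} and servers by k in {1..K}.  A vector of measures is a
   function nat => real measure, of which only the entries in {1..J} matter.  Functions on
   [0,\<infinity>) are total functions on the reals of which only the values on {0..} matter. *)

section \<open>Measures on the half line\<close>

abbreviation Rplus :: "real measure" where
  "Rplus \<equiv> restrict_space borel {0..}"

definition finite_measures :: "real measure set" where
  "finite_measures = {\<xi>. sets \<xi> = sets Rplus \<and> finite_measure \<xi>}"

abbreviation pairing :: "(real \<Rightarrow> real) \<Rightarrow> real measure \<Rightarrow> real"  ("\<langle>_, _\<rangle>") where
  "\<langle>f, \<xi>\<rangle> \<equiv> integral\<^sup>L \<xi> f"

text \<open>The topology of weak convergence: the coarsest topology on the finite measures that makes
  \<open>\<xi> \<mapsto> \<langle>g, \<xi>\<rangle>\<close> continuous for each bounded continuous \<open>g\<close>.\<close>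

definition weak_topology :: "real measure topology" where
  "weak_topology = topology_generated_by
     {{\<xi> \<in> finite_measures. \<langle>g, \<xi>\<rangle> \<in> U} | g U.
        continuous_on {0..} g \<and> bounded (g ` {0..}) \<and> open (U :: real set)}"

definition atomless :: "real measure \<Rightarrow> bool" where
  "atomless \<xi> \<longleftrightarrow> (\<forall>x\<ge>0. measure \<xi> {x} = 0)"

text \<open>The CDF is \<open>x \<mapsto> measure \<xi> {0..x}\<close>; the library's \<open>cdf\<close> uses \<open>{..x}\<close>, which is not a
  subset of the half line.\<close>

definition holder_cdf :: "real measure \<Rightarrow> bool" where
  "holder_cdf \<xi> \<longleftrightarrow> (\<exists>h C. 0 < h \<and> h \<le> 1 \<and>
     (\<forall>x\<ge>0. \<forall>y\<ge>0. \<bar>measure \<xi> {0..x} - measure \<xi> {0..y}\<bar> \<le> C * \<bar>x - y\<bar> powr h))"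

section \<open>Test functions and translates\<close>

text \<open>Derivatives are taken within the half line, so they are one-sided at 0.\<close>

definition rderiv :: "(real \<Rightarrow> real) \<Rightarrow> real \<Rightarrow> real" where
  "rderiv f x = vector_derivative f (at x within {0..})"

definition Cb1 :: "(real \<Rightarrow> real) set" where
  "Cb1 = {f. continuous_on {0..} f \<and> bounded (f ` {0..}) \<and>
             f differentiable_on {0..} \<and>
             continuous_on {0..} (rderiv f) \<and> bounded (rderiv f ` {0..})}"

definition test_functions :: "(real \<Rightarrow> real) set"  ("\<C>") where
  "\<C> = {f \<in> Cb1. f 0 = 0}"

definition translate :: "real \<Rightarrow> (real \<Rightarrow> real) \<Rightarrow> real \<Rightarrow> real" where
  "translate x f y = (if y > x then f (y - x) else 0)"

section \<open>Fluid model solutions\<close>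

definition fluid_params ::
  "nat \<Rightarrow> nat \<Rightarrow> (nat \<Rightarrow> real) \<Rightarrow> (nat \<Rightarrow> real) \<Rightarrow> (nat \<Rightarrow> real) \<Rightarrow> (nat \<Rightarrow> real measure) \<Rightarrow> bool" where
  "fluid_params J K \<alpha> \<mu> p \<theta> \<longleftrightarrow> 1 \<le> J \<and> 1 \<le> K \<and>
     (\<forall>j\<in>{1..J}. 0 < \<alpha> j \<and> 0 < \<mu> j \<and> 0 < p j \<and> p j < 1) \<and> (\<Sum>j=1..J. p j) = 1 \<and>
     (\<forall>j\<in>{1..J}. \<theta> j \<in> finite_measures \<and> prob_space (\<theta> j) \<and> measure (\<theta> j) {0} = 0)"

definition traffic_intensity :: "nat \<Rightarrow> nat \<Rightarrow> (nat \<Rightarrow> real) \<Rightarrow> (nat \<Rightarrow> real) \<Rightarrow> real" where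
  "traffic_intensity J K \<alpha> \<mu> = (\<Sum>j=1..J. \<alpha> j / (real K * \<mu> j))"

definition nonzero_measures :: "nat \<Rightarrow> (nat \<Rightarrow> real measure) \<Rightarrow> bool" where
  "nonzero_measures J \<xi> \<longleftrightarrow> (\<exists>j\<in>{1..J}. \<xi> j \<noteq> null_measure Rplus)"

definition fluid_solution ::
  "nat \<Rightarrow> nat \<Rightarrow> (nat \<Rightarrow> real) \<Rightarrow> (nat \<Rightarrow> real) \<Rightarrow> (nat \<Rightarrow> real) \<Rightarrow> (nat \<Rightarrow> real measure) \<Rightarrow>
   (nat \<Rightarrow> real measure) \<Rightarrow> (real \<Rightarrow> nat \<Rightarrow> real measure) \<Rightarrow> bool" where
  "fluid_solution J K \<alpha> \<mu> p \<theta> \<zeta>\<^sub>0 \<zeta> \<longleftrightarrow>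
     (\<forall>j\<in>{1..J}. \<zeta>\<^sub>0 j \<in> finite_measures \<and> atomless (\<zeta>\<^sub>0 j)) \<and>
     (\<forall>j\<in>{1..J}. continuous_map (top_of_set {0..}) weak_topology (\<lambda>t. \<zeta> t j)) \<and>
     (\<forall>j\<in>{1..J}. \<zeta> 0 j = \<zeta>\<^sub>0 j) \<and>
     (\<forall>t\<ge>0. \<forall>j\<in>{1..J}. \<langle>indicator {0}, \<zeta> t j\<rangle> = 0) \<and>
     (\<forall>f\<in>\<C>. \<forall>j\<in>{1..J}. \<forall>t\<ge>0.
        \<langle>f, \<zeta> t j\<rangle> = \<langle>f, \<zeta> 0 j\<rangle>
          - (LINT s:{0..t}|lborel. \<langle>rderiv f, \<zeta> s j\<rangle>)
          - (LINT s:{0..t}|lborel. real K * of_bool (nonzero_measures J (\<zeta> s)) *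
               (p j * \<langle>f, \<zeta> s j\<rangle> / (\<Sum>i=1..J. p i / \<mu> i * \<langle>\<lambda>_. 1, \<zeta> s i\<rangle>)))
          + \<alpha> j * \<langle>f, \<theta> j\<rangle> * (LINT s:{0..t}|lborel. of_bool (nonzero_measures J (\<zeta> s)))) \<and>
     (traffic_intensity J K \<alpha> \<mu> > 1 \<longrightarrow> (\<forall>t>0. \<exists>j\<in>{1..J}. \<langle>\<lambda>_. 1, \<zeta> t j\<rangle> > 0))"

section \<open>The limiting Gaussian process\<close>

text \<open>\<open>Arr a j\<close> and \<open>Srv a j k i\<close> label the coordinates \<open>Y\<^bsub>f\<^sub>a\<^esub>\<^bsup>A\<^sub>j,j\<^esup>\<close>
  and \<open>Y\<^bsub>f\<^sub>a\<^esub>\<^bsup>V\<^sub>j\<^sup>k,i\<^esup>\<close>.\<close>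

datatype coord = Arr nat nat | Srv nat nat nat nat

definition coords :: "nat \<Rightarrow> nat \<Rightarrow> nat \<Rightarrow> coord set" where
  "coords n J K = {Arr a j | a j. a \<in> {1..n} \<and> j \<in> {1..J}} \<union>
     {Srv a j k i | a j k i. a \<in> {1..n} \<and> j \<in> {1..J} \<and> k \<in> {1..K} \<and> i \<in> {1..J}}"

definition triangle :: "real \<Rightarrow> (real \<times> real) set" where
  "triangle T = {(r, t). 0 \<le> r \<and> r \<le> t \<and> t \<le> T}"

definition Lp :: "nat \<Rightarrow> (nat \<Rightarrow> real) \<Rightarrow> (nat \<Rightarrow> real) \<Rightarrow> real" where
  "Lp J p z = (\<Sum>j=1..J. p j * z j)"

definition Lpmu :: "nat \<Rightarrow> (nat \<Rightarrow> real) \<Rightarrow> (nat \<Rightarrow> real) \<Rightarrow> (nat \<Rightarrow> real) \<Rightarrow> real" where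
  "Lpmu J \<mu> p z = (\<Sum>j=1..J. p j / \<mu> j * z j)"

definition masses :: "(nat \<Rightarrow> real measure) \<Rightarrow> nat \<Rightarrow> real" where
  "masses \<xi> j = \<langle>\<lambda>_. 1, \<xi> j\<rangle>"

definition arrival_cov ::
  "(nat \<Rightarrow> real) \<Rightarrow> (nat \<Rightarrow> real measure) \<Rightarrow> nat \<Rightarrow> (real \<Rightarrow> real) \<Rightarrow> (real \<Rightarrow> real) \<Rightarrow>
   real \<times> real \<Rightarrow> real \<times> real \<Rightarrow> real" where
  "arrival_cov \<alpha> \<theta> j f g = (\<lambda>(r\<^sub>1, t\<^sub>1) (r\<^sub>2, t\<^sub>2).
     LINT u:{0..min r\<^sub>1 r\<^sub>2}|lborel.
       \<alpha> j * (\<langle>\<lambda>y. translate (t\<^sub>1 - u) f y * translate (t\<^sub>2 - u) g y, \<theta> j\<rangle>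
              - \<langle>translate (t\<^sub>1 - u) f, \<theta> j\<rangle> * \<langle>translate (t\<^sub>2 - u) g, \<theta> j\<rangle>))"

definition service_cov ::
  "nat \<Rightarrow> (nat \<Rightarrow> real) \<Rightarrow> (nat \<Rightarrow> real) \<Rightarrow> (real \<Rightarrow> nat \<Rightarrow> real measure) \<Rightarrow> nat \<Rightarrow> nat \<Rightarrow> nat \<Rightarrow>
   (real \<Rightarrow> real) \<Rightarrow> (real \<Rightarrow> real) \<Rightarrow> real \<times> real \<Rightarrow> real \<times> real \<Rightarrow> real" where
  "service_cov J \<mu> p \<zeta> j c d f g = (\<lambda>(r\<^sub>1, t\<^sub>1) (r\<^sub>2, t\<^sub>2).
     LINT u:{0..min r\<^sub>1 r\<^sub>2}|lborel.
       (of_bool (c = d) *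
          (p c * \<langle>\<lambda>y. translate (t\<^sub>1 - u) f y * translate (t\<^sub>2 - u) g y, \<zeta> u c\<rangle>
             / Lp J p (masses (\<zeta> u)))
        - p c * p d * \<langle>translate (t\<^sub>1 - u) f, \<zeta> u c\<rangle> * \<langle>translate (t\<^sub>2 - u) g, \<zeta> u d\<rangle>
             / (Lp J p (masses (\<zeta> u)))\<^sup>2)
       * (p j * masses (\<zeta> u) j / Lpmu J \<mu> p (masses (\<zeta> u))))"

fun limit_cov ::
  "nat \<Rightarrow> (nat \<Rightarrow> real) \<Rightarrow> (nat \<Rightarrow> real) \<Rightarrow> (nat \<Rightarrow> real) \<Rightarrow> (nat \<Rightarrow> real measure) \<Rightarrow>
   (real \<Rightarrow> nat \<Rightarrow> real measure) \<Rightarrow> (nat \<Rightarrow> real \<Rightarrow> real) \<Rightarrow>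
   coord \<times> real \<times> real \<Rightarrow> coord \<times> real \<times> real \<Rightarrow> real" where
  "limit_cov J \<alpha> \<mu> p \<theta> \<zeta> f (Arr a j, x\<^sub>1) (Arr b j', x\<^sub>2) =
     (if j = j' then arrival_cov \<alpha> \<theta> j (f a) (f b) x\<^sub>1 x\<^sub>2 else 0)"
| "limit_cov J \<alpha> \<mu> p \<theta> \<zeta> f (Srv a j k c, x\<^sub>1) (Srv b j' k' d, x\<^sub>2) =
     (if j = j' \<and> k = k' then service_cov J \<mu> p \<zeta> j c d (f a) (f b) x\<^sub>1 x\<^sub>2 else 0)"
| "limit_cov J \<alpha> \<mu> p \<theta> \<zeta> f (Arr a j, x\<^sub>1) (Srv b j' k' d, x\<^sub>2) = 0"
| "limit_cov J \<alpha> \<mu> p \<theta> \<zeta> f (Srv a j k c, x\<^sub>1) (Arr b j' , x\<^sub>2) = 0"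

definition covariance :: "'w measure \<Rightarrow> ('w \<Rightarrow> real) \<Rightarrow> ('w \<Rightarrow> real) \<Rightarrow> real" where
  "covariance M X Y =
     integral\<^sup>L M (\<lambda>\<omega>. (X \<omega> - integral\<^sup>L M X) * (Y \<omega> - integral\<^sup>L M Y))"

text \<open>Point masses count as (degenerate) Gaussian laws.\<close>

definition gaussian_rv :: "'w measure \<Rightarrow> ('w \<Rightarrow> real) \<Rightarrow> bool" where
  "gaussian_rv M X \<longleftrightarrow> X \<in> borel_measurable M \<and>
     (\<exists>m. distr M borel X = return borel m \<or>
          (\<exists>\<sigma>>0. distributed M lborel X (normal_density m \<sigma>)))"

definition gaussian_process :: "'w measure \<Rightarrow> 'i set \<Rightarrow> ('i \<Rightarrow> 'w \<Rightarrow> real) \<Rightarrow> bool" where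
  "gaussian_process M I Y \<longleftrightarrow>
     (\<forall>S c. finite S \<and> S \<subseteq> I \<longrightarrow> gaussian_rv M (\<lambda>\<omega>. \<Sum>q\<in>S. c q * Y q \<omega>))"

text \<open>The index set carries the product of the discrete topology on the finitely many coordinates
  and the Euclidean topology on the triangle.  Continuous real functions on it are exactly the
  continuous maps from the triangle to \<open>\<real>\<^bsup>n(J+J\<^sup>2K)\<^esup>\<close>.\<close>

definition index_space :: "nat \<Rightarrow> nat \<Rightarrow> nat \<Rightarrow> real \<Rightarrow> (coord \<times> real \<times> real) topology" where
  "index_space n J K T = prod_topology (discrete_topology (coords n J K)) (top_of_set (triangle T))"

text \<open>A continuous process whose finite dimensional distributions are centred Gaussian with the
  covariances above.\<close>

definition limit_process ::
  "nat \<Rightarrow> nat \<Rightarrow> (nat \<Rightarrow> real) \<Rightarrow> (nat \<Rightarrow> real) \<Rightarrow> (nat \<Rightarrow> real) \<Rightarrow> (nat \<Rightarrow> real measure) \<Rightarrow>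
   (real \<Rightarrow> nat \<Rightarrow> real measure) \<Rightarrow> real \<Rightarrow> nat \<Rightarrow> (nat \<Rightarrow> real \<Rightarrow> real) \<Rightarrow>
   'w measure \<Rightarrow> (coord \<times> real \<times> real \<Rightarrow> 'w \<Rightarrow> real) \<Rightarrow> bool" where
  "limit_process J K \<alpha> \<mu> p \<theta> \<zeta> T n f M Y \<longleftrightarrow>
     prob_space M \<and>
     (\<forall>q \<in> coords n J K \<times> triangle T. Y q \<in> borel_measurable M) \<and>
     (\<forall>\<omega>\<in>space M. continuous_map (index_space n J K T) euclidean (\<lambda>q. Y q \<omega>)) \<and>
     gaussian_process M (coords n J K \<times> triangle T) Y \<and>
     (\<forall>q \<in> coords n J K \<times> triangle T. integral\<^sup>L M (Y q) = 0) \<and>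
     (\<forall>q\<^sub>1 \<in> coords n J K \<times> triangle T. \<forall>q\<^sub>2 \<in> coords n J K \<times> triangle T.
        covariance M (Y q\<^sub>1) (Y q\<^sub>2) = limit_cov J \<alpha> \<mu> p \<theta> \<zeta> f q\<^sub>1 q\<^sub>2)"

text \<open>The law of a continuous process is a measure on the space of continuous paths with the Borel
  sets of the uniform metric.  Since the index space is compact and metrizable, these Borel sets are
  generated by the evaluation maps, so the path map in \<open>path_law\<close> is measurable for every
  limit process.\<close>

definition path_space :: "nat \<Rightarrow> nat \<Rightarrow> nat \<Rightarrow> real \<Rightarrow> (coord \<times> real \<times> real \<Rightarrow> real) metric" where
  "path_space n J K T = cfunspace (index_space n J K T) euclidean_metric"

definition path_borel :: "nat \<Rightarrow> nat \<Rightarrow> nat \<Rightarrow> real \<Rightarrow> (coord \<times> real \<times> real \<Rightarrow> real) measure" where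
  "path_borel n J K T =
     sigma (mspace (path_space n J K T)) {U. openin (mtopology_of (path_space n J K T)) U}"

definition path_law ::
  "nat \<Rightarrow> nat \<Rightarrow> nat \<Rightarrow> real \<Rightarrow> 'w measure \<Rightarrow> (coord \<times> real \<times> real \<Rightarrow> 'w \<Rightarrow> real) \<Rightarrow>
   (coord \<times> real \<times> real \<Rightarrow> real) measure" where
  "path_law n J K T M Y =
     distr M (path_borel n J K T) (\<lambda>\<omega>. restrict (\<lambda>q. Y q \<omega>) (coords n J K \<times> triangle T))"

end

(* Existence. Kernels of the two kinds of blocks (one arrival stream, or one server with all classes)
   are integrals over u of a nonnegative rate times the covariance, under a mixture of the measures theta_j or
   zeta_c(u), of the translated test functions restricted to u <= r; hence they are positive
   semidefinite. Gaussian elimination (Cholesky) realizes such a kernel on a countable grid by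
   independent standard normals, and the Kolmogorov-Chentsov chaining argument extends the process
   continuously as soon as the variance of increments is Hoelder continuous.

   For test functions vanishing at 0 the translates are Lipschitz in the shift, so this is clear. For
   the constant 1 the increment of the translates is the indicator of an interval, and one needs a
   Hoelder bound for zeta_j(u) on intervals, uniformly in u. Testing the fluid equation with functions
   that travel to the left at unit speed gives
     zeta_j(u)(t-u, t-u+d] <= zeta_j(0)(t, t+d] + alpha_j * int_0^u theta_j(t-s, t-s+d] ds,
   because departures only remove mass; the right-hand side is Hoelder in d by assumption.

   Uniqueness. The covariances determine the characteristic functions of all linear combinations, these
   determine the finite dimensional distributions (one coordinate at a time, by Levy's one-dimensional
   uniqueness theorem under tilted measures), and the Borel sets of the separable path space are traces
   of the product sigma-algebra. *)

theory Submission
  imports Defs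
begin

section \<open>Gaussian sequences with a given covariance\<close>

text \<open>Obstacles that shape the proof. The exponent in the variance bound may be arbitrarily
  small, so second moments of increments cannot beat the growing number of grid points; chaining
  succeeds because the variance controls Gaussian moments of every even order. Increments may be
  degenerate, so centred Gaussian laws are handled through the characteristic function exp (- s^2 v
  / 2), which includes v = 0 and passes to limits. Continuity is demanded at every sample point, so
  paths have to be repaired on a null event. The fluid equation holds for one fixed test function,
  whereas the travelling function changes with time. Its profile is only C^1 and its pairing need
  not be differentiable in time; increments over short steps are therefore compared with an error
  quadratic in the step, and summed. The set of continuous paths need not belong to the product
  sigma-algebra over the uncountable triangle, which is why laws on path space are compared through
  traces. The sample space is prescribed by the theorem, so the countably many normals have to be
  embedded into its index type.\<close>

definition psd_nat :: "(nat \<Rightarrow> nat \<Rightarrow> real) \<Rightarrow> bool" where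
  "psd_nat k \<longleftrightarrow> (\<forall>n m. k n m = k m n) \<and>
     (\<forall>N c. 0 \<le> (\<Sum>n<N. \<Sum>m<N. c n * c m * k n m))"

text \<open>One step of Gaussian elimination; for \<open>k i i = 0\<close> the quotient is 0.\<close>

definition residual :: "nat \<Rightarrow> (nat \<Rightarrow> nat \<Rightarrow> real) \<Rightarrow> nat \<Rightarrow> nat \<Rightarrow> real" where
  "residual i k n m = k n m - k n i * k m i / k i i"

lemma psd_natD: "psd_nat k \<Longrightarrow> 0 \<le> (\<Sum>n<N. \<Sum>m<N. c n * c m * k n m)"
  by (simp add: psd_nat_def)

text \<open>Expansion of the form at c - d e_i. For a positive pivot it is a quadratic polynomial in
  d, minimal at d = (\<Sum>n<N. c n * k n i) / k i i, and the minimum is the form of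
  \<open>residual i k\<close> at c.\<close>

lemma quadratic_form_shift:
  fixes k :: "nat \<Rightarrow> nat \<Rightarrow> real"
  assumes sym: "\<And>n m. k n m = k m n" and i: "i < N"
  shows "(\<Sum>n<N. \<Sum>m<N. (c n - (if n = i then d else 0)) * (c m - (if m = i then d else 0)) * k n m)
    = (\<Sum>n<N. \<Sum>m<N. c n * c m * k n m) - 2 * d * (\<Sum>n<N. c n * k n i) + d\<^sup>2 * k i i"
proof -
  have inner: "(\<Sum>m<N. (c m - (if m = i then d else 0)) * k n m) = (\<Sum>m<N. c m * k n m) - d * k n i" for n
  proof -
    have "(\<Sum>m<N. (c m - (if m = i then d else 0)) * k n m)
      = (\<Sum>m<N. c m * k n m - (if m = i then d * k n i else 0))"
      by (intro sum.cong refl) (auto simp: algebra_simps)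
    then show ?thesis using i by (simp add: sum_subtractf)
  qed
  have "(\<Sum>n<N. \<Sum>m<N. (c n - (if n = i then d else 0)) * (c m - (if m = i then d else 0)) * k n m)
    = (\<Sum>n<N. (c n - (if n = i then d else 0)) * ((\<Sum>m<N. c m * k n m) - d * k n i))"
    by (simp add: inner[symmetric] sum_distrib_left mult.assoc)
  also have "\<dots> = (\<Sum>n<N. c n * ((\<Sum>m<N. c m * k n m) - d * k n i)
      - (if n = i then d * ((\<Sum>m<N. c m * k i m) - d * k i i) else 0))"
    by (intro sum.cong refl) (auto simp: algebra_simps)
  also have "\<dots> = (\<Sum>n<N. c n * ((\<Sum>m<N. c m * k n m) - d * k n i))
      - d * ((\<Sum>m<N. c m * k i m) - d * k i i)"
    using i by (simp add: sum_subtractf)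
  also have "(\<Sum>m<N. c m * k i m) = (\<Sum>n<N. c n * k n i)" by (simp add: sym[of i])
  also have "(\<Sum>n<N. c n * ((\<Sum>m<N. c m * k n m) - d * k n i))
      = (\<Sum>n<N. \<Sum>m<N. c n * c m * k n m) - d * (\<Sum>n<N. c n * k n i)"
    by (simp add: right_diff_distrib sum_subtractf sum_distrib_left mult_ac)
  finally show ?thesis by (simp add: algebra_simps power2_eq_square)
qed

text \<open>Padding with zeros: the pivot i need not lie below N, so the range has to be enlarged
  before the pivot can be shifted.\<close>

lemma quadratic_form_extend:
  fixes k :: "nat \<Rightarrow> nat \<Rightarrow> real"
  assumes "N \<le> N'"
  shows "(\<Sum>n<N'. \<Sum>m<N'. (if n < N then c n else 0) * (if m < N then c m else 0) * k n m)
    = (\<Sum>n<N. \<Sum>m<N. c n * c m * k n m)"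
proof -
  have "(\<Sum>n<N'. \<Sum>m<N'. (if n < N then c n else 0) * (if m < N then c m else 0) * k n m)
    = (\<Sum>n<N. \<Sum>m<N'. c n * (if m < N then c m else 0) * k n m)"
    using assms by (intro sum.mono_neutral_cong_right) auto
  also have "\<dots> = (\<Sum>n<N. \<Sum>m<N. c n * c m * k n m)"
    using assms by (intro sum.cong refl sum.mono_neutral_cong_right) auto
  finally show ?thesis .
qed

text \<open>Two successive shifts of the zero vector add y at m and x at i. Written as increments,
  this covers i = m as well.\<close>

lemma psd_nat_two:
  assumes "psd_nat k"
  shows "0 \<le> x\<^sup>2 * k i i + 2 * x * y * k i m + y\<^sup>2 * k m m"
proof -
  have sym: "\<And>n m. k n m = k m n" using assms by (auto simp: psd_nat_def)
  define N where "N = Suc (max i m)"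
  have iN: "i < N" and mN: "m < N" by (auto simp: N_def)
  let ?e = "\<lambda>n. (0::real) - (if n = m then - y else 0)"
  have "0 \<le> (\<Sum>n<N. \<Sum>l<N. (?e n - (if n = i then - x else 0)) * (?e l - (if l = i then - x else 0)) * k n l)"
    by (rule psd_natD[OF assms])
  also have "\<dots> = (\<Sum>n<N. \<Sum>l<N. ?e n * ?e l * k n l) - 2 * (-x) * (\<Sum>n<N. ?e n * k n i) + (-x)\<^sup>2 * k i i"
    by (rule quadratic_form_shift[OF sym iN])
  also have "(\<Sum>n<N. \<Sum>l<N. ?e n * ?e l * k n l) = y\<^sup>2 * k m m"
    by (subst quadratic_form_shift[OF sym mN]) simp
  also have "(\<Sum>n<N. ?e n * k n i) = (\<Sum>n<N. if n = m then y * k m i else 0)"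
    by (intro sum.cong refl) auto
  also have "\<dots> = y * k m i" using mN by simp
  finally show ?thesis by (simp add: sym[of m i] algebra_simps)
qed

lemma psd_nat_diag_nonneg: "psd_nat k \<Longrightarrow> 0 \<le> k i i"
  using psd_nat_two[of k 1 i 0] by simp

lemma psd_nat_diag_zero:
  assumes "psd_nat k" "k i i = 0"
  shows "k i m = 0"
proof (rule ccontr)
  assume "k i m \<noteq> 0"
  \<comment> \<open>With y = 1 and a zero diagonal entry the form is affine in x, and this x gives
    it the value -1.\<close>
  then show False
    using psd_nat_two[OF assms(1), of "- (k m m + 1) / (2 * k i m)" i 1 m] assms(2)
    by (simp add: field_simps)
qed

lemma psd_nat_residual:
  assumes k: "psd_nat k"
  shows "psd_nat (residual i k)"
proof -
  have sym: "\<And>n m. k n m = k m n" using k by (auto simp: psd_nat_def)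
  have "0 \<le> (\<Sum>n<N. \<Sum>m<N. c n * c m * residual i k n m)" for N c
  proof (cases "k i i = 0")
    case True
    then show ?thesis using k by (auto simp: psd_nat_def residual_def)
  next
    case False
    define N' where "N' = max N (Suc i)"
    define c' where "c' = (\<lambda>n. if n < N then c n else 0)"
    define b where "b = (\<Sum>n<N'. c' n * k n i)"
    have iN: "i < N'" and NN: "N \<le> N'" by (auto simp: N'_def)
    \<comment> \<open>The shift b / k i i minimises the form, so the residual form at
      \<open>c'\<close> is itself a value of the form of k.\<close>
    have "0 \<le> (\<Sum>n<N'. \<Sum>m<N'. (c' n - (if n = i then b / k i i else 0)) *
        (c' m - (if m = i then b / k i i else 0)) * k n m)"
      by (rule psd_natD[OF k])
    also have "\<dots> = (\<Sum>n<N'. \<Sum>m<N'. c' n * c' m * k n m) - 2 * (b / k i i) * b + (b / k i i)\<^sup>2 * k i i"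
      unfolding b_def by (rule quadratic_form_shift[OF sym iN])
    also have "\<dots> = (\<Sum>n<N'. \<Sum>m<N'. c' n * c' m * k n m) - b * b / k i i"
      using False by (simp add: field_simps power2_eq_square)
    also have "\<dots> = (\<Sum>n<N'. \<Sum>m<N'. c' n * c' m * residual i k n m)"
      unfolding residual_def b_def sum_product
      by (simp add: right_diff_distrib sum_subtractf sum_divide_distrib mult_ac)
    also have "\<dots> = (\<Sum>n<N. \<Sum>m<N. c n * c m * residual i k n m)"
      unfolding c'_def by (rule quadratic_form_extend[OF NN])
    finally show ?thesis .
  qed
  moreover have "residual i k n m = residual i k m n" for n m
    by (simp add: residual_def sym[of n m] mult.commute)
  ultimately show ?thesis by (auto simp: psd_nat_def)
qed

primrec residuals :: "(nat \<Rightarrow> nat \<Rightarrow> real) \<Rightarrow> nat \<Rightarrow> nat \<Rightarrow> nat \<Rightarrow> real" where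
  "residuals k 0 = k"
| "residuals k (Suc i) = residual i (residuals k i)"

text \<open>Column i is the i-th residual column divided by the square root of its pivot. A zero
  pivot yields the zero column, since division by 0 gives 0; for a semidefinite kernel the residual
  column is then zero as well.\<close>

definition cholesky :: "(nat \<Rightarrow> nat \<Rightarrow> real) \<Rightarrow> nat \<Rightarrow> nat \<Rightarrow> real" where
  "cholesky k n i = residuals k i n i / sqrt (residuals k i i i)"

lemma psd_nat_residuals: "psd_nat k \<Longrightarrow> psd_nat (residuals k i)"
  by (induction i) (auto intro: psd_nat_residual)

text \<open>Row i is cleared at step i, by the subtraction if the pivot is nonzero and by
  semidefiniteness if it is zero. Later steps subtract multiples of zero from it.\<close>

lemma residuals_zero:
  assumes "psd_nat k" "n < i"
  shows "residuals k i n m = 0"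
  using assms(2)
proof (induction i arbitrary: n m)
  case (Suc i)
  have psd: "psd_nat (residuals k i)" by (rule psd_nat_residuals[OF assms(1)])
  show ?case
  proof (cases "n = i")
    case True
    have "residuals k i i m = residuals k i m i" using psd by (auto simp: psd_nat_def)
    then show ?thesis using True psd_nat_diag_zero[OF psd, of i m]
      by (cases "residuals k i i i = 0") (auto simp: residual_def)
  next
    case False
    then show ?thesis using Suc.IH[of n] Suc.prems by (simp add: residual_def)
  qed
qed simp

lemma cholesky_zero: "psd_nat k \<Longrightarrow> n < i \<Longrightarrow> cholesky k n i = 0"
  by (simp add: cholesky_def residuals_zero)

text \<open>The first N columns and the N-th residual always add up to k, by telescoping; no row n
  is left in the residual once n < N.\<close>

lemma cholesky:
  assumes k: "psd_nat k" and "n < N"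
  shows "k n m = (\<Sum>i<N. cholesky k n i * cholesky k m i)"
proof -
  have "k n m = (\<Sum>i<N. cholesky k n i * cholesky k m i) + residuals k N n m" for N
  proof (induction N)
    case (Suc N)
    have "0 \<le> residuals k N N N"
      by (rule psd_nat_diag_nonneg[OF psd_nat_residuals[OF k]])
    then have "cholesky k n N * cholesky k m N = residuals k N n N * residuals k N m N / residuals k N N N"
      by (simp add: cholesky_def)
    then show ?case using Suc by (simp add: residual_def)
  qed simp
  then show ?thesis using residuals_zero[OF k \<open>n < N\<close>, of m] by (metis add.right_neutral)
qed

text \<open>A characteristic function instead of a density: v = 0 needs no separate treatment, and
  pointwise limits keep the form.\<close>

definition centred_gaussian :: "'w measure \<Rightarrow> ('w \<Rightarrow> real) \<Rightarrow> real \<Rightarrow> bool" where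
  "centred_gaussian M X v \<longleftrightarrow> X \<in> borel_measurable M \<and> 0 \<le> v \<and>
     (\<forall>s. char (distr M borel X) s = complex_of_real (exp (- (s\<^sup>2 * v) / 2)))"

lemma char_distr_scale:
  assumes [measurable]: "X \<in> borel_measurable M"
  shows "char (distr M borel (\<lambda>\<omega>. a * X \<omega>)) s = char (distr M borel X) (s * a)"
  by (simp add: char_def integral_distr mult_ac)

context prob_space
begin

text \<open>The law is that of a rescaled standard normal, also for v = 0, so all moments can be
  transported from the standard normal.\<close>

lemma centred_gaussian_distr:
  assumes "centred_gaussian M X v"
  shows "distr M borel X = distr std_normal_distribution borel (\<lambda>x. sqrt v * x)"
proof (rule Levy_uniqueness)
  have [measurable]: "X \<in> borel_measurable M" using assms by (simp add: centred_gaussian_def)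
  interpret N: prob_space std_normal_distribution by (rule prob_space_normal_density) simp
  show "real_distribution (distr M borel X)" by simp
  show "real_distribution (distr std_normal_distribution borel (\<lambda>x. sqrt v * x))" by simp
  have id: "distr std_normal_distribution borel (\<lambda>x. x) = std_normal_distribution"
    by (intro distr_id2) simp
  show "char (distr M borel X) = char (distr std_normal_distribution borel (\<lambda>x. sqrt v * x))"
  proof
    fix s
    have "char (distr std_normal_distribution borel (\<lambda>x. sqrt v * x)) s
      = char (distr std_normal_distribution borel (\<lambda>x. x)) (s * sqrt v)"
      by (rule char_distr_scale) simp
    also have "\<dots> = complex_of_real (exp (- (s\<^sup>2 * v) / 2))"
      using assms by (simp add: id char_std_normal_distribution power_mult_distrib centred_gaussian_def)
    finally show "char (distr M borel X) s = char (distr std_normal_distribution borel (\<lambda>x. sqrt v * x)) s"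
      using assms by (simp add: centred_gaussian_def)
  qed
qed

lemma centred_gaussian_rv:
  assumes G: "centred_gaussian M X v"
  shows "gaussian_rv M X"
proof -
  have [measurable]: "X \<in> borel_measurable M" and v: "0 \<le> v"
    using assms by (simp_all add: centred_gaussian_def)
  interpret N: prob_space std_normal_distribution by (rule prob_space_normal_density) simp
  show ?thesis
  proof (cases "v = 0")
    case True
    have "distr M borel X = return borel 0"
      using centred_gaussian_distr[OF G] True by (simp add: N.distr_const)
    then show ?thesis by (auto simp: gaussian_rv_def)
  next
    case False
    have "distributed std_normal_distribution lborel (\<lambda>x. x) std_normal_density"
      by (auto simp: distributed_def intro!: distr_id2)
    then have "distributed std_normal_distribution lborel (\<lambda>x. 0 + sqrt v * x)
        (normal_density (0 + sqrt v * 0) (\<bar>sqrt v\<bar> * 1))"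
      using False v by (intro N.normal_density_affine) auto
    then have "distr std_normal_distribution lborel (\<lambda>x. sqrt v * x)
        = density lborel (\<lambda>x. ennreal (normal_density 0 (sqrt v) x))"
      using v by (simp add: distributed_def)
    moreover have "distr std_normal_distribution lborel (\<lambda>x. sqrt v * x)
        = distr std_normal_distribution borel (\<lambda>x. sqrt v * x)"
      by (rule distr_cong) auto
    moreover have "distr M lborel X = distr M borel X" by (rule distr_cong) auto
    ultimately have "distributed M lborel X (normal_density 0 (sqrt v))"
      using centred_gaussian_distr[OF G] by (simp add: distributed_def)
    then show ?thesis using False v unfolding gaussian_rv_def
      by (intro conjI exI[of _ "0::real"] disjI2 exI[of _ "sqrt v"]) auto
  qed
qed

lemma centred_gaussian_moment:
  assumes G: "centred_gaussian M X v"
  shows "integrable M (\<lambda>\<omega>. X \<omega> ^ (2 * k))"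
    and "expectation (\<lambda>\<omega>. X \<omega> ^ (2 * k)) = v ^ k * (fact (2 * k) / (2 ^ k * fact k))"
proof -
  have [measurable]: "X \<in> borel_measurable M" and v: "0 \<le> v"
    using assms by (simp_all add: centred_gaussian_def)
  have i: "has_bochner_integral std_normal_distribution (\<lambda>x::real. x ^ (2 * k)) (fact (2 * k) / (2 ^ k * fact k))"
    by (rule has_bochner_integral_density)
      (use std_normal_moment_even[of k] in \<open>auto simp: normal_density_nonneg\<close>)
  have *: "has_bochner_integral std_normal_distribution (\<lambda>x::real. (sqrt v * x) ^ (2 * k))
      (v ^ k * (fact (2 * k) / (2 ^ k * fact k)))"
    using has_bochner_integral_mult_right[of "v ^ k", OF i] v
    by (simp add: power_mult_distrib power_mult)
  have "has_bochner_integral (distr M borel X) (\<lambda>x. x ^ (2 * k))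
      (v ^ k * (fact (2 * k) / (2 ^ k * fact k)))"
    unfolding centred_gaussian_distr[OF G] by (intro has_bochner_integral_distr *) auto
  then show "integrable M (\<lambda>\<omega>. X \<omega> ^ (2 * k))"
    "expectation (\<lambda>\<omega>. X \<omega> ^ (2 * k)) = v ^ k * (fact (2 * k) / (2 ^ k * fact k))"
    by (simp_all add: has_bochner_integral_iff integrable_distr_eq integral_distr)
qed

lemma centred_gaussian_square:
  assumes "centred_gaussian M X v"
  shows "integrable M (\<lambda>\<omega>. (X \<omega>)\<^sup>2)" "expectation (\<lambda>\<omega>. (X \<omega>)\<^sup>2) = v"
  using centred_gaussian_moment[OF assms, of 1] by (simp_all add: fact_2)

lemma centred_gaussian_mean:
  assumes G: "centred_gaussian M X v"
  shows "integrable M X" "expectation X = 0"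
proof -
  have [measurable]: "X \<in> borel_measurable M" using assms by (simp add: centred_gaussian_def)
  show "integrable M X"
    by (rule square_integrable_imp_integrable[OF _ centred_gaussian_square(1)[OF G]]) simp
  have "expectation X = integral\<^sup>L (distr M borel X) (\<lambda>x. x)" by (simp add: integral_distr)
  also have "\<dots> = sqrt v * (\<integral>x. x \<partial>std_normal_distribution)"
    unfolding centred_gaussian_distr[OF G] by (simp add: integral_distr)
  also have "(\<integral>x. x \<partial>std_normal_distribution) = 0"
    using std_normal_moment_odd[of 0]
    by (subst integral_density) (auto simp: has_bochner_integral_iff normal_density_nonneg)
  finally show "expectation X = 0" by simp
qed

text \<open>Markov's inequality for the power 2k. The order k stays free, because the chaining has
  to choose it depending on the Hoelder exponent.\<close>

lemma centred_gaussian_tail: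
  assumes G: "centred_gaussian M X v" and l: "0 < l"
  shows "prob {\<omega>\<in>space M. l \<le> \<bar>X \<omega>\<bar>} \<le> fact (2 * k) / (2 ^ k * fact k) * (v / l\<^sup>2) ^ k"
proof -
  have [measurable]: "X \<in> borel_measurable M" using assms by (simp add: centred_gaussian_def)
  have "prob {\<omega>\<in>space M. l \<le> \<bar>X \<omega>\<bar>} \<le> prob {\<omega>\<in>space M. l ^ (2 * k) \<le> X \<omega> ^ (2 * k)}"
  proof (intro finite_measure_mono subsetI)
    fix \<omega> assume "\<omega> \<in> {\<omega>\<in>space M. l \<le> \<bar>X \<omega>\<bar>}"
    then have "\<omega> \<in> space M" "l ^ (2 * k) \<le> \<bar>X \<omega>\<bar> ^ (2 * k)" using l by (auto intro: power_mono)
    then show "\<omega> \<in> {\<omega>\<in>space M. l ^ (2 * k) \<le> X \<omega> ^ (2 * k)}" by (simp add: power_even_abs)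
  qed simp
  also have "\<dots> \<le> expectation (\<lambda>\<omega>. X \<omega> ^ (2 * k)) / l ^ (2 * k)"
    using l by (intro integral_Markov_inequality_measure[where A="{}"] centred_gaussian_moment(1)[OF G])
      (auto simp: zero_le_even_power)
  also have "\<dots> = fact (2 * k) / (2 ^ k * fact k) * (v / l\<^sup>2) ^ k"
    using centred_gaussian_moment(2)[OF G, of k] by (simp add: power_mult power_divide)
  finally show ?thesis .
qed

end

text \<open>The normals are indexed by an arbitrary type into which the naturals embed, because the
  theorem prescribes a sample space of functions on its own index type. Only the coordinates in the
  range of \<open>e\<close> are used.\<close>

lemma char_sum_std_normals:
  fixes e :: "nat \<Rightarrow> 'i" and a :: "nat \<Rightarrow> real"
  assumes "inj e"
  defines "M \<equiv> PiM (UNIV :: 'i set) (\<lambda>_. std_normal_distribution)"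
  shows "char (distr M borel (\<lambda>\<omega>. \<Sum>i<N. a i * \<omega> (e i))) s
    = complex_of_real (exp (- (s\<^sup>2 * (\<Sum>i<N. (a i)\<^sup>2)) / 2))"
proof -
  have ps: "prob_space std_normal_distribution" by (rule prob_space_normal_density) simp
  interpret prob_space M unfolding M_def by (intro prob_space_PiM ps)
  have [measurable]: "(\<lambda>\<omega>. \<omega> i) \<in> borel_measurable M" for i
    unfolding M_def using measurable_component_singleton[of i UNIV "\<lambda>_. std_normal_distribution"] by simp
  have "indep_vars (\<lambda>_. std_normal_distribution) (\<lambda>i \<omega>. \<omega> i) (UNIV :: 'i set)"
  proof (subst indep_vars_iff_distr_eq_PiM')
    have "distr M M (\<lambda>\<omega>. \<lambda>i\<in>UNIV. \<omega> i) = M" by (simp add: restrict_UNIV)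
    moreover have "distr M std_normal_distribution (\<lambda>\<omega>. \<omega> i) = std_normal_distribution" for i
      unfolding M_def by (rule distr_PiM_component) (auto intro: ps)
    ultimately show "distr M (PiM UNIV (\<lambda>_. std_normal_distribution)) (\<lambda>\<omega>. \<lambda>i\<in>UNIV. \<omega> i)
        = PiM UNIV (\<lambda>i. distr M std_normal_distribution (\<lambda>\<omega>. \<omega> i))"
      by (simp add: M_def)
    show "(\<lambda>\<omega>. \<omega> i) \<in> measurable M std_normal_distribution" for i
      unfolding M_def by (rule measurable_component_singleton) simp
  qed simp
  \<comment> \<open>The factors are indexed by points of the large type; \<open>inv e\<close>
    recovers the number of a coordinate.\<close>
  then have "indep_vars (\<lambda>_. borel) (\<lambda>i \<omega>. a (inv e i) * \<omega> i) UNIV"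
    by (rule indep_vars_compose2) simp
  then have "indep_vars (\<lambda>_. borel) (\<lambda>i \<omega>. a (inv e i) * \<omega> i) (e ` {..<N})"
    by (rule indep_vars_subset) simp
  then have "char (distr M borel (\<lambda>\<omega>. \<Sum>i\<in>e ` {..<N}. a (inv e i) * \<omega> i)) s
      = (\<Prod>i\<in>e ` {..<N}. char (distr M borel (\<lambda>\<omega>. a (inv e i) * \<omega> i)) s)"
    by (rule char_distr_sum)
  then have "char (distr M borel (\<lambda>\<omega>. \<Sum>i<N. a i * \<omega> (e i))) s
      = (\<Prod>i<N. char (distr M borel (\<lambda>\<omega>. a i * \<omega> (e i))) s)"
    using assms(1) by (simp add: sum.reindex prod.reindex inj_on_subset)
  also have "\<dots> = (\<Prod>i<N. complex_of_real (exp (- (s * a i)\<^sup>2 / 2)))"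
  proof (intro prod.cong refl)
    fix i
    have "distr M borel (\<lambda>\<omega>. \<omega> (e i)) = distr M std_normal_distribution (\<lambda>\<omega>. \<omega> (e i))"
      by (rule distr_cong) auto
    also have "\<dots> = std_normal_distribution"
      unfolding M_def by (rule distr_PiM_component) (auto intro: ps)
    finally show "char (distr M borel (\<lambda>\<omega>. a i * \<omega> (e i))) s = complex_of_real (exp (- (s * a i)\<^sup>2 / 2))"
      by (simp add: char_distr_scale char_std_normal_distribution)
  qed
  also have "\<dots> = complex_of_real (exp (\<Sum>i<N. - (s * a i)\<^sup>2 / 2))"
    by (simp add: exp_sum)
  also have "(\<Sum>i<N. - (s * a i)\<^sup>2 / 2) = - (s\<^sup>2 * (\<Sum>i<N. (a i)\<^sup>2)) / 2"
    by (simp add: power_mult_distrib sum_distrib_left sum_negf sum_divide_distrib)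
  finally show ?thesis .
qed

text \<open>\<open>X n\<close> is row n of the Cholesky factor applied to independent normals. The
  factor is triangular, so each row is a finite sum that does not depend on how many variables are
  combined.\<close>

lemma gaussian_sequence:
  fixes k :: "nat \<Rightarrow> nat \<Rightarrow> real" and e :: "nat \<Rightarrow> 'i"
  assumes k: "psd_nat k" and "inj e"
  shows "\<exists>(M :: ('i \<Rightarrow> real) measure) X. prob_space M \<and>
    (\<forall>N c. centred_gaussian M (\<lambda>\<omega>. \<Sum>n<N. c n * X n \<omega>) (\<Sum>n<N. \<Sum>m<N. c n * c m * k n m))"
proof (intro exI conjI allI)
  let ?M = "PiM (UNIV :: 'i set) (\<lambda>_. std_normal_distribution)"
  let ?X = "\<lambda>n \<omega>. \<Sum>i<Suc n. cholesky k n i * \<omega> (e i)"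
  show "prob_space ?M" by (intro prob_space_PiM prob_space_normal_density) simp
  fix N and c :: "nat \<Rightarrow> real"
  define a where "a = (\<lambda>i. \<Sum>n<N. c n * cholesky k n i)"
  have meas [measurable]: "(\<lambda>\<omega>. \<omega> i) \<in> borel_measurable ?M" for i
    using measurable_component_singleton[of i UNIV "\<lambda>_. std_normal_distribution"] by simp
  have X: "?X n \<omega> = (\<Sum>i<N. cholesky k n i * \<omega> (e i))" if "n < N" for n \<omega>
    using that by (intro sum.mono_neutral_left) (auto simp: cholesky_zero[OF k])
  have eq: "(\<lambda>\<omega>. \<Sum>n<N. c n * ?X n \<omega>) = (\<lambda>\<omega>. \<Sum>i<N. a i * \<omega> (e i))"
  proof
    fix \<omega> :: "'i \<Rightarrow> real"
    have "(\<Sum>n<N. c n * ?X n \<omega>) = (\<Sum>n<N. \<Sum>i<N. c n * cholesky k n i * \<omega> (e i))"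
      by (intro sum.cong refl) (simp only: X lessThan_iff sum_distrib_left mult.assoc)
    also have "\<dots> = (\<Sum>i<N. a i * \<omega> (e i))"
      unfolding a_def by (subst sum.swap) (simp add: sum_distrib_right)
    finally show "(\<Sum>n<N. c n * ?X n \<omega>) = (\<Sum>i<N. a i * \<omega> (e i))" .
  qed
  have "(\<Sum>i<N. (a i)\<^sup>2) = (\<Sum>i<N. \<Sum>n<N. \<Sum>m<N. c n * c m * (cholesky k n i * cholesky k m i))"
    unfolding a_def power2_eq_square sum_product by (intro sum.cong refl) (simp add: mult_ac)
  also have "\<dots> = (\<Sum>n<N. \<Sum>i<N. \<Sum>m<N. c n * c m * (cholesky k n i * cholesky k m i))"
    by (rule sum.swap)
  also have "\<dots> = (\<Sum>n<N. \<Sum>m<N. \<Sum>i<N. c n * c m * (cholesky k n i * cholesky k m i))"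
    by (intro sum.cong refl sum.swap)
  also have "\<dots> = (\<Sum>n<N. \<Sum>m<N. c n * c m * k n m)"
    by (intro sum.cong refl) (simp add: cholesky[OF k] sum_distrib_left)
  finally have v: "(\<Sum>i<N. (a i)\<^sup>2) = (\<Sum>n<N. \<Sum>m<N. c n * c m * k n m)" .
  show "centred_gaussian ?M (\<lambda>\<omega>. \<Sum>n<N. c n * ?X n \<omega>) (\<Sum>n<N. \<Sum>m<N. c n * c m * k n m)"
    unfolding eq centred_gaussian_def
    using char_sum_std_normals[OF assms(2), where a=a and N=N] v psd_natD[OF k, of c N]
    by (auto intro!: borel_measurable_sum borel_measurable_times)
qed

section \<open>Gaussian processes and their covariances\<close>

context prob_space
begin

lemma integrable_mult_square:
  fixes X Y :: "'a \<Rightarrow> real"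
  assumes [measurable]: "X \<in> borel_measurable M" "Y \<in> borel_measurable M"
    and X: "integrable M (\<lambda>\<omega>. (X \<omega>)\<^sup>2)" and Y: "integrable M (\<lambda>\<omega>. (Y \<omega>)\<^sup>2)"
  shows "integrable M (\<lambda>\<omega>. X \<omega> * Y \<omega>)"
proof (rule Bochner_Integration.integrable_bound)
  show "integrable M (\<lambda>\<omega>. (X \<omega>)\<^sup>2 + (Y \<omega>)\<^sup>2)" using X Y by simp
  show "AE \<omega> in M. norm (X \<omega> * Y \<omega>) \<le> norm ((X \<omega>)\<^sup>2 + (Y \<omega>)\<^sup>2)"
  proof (intro AE_I2)
    fix \<omega>
    have "2 * (\<bar>X \<omega>\<bar> * \<bar>Y \<omega>\<bar>) \<le> (X \<omega>)\<^sup>2 + (Y \<omega>)\<^sup>2"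
      using sum_squares_bound[of "\<bar>X \<omega>\<bar>" "\<bar>Y \<omega>\<bar>"] by simp
    moreover have "0 \<le> \<bar>X \<omega>\<bar> * \<bar>Y \<omega>\<bar>" by simp
    ultimately show "norm (X \<omega> * Y \<omega>) \<le> norm ((X \<omega>)\<^sup>2 + (Y \<omega>)\<^sup>2)"
      unfolding real_norm_def abs_mult[of "X \<omega>"] by linarith
  qed
qed simp

text \<open>Both shapes of a Gaussian law, point mass and normal density, reduce to one
  characteristic function once the mean is 0; the variance is then identified as the second
  moment.\<close>

lemma gaussian_rv_centred:
  assumes G: "gaussian_rv M X" and mean: "expectation X = 0"
  shows "integrable M (\<lambda>\<omega>. (X \<omega>)\<^sup>2)" "centred_gaussian M X (expectation (\<lambda>\<omega>. (X \<omega>)\<^sup>2))"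
proof -
  have X [measurable]: "X \<in> borel_measurable M" using G by (simp add: gaussian_rv_def)
  have "\<exists>v. centred_gaussian M X v"
  proof (cases "\<exists>m. distr M borel X = return borel m")
    case True
    then obtain m where m: "distr M borel X = return borel m" by blast
    have "m = integral\<^sup>L (distr M borel X) (\<lambda>x. x)" unfolding m by (simp add: integral_return)
    then have "m = 0" using mean by (simp add: integral_distr)
    then have "centred_gaussian M X 0"
      using m by (simp add: centred_gaussian_def char_def integral_return)
    then show ?thesis ..
  next
    case False
    then obtain m \<sigma> where \<sigma>: "\<sigma> > 0" and D: "distributed M lborel X (normal_density m \<sigma>)"
      using G by (auto simp: gaussian_rv_def)
    have "m = 0" using normal_distributed_expectation[OF \<sigma> D] mean by simp
    then have "distributed M lborel (\<lambda>\<omega>. X \<omega> / \<sigma>) std_normal_density"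
      using D normal_standard_normal_convert[OF \<sigma>, of X m] by simp
    then have "distr M lborel (\<lambda>\<omega>. X \<omega> / \<sigma>) = std_normal_distribution"
      by (simp add: distributed_def)
    moreover have "distr M lborel (\<lambda>\<omega>. X \<omega> / \<sigma>) = distr M borel (\<lambda>\<omega>. X \<omega> / \<sigma>)"
      by (rule distr_cong) auto
    ultimately have Z: "distr M borel (\<lambda>\<omega>. X \<omega> / \<sigma>) = std_normal_distribution" by simp
    have "char (distr M borel X) s = complex_of_real (exp (- (s\<^sup>2 * \<sigma>\<^sup>2) / 2))" for s
    proof -
      have "char (distr M borel X) s = char (distr M borel (\<lambda>\<omega>. \<sigma> * (X \<omega> / \<sigma>))) s" using \<sigma> by simp
      also have "\<dots> = char (distr M borel (\<lambda>\<omega>. X \<omega> / \<sigma>)) (s * \<sigma>)" by (rule char_distr_scale) simp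
      finally show ?thesis by (simp add: Z char_std_normal_distribution power_mult_distrib)
    qed
    then have "centred_gaussian M X (\<sigma>\<^sup>2)" by (simp add: centred_gaussian_def)
    then show ?thesis ..
  qed
  then obtain v where v: "centred_gaussian M X v" by blast
  show "integrable M (\<lambda>\<omega>. (X \<omega>)\<^sup>2)" by (rule centred_gaussian_square(1)[OF v])
  show "centred_gaussian M X (expectation (\<lambda>\<omega>. (X \<omega>)\<^sup>2))"
    using v centred_gaussian_square(2)[OF v] by simp
qed

text \<open>The direction used for uniqueness: mean and covariance determine the law of every linear
  combination.\<close>

lemma gaussian_process_centred:
  assumes G: "gaussian_process M I Y" and mean: "\<And>q. q \<in> I \<Longrightarrow> expectation (Y q) = 0"
    and cov: "\<And>q r. q \<in> I \<Longrightarrow> r \<in> I \<Longrightarrow> covariance M (Y q) (Y r) = k q r"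
    and S: "finite S" "S \<subseteq> I"
  shows "centred_gaussian M (\<lambda>\<omega>. \<Sum>q\<in>S. c q * Y q \<omega>) (\<Sum>q\<in>S. \<Sum>r\<in>S. c q * c r * k q r)"
proof -
  have rv: "gaussian_rv M (Y q)" if "q \<in> I" for q
  proof -
    show ?thesis
      using G[unfolded gaussian_process_def, rule_format, of "{q}" "\<lambda>_. 1"] that by simp
  qed
  have Y: "Y q \<in> borel_measurable M" if "q \<in> I" for q using rv[OF that] by (simp add: gaussian_rv_def)
  have sq: "integrable M (\<lambda>\<omega>. (Y q \<omega>)\<^sup>2)" if "q \<in> I" for q
    by (rule gaussian_rv_centred(1)[OF rv[OF that] mean[OF that]])
  have int: "integrable M (\<lambda>\<omega>. Y q \<omega> * Y r \<omega>)" if "q \<in> S" "r \<in> S" for q r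
    using that S by (intro integrable_mult_square Y sq) auto
  have intY: "integrable M (Y q)" if "q \<in> I" for q
    by (rule square_integrable_imp_integrable[OF Y[OF that] sq[OF that]])
  let ?X = "\<lambda>\<omega>. \<Sum>q\<in>S. c q * Y q \<omega>"
  have "expectation ?X = (\<Sum>q\<in>S. c q * expectation (Y q))"
    using S intY by (subst Bochner_Integration.integral_sum) auto
  then have m: "expectation ?X = 0" using S mean by (simp add: subset_iff)
  have g: "gaussian_rv M ?X" using G S by (simp add: gaussian_process_def)
  have "expectation (\<lambda>\<omega>. (?X \<omega>)\<^sup>2) = expectation (\<lambda>\<omega>. \<Sum>q\<in>S. \<Sum>r\<in>S. c q * c r * (Y q \<omega> * Y r \<omega>))"
    by (simp add: power2_eq_square sum_product mult_ac)
  also have "\<dots> = (\<Sum>q\<in>S. \<Sum>r\<in>S. c q * c r * expectation (\<lambda>\<omega>. Y q \<omega> * Y r \<omega>))"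
    using int by (simp add: Bochner_Integration.integral_sum Bochner_Integration.integrable_sum)
  also have "\<dots> = (\<Sum>q\<in>S. \<Sum>r\<in>S. c q * c r * k q r)"
  proof (intro sum.cong refl)
    fix q r assume "q \<in> S" "r \<in> S"
    then have "q \<in> I" "r \<in> I" using S by auto
    then show "c q * c r * expectation (\<lambda>\<omega>. Y q \<omega> * Y r \<omega>) = c q * c r * k q r"
      using cov[of q r] mean by (simp add: covariance_def)
  qed
  finally show ?thesis using gaussian_rv_centred(2)[OF g m] by simp
qed

text \<open>The converse, used for existence: the covariance of two variables is recovered by
  polarisation from the variance of their sum.\<close>

lemma centred_gaussian_process:
  assumes G: "\<And>S c. finite S \<Longrightarrow> S \<subseteq> I \<Longrightarrow>
      centred_gaussian M (\<lambda>\<omega>. \<Sum>q\<in>S. c q * Y q \<omega>) (\<Sum>q\<in>S. \<Sum>r\<in>S. c q * c r * k q r)"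
    and sym: "\<And>q r. q \<in> I \<Longrightarrow> r \<in> I \<Longrightarrow> k q r = k r q"
  shows "gaussian_process M I Y" "\<And>q. q \<in> I \<Longrightarrow> expectation (Y q) = 0"
    "\<And>q r. q \<in> I \<Longrightarrow> r \<in> I \<Longrightarrow> covariance M (Y q) (Y r) = k q r"
proof -
  show "gaussian_process M I Y"
    unfolding gaussian_process_def using G centred_gaussian_rv by blast
  have one: "centred_gaussian M (Y q) (k q q)" if "q \<in> I" for q
    using G[of "{q}" "\<lambda>_. 1"] that by simp
  show mean: "expectation (Y q) = 0" if "q \<in> I" for q
    by (rule centred_gaussian_mean(2)[OF one[OF that]])
  fix q r assume q: "q \<in> I" and r: "r \<in> I"
  have cov: "covariance M (Y q) (Y r) = expectation (\<lambda>\<omega>. Y q \<omega> * Y r \<omega>)"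
    by (simp add: covariance_def mean q r)
  show "covariance M (Y q) (Y r) = k q r"
  proof (cases "q = r")
    case True
    then show ?thesis
      using centred_gaussian_square(2)[OF one[OF q]] unfolding cov by (simp add: power2_eq_square)
  next
    case False
    have 2: "centred_gaussian M (\<lambda>\<omega>. Y q \<omega> + Y r \<omega>) (k q q + 2 * k q r + k r r)"
      using G[of "{q, r}" "\<lambda>_. 1"] q r False sym[OF q r] by (simp add: algebra_simps)
    have i: "integrable M (\<lambda>\<omega>. (Y q \<omega>)\<^sup>2)" "integrable M (\<lambda>\<omega>. (Y r \<omega>)\<^sup>2)"
      using centred_gaussian_square(1)[OF one] q r by auto
    have m: "Y q \<in> borel_measurable M" "Y r \<in> borel_measurable M"
      using one q r by (auto simp: centred_gaussian_def)
    have "expectation (\<lambda>\<omega>. (Y q \<omega> + Y r \<omega>)\<^sup>2)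
      = expectation (\<lambda>\<omega>. (Y q \<omega>)\<^sup>2 + (Y r \<omega>)\<^sup>2 + 2 * (Y q \<omega> * Y r \<omega>))"
      by (simp add: power2_sum mult.assoc)
    also have "\<dots> = k q q + k r r + 2 * expectation (\<lambda>\<omega>. Y q \<omega> * Y r \<omega>)"
      using i integrable_mult_square[OF m i] centred_gaussian_square(2)[OF one[OF q]]
        centred_gaussian_square(2)[OF one[OF r]] by simp
    finally show ?thesis using centred_gaussian_square(2)[OF 2] unfolding cov by simp
  qed
qed

end

section \<open>Uniqueness of the law on path space\<close>

text \<open>Levy's uniqueness theorem, applied to the law of \<open>X\<close> under the tilted probability measure
  with density proportional to \<open>2 + W\<close>.\<close>

lemma weighted_law_unique:
  fixes X W :: "'a \<Rightarrow> real" and X' W' :: "'b \<Rightarrow> real"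
  assumes "prob_space M" "prob_space M'"
    and [measurable]: "X \<in> borel_measurable M" "W \<in> borel_measurable M"
      "X' \<in> borel_measurable M'" "W' \<in> borel_measurable M'"
    and W: "\<And>\<omega>. \<bar>W \<omega>\<bar> \<le> 1" "\<And>\<omega>. \<bar>W' \<omega>\<bar> \<le> 1"
    and eq1: "\<And>s b. (\<integral>\<omega>. cos (s * X \<omega> + b) \<partial>M) = (\<integral>\<omega>. cos (s * X' \<omega> + b) \<partial>M')"
    and eqW: "\<And>s b. (\<integral>\<omega>. W \<omega> * cos (s * X \<omega> + b) \<partial>M) = (\<integral>\<omega>. W' \<omega> * cos (s * X' \<omega> + b) \<partial>M')"
    and [measurable]: "A \<in> sets borel"
  shows "(\<integral>\<omega>. W \<omega> * indicator A (X \<omega>) \<partial>M) = (\<integral>\<omega>. W' \<omega> * indicator A (X' \<omega>) \<partial>M')"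
proof -
  interpret M: prob_space M by fact
  interpret M': prob_space M' by fact
  have key: "(\<integral>\<omega>. V \<omega> * indicator A (X \<omega>) \<partial>M) = (\<integral>\<omega>. V' \<omega> * indicator A (X' \<omega>) \<partial>M')"
    if [measurable]: "V \<in> borel_measurable M" "V' \<in> borel_measurable M'"
      and V: "\<And>\<omega>. 1 \<le> V \<omega>" "\<And>\<omega>. V \<omega> \<le> 3" "\<And>\<omega>. 1 \<le> V' \<omega>" "\<And>\<omega>. V' \<omega> \<le> 3"
      and eqV: "\<And>s b. (\<integral>\<omega>. V \<omega> * cos (s * X \<omega> + b) \<partial>M) = (\<integral>\<omega>. V' \<omega> * cos (s * X' \<omega> + b) \<partial>M')"
    for V V'
  proof -
    define m where "m = (\<integral>\<omega>. V \<omega> \<partial>M)"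
    have m': "m = (\<integral>\<omega>. V' \<omega> \<partial>M')" using eqV[of 0 0] by (simp add: m_def)
    have iV: "integrable M V"
      by (rule M.integrable_const_bound[of _ 3]) (use V order_trans[OF zero_le_one V(1)] in auto)
    have iV': "integrable M' V'"
      by (rule M'.integrable_const_bound[of _ 3]) (use V order_trans[OF zero_le_one V(3)] in auto)
    have "1 \<le> m" unfolding m_def using V(1) M.integral_ge_const[OF iV, of 1] by simp
    then have m: "0 < m" by simp
    have pos: "0 \<le> V \<omega> / m" "0 \<le> V' \<omega>' / m" for \<omega> \<omega>'
      using m order_trans[OF zero_le_one V(1)] order_trans[OF zero_le_one V(3)] by auto
    let ?N = "density M (\<lambda>\<omega>. ennreal (V \<omega> / m))" and ?N' = "density M' (\<lambda>\<omega>. ennreal (V' \<omega> / m))"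
    have N: "prob_space ?N"
    proof
      have "emeasure ?N (space ?N) = (\<integral>\<^sup>+\<omega>. ennreal (V \<omega> / m) \<partial>M)"
        by (simp add: emeasure_density cong: nn_integral_cong)
      also have "\<dots> = ennreal (\<integral>\<omega>. V \<omega> / m \<partial>M)" using iV pos by (intro nn_integral_eq_integral) auto
      also have "(\<integral>\<omega>. V \<omega> / m \<partial>M) = 1" using m by (simp add: m_def)
      finally show "emeasure ?N (space ?N) = 1" by simp
    qed
    have N': "prob_space ?N'"
    proof
      have "emeasure ?N' (space ?N') = (\<integral>\<^sup>+\<omega>. ennreal (V' \<omega> / m) \<partial>M')"
        by (simp add: emeasure_density cong: nn_integral_cong)
      also have "\<dots> = ennreal (\<integral>\<omega>. V' \<omega> / m \<partial>M')" using iV' pos by (intro nn_integral_eq_integral) auto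
      also have "(\<integral>\<omega>. V' \<omega> / m \<partial>M') = 1" using m by (simp add: m')
      finally show "emeasure ?N' (space ?N') = 1" by simp
    qed
    interpret N: prob_space ?N by (rule N)
    interpret N': prob_space ?N' by (rule N')
    \<comment> \<open>Sine is a shifted cosine, so the hypothesis with a free phase b covers both
      the real and the imaginary part.\<close>
    have RI: "Re (iexp x) = cos x" "Im (iexp x) = cos (x - pi/2)" for x :: real
      by (simp_all add: Re_exp Im_exp cos_diff)
    have "distr ?N borel X = distr ?N' borel X'"
    proof (rule Levy_uniqueness)
      show "real_distribution (distr ?N borel X)" "real_distribution (distr ?N' borel X')" by simp_all
      show "char (distr ?N borel X) = char (distr ?N' borel X')"
      proof
        fix s
        have i: "integrable ?N (\<lambda>\<omega>. iexp (s * X \<omega>))" by (rule N.integrable_const_bound[of _ 1]) auto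
        have i': "integrable ?N' (\<lambda>\<omega>. iexp (s * X' \<omega>))" by (rule N'.integrable_const_bound[of _ 1]) auto
        have c: "(\<integral>\<omega>. cos (s * X \<omega> + b) \<partial>?N) = (\<integral>\<omega>. cos (s * X' \<omega> + b) \<partial>?N')" for b
          using eqV[of s b] pos by (simp add: integral_density)
        have "Re (\<integral>\<omega>. iexp (s * X \<omega>) \<partial>?N) = Re (\<integral>\<omega>. iexp (s * X' \<omega>) \<partial>?N')"
          unfolding integral_Re[OF i, symmetric] integral_Re[OF i', symmetric] RI using c[of 0] by simp
        moreover have "Im (\<integral>\<omega>. iexp (s * X \<omega>) \<partial>?N) = Im (\<integral>\<omega>. iexp (s * X' \<omega>) \<partial>?N')"
          unfolding integral_Im[OF i, symmetric] integral_Im[OF i', symmetric] RI using c[of "-pi/2"] by simp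
        ultimately have "(\<integral>\<omega>. iexp (s * X \<omega>) \<partial>?N) = (\<integral>\<omega>. iexp (s * X' \<omega>) \<partial>?N')"
          by (rule complex_eqI)
        then show "char (distr ?N borel X) s = char (distr ?N' borel X') s"
          by (simp add: char_def integral_distr)
      qed
    qed
    then have "(\<integral>x. indicator A x \<partial>distr ?N borel X) = (\<integral>x. indicator A x \<partial>distr ?N' borel X' :: real)"
      by simp
    then have "(\<integral>\<omega>. indicator A (X \<omega>) \<partial>?N) = (\<integral>\<omega>. indicator A (X' \<omega>) \<partial>?N' :: real)"
      by (subst (asm) (1 2) integral_distr) auto
    then have "(\<integral>\<omega>. V \<omega> / m * indicator A (X \<omega>) \<partial>M) = (\<integral>\<omega>. V' \<omega> / m * indicator A (X' \<omega>) \<partial>M')"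
      using pos by (subst (asm) (1 2) integral_density) auto
    then show ?thesis using m by simp
  qed
  have b: "1 \<le> 2 + W \<omega>" "2 + W \<omega> \<le> 3" for \<omega> using W(1)[of \<omega>] by (auto simp: abs_le_iff)
  have b': "1 \<le> 2 + W' \<omega>" "2 + W' \<omega> \<le> 3" for \<omega> using W(2)[of \<omega>] by (auto simp: abs_le_iff)
  have ab: "\<bar>x * y\<bar> \<le> 1" if "\<bar>x\<bar> \<le> 1" "\<bar>y\<bar> \<le> 1" for x y :: real
    unfolding abs_mult using that by (intro mult_le_one) auto
  have iM: "integrable M (\<lambda>\<omega>. W \<omega> * f (X \<omega>))" if "\<And>x. \<bar>f x\<bar> \<le> 1" "f \<in> borel_measurable borel" for f :: "real \<Rightarrow> real"
    using W(1) that by (intro M.integrable_const_bound[of _ 1]) (auto intro!: AE_I2 ab)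
  have iM': "integrable M' (\<lambda>\<omega>. W' \<omega> * f (X' \<omega>))" if "\<And>x. \<bar>f x\<bar> \<le> 1" "f \<in> borel_measurable borel" for f :: "real \<Rightarrow> real"
    using W(2) that by (intro M'.integrable_const_bound[of _ 1]) (auto intro!: AE_I2 ab)
  have jM: "integrable M (\<lambda>\<omega>. f (X \<omega>))" if "\<And>x. \<bar>f x\<bar> \<le> 1" "f \<in> borel_measurable borel" for f :: "real \<Rightarrow> real"
    using that by (intro M.integrable_const_bound[of _ 1]) auto
  have jM': "integrable M' (\<lambda>\<omega>. f (X' \<omega>))" if "\<And>x. \<bar>f x\<bar> \<le> 1" "f \<in> borel_measurable borel" for f :: "real \<Rightarrow> real"
    using that by (intro M'.integrable_const_bound[of _ 1]) auto
  \<comment> \<open>Weights bounded away from 0 can be normalised to densities. Both 2 + W and 1 are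
    of this kind, and W is the first minus twice the second.\<close>
  have "(\<integral>\<omega>. (2 + W \<omega>) * indicator A (X \<omega>) \<partial>M) = (\<integral>\<omega>. (2 + W' \<omega>) * indicator A (X' \<omega>) \<partial>M')"
  proof (rule key)
    show "(\<integral>\<omega>. (2 + W \<omega>) * cos (s * X \<omega> + b) \<partial>M) = (\<integral>\<omega>. (2 + W' \<omega>) * cos (s * X' \<omega> + b) \<partial>M')" for s b
      using eq1[of s b] eqW[of s b] iM[of "\<lambda>x. cos (s * x + b)"] iM'[of "\<lambda>x. cos (s * x + b)"]
        jM[of "\<lambda>x. cos (s * x + b)"] jM'[of "\<lambda>x. cos (s * x + b)"]
      by (simp add: distrib_right)
  qed (use b b' in auto)
  moreover have "(\<integral>\<omega>. 1 * indicator A (X \<omega>) \<partial>M) = (\<integral>\<omega>. 1 * indicator A (X' \<omega>) \<partial>M' :: real)"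
    by (rule key) (use eq1 in auto)
  ultimately show ?thesis
    using iM[of "indicator A"] iM'[of "indicator A"] jM[of "indicator A"] jM'[of "indicator A"]
    by (simp add: distrib_right indicator_def)
qed

lemma (in prob_space) char_eq_cos:
  assumes [measurable]: "X \<in> borel_measurable M"
  shows "Re (exp (\<i> * b) * char (distr M borel X) s) = (\<integral>\<omega>. cos (s * X \<omega> + b) \<partial>M)"
proof -
  have i: "integrable M (\<lambda>\<omega>. exp (\<i> * b) * iexp (s * X \<omega>))"
    by (rule integrable_const_bound[of _ 1]) (auto simp: norm_mult)
  have "exp (\<i> * b) * char (distr M borel X) s = (\<integral>\<omega>. exp (\<i> * b) * iexp (s * X \<omega>) \<partial>M)"
    by (simp add: char_def integral_distr)
  then have "Re (exp (\<i> * b) * char (distr M borel X) s) = (\<integral>\<omega>. Re (exp (\<i> * b) * iexp (s * X \<omega>)) \<partial>M)"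
    by (simp only: integral_Re[OF i])
  also have "\<dots> = (\<integral>\<omega>. cos (s * X \<omega> + b) \<partial>M)"
    by (intro Bochner_Integration.integral_cong refl)
      (simp add: Re_exp Im_exp cos_add)
  finally show ?thesis .
qed

text \<open>The induction is loaded: the indicators of the coordinates already treated are
  multiplied by a cosine of a linear combination. In each step this whole product is the bounded
  weight W, and one further coordinate turns from a frequency into an indicator.\<close>

lemma joint_law_unique:
  fixes Y :: "'q \<Rightarrow> 'a \<Rightarrow> real" and Y' :: "'q \<Rightarrow> 'b \<Rightarrow> real"
  assumes "prob_space M" "prob_space M'"
    and Y: "\<And>q. q \<in> I \<Longrightarrow> Y q \<in> borel_measurable M"
    and Y': "\<And>q. q \<in> I \<Longrightarrow> Y' q \<in> borel_measurable M'"
    and ch: "\<And>T c. finite T \<Longrightarrow> T \<subseteq> I \<Longrightarrow>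
      char (distr M borel (\<lambda>\<omega>. \<Sum>q\<in>T. c q * Y q \<omega>)) 1 = char (distr M' borel (\<lambda>\<omega>. \<Sum>q\<in>T. c q * Y' q \<omega>)) 1"
    and S: "finite S" "S \<subseteq> I" and A: "\<And>q. q \<in> S \<Longrightarrow> A q \<in> sets borel"
  shows "(\<integral>\<omega>. (\<Prod>q\<in>S. indicator (A q) (Y q \<omega>)) \<partial>M) = (\<integral>\<omega>. (\<Prod>q\<in>S. indicator (A q) (Y' q \<omega>)) \<partial>M' :: real)"
proof -
  interpret M: prob_space M by fact
  interpret M': prob_space M' by fact
  define Z where "Z = (\<lambda>T c \<omega>. \<Sum>q\<in>T. c q * Y q \<omega>)"
  define Z' where "Z' = (\<lambda>T c \<omega>. \<Sum>q\<in>T. c q * Y' q \<omega>)"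
  have Zm: "Z T c \<in> borel_measurable M" "Z' T c \<in> borel_measurable M'" if "T \<subseteq> I" for T c
    using that Y Y' by (auto simp: Z_def Z'_def intro!: borel_measurable_sum borel_measurable_times)
  \<comment> \<open>One coefficient family serves both processes. If q already occurs in T, its
    coefficient is increased.\<close>
  have Zadd: "\<exists>d. (\<forall>\<omega>. Z (insert q T) d \<omega> = Z T c \<omega> + s * Y q \<omega>) \<and> (\<forall>\<omega>. Z' (insert q T) d \<omega> = Z' T c \<omega> + s * Y' q \<omega>)"
    if "finite T" for q T c s
  proof (cases "q \<in> T")
    case True
    have "(\<Sum>r\<in>T. (c r + (if r = q then s else 0)) * f r) = (\<Sum>r\<in>T. c r * f r) + s * f q" for f :: "'q \<Rightarrow> real"
    proof -
      have "(\<Sum>r\<in>T. (c r + (if r = q then s else 0)) * f r) = (\<Sum>r\<in>T. c r * f r + (if r = q then s * f q else 0))"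
        by (intro sum.cong) (auto simp: distrib_right)
      then show ?thesis using True that by (simp add: sum.distrib)
    qed
    then show ?thesis using True that unfolding Z_def Z'_def
      by (intro exI[of _ "\<lambda>r. c r + (if r = q then s else 0)"]) (simp add: insert_absorb)
  next
    case False
    then show ?thesis using that unfolding Z_def Z'_def
      by (intro exI[of _ "c(q := s)"]) (auto intro!: sum.cong)
  qed
  have "(\<integral>\<omega>. (\<Prod>q\<in>S. indicator (A q) (Y q \<omega>)) * cos (Z T c \<omega> + b) \<partial>M)
      = (\<integral>\<omega>. (\<Prod>q\<in>S. indicator (A q) (Y' q \<omega>)) * cos (Z' T c \<omega> + b) \<partial>M')"
    if "finite T" "T \<subseteq> I" for T c b
    using S A that
  proof (induction S arbitrary: T c b rule: finite_induct)
    case empty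
    have "(\<integral>\<omega>. cos (1 * Z T c \<omega> + b) \<partial>M) = (\<integral>\<omega>. cos (1 * Z' T c \<omega> + b) \<partial>M')"
      using M.char_eq_cos[OF Zm(1)[OF empty(4), of c], where b=b and s=1] M'.char_eq_cos[OF Zm(2)[OF empty(4), of c], where b=b and s=1]
        ch[OF empty(3,4), of c] unfolding Z_def Z'_def by simp
    then show ?case by simp
  next
    case (insert q S)
    have q: "q \<in> I" and SI: "S \<subseteq> I" and AS: "\<And>r. r \<in> S \<Longrightarrow> A r \<in> sets borel" and Aq: "A q \<in> sets borel"
      using insert.prems by auto
    let ?P = "\<lambda>\<omega>. \<Prod>q\<in>S. indicator (A q) (Y q \<omega>) :: real" and ?P' = "\<lambda>\<omega>. \<Prod>q\<in>S. indicator (A q) (Y' q \<omega>) :: real"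
    have IH: "(\<integral>\<omega>. ?P \<omega> * cos (Z T c \<omega> + b) \<partial>M) = (\<integral>\<omega>. ?P' \<omega> * cos (Z' T c \<omega> + b) \<partial>M')"
      if "finite T" "T \<subseteq> I" for T c b
      by (rule insert.IH[OF SI _ that]) (rule AS)
    have Pm [measurable]: "?P \<in> borel_measurable M" "?P' \<in> borel_measurable M'"
      using SI AS Y Y' by (auto intro!: borel_measurable_prod measurable_compose[OF _ borel_measurable_indicator])
    have Pb: "\<bar>?P \<omega>\<bar> \<le> 1" "\<bar>?P' \<omega>'\<bar> \<le> 1" for \<omega> \<omega>'
      by (auto simp: abs_prod intro!: prod_le_1)
    note [measurable] = Zm[OF insert.prems(4)] Y[OF q] Y'[OF q]
    have "(\<integral>\<omega>. (?P \<omega> * cos (Z T c \<omega> + b)) * indicator (A q) (Y q \<omega>) \<partial>M)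
        = (\<integral>\<omega>. (?P' \<omega> * cos (Z' T c \<omega> + b)) * indicator (A q) (Y' q \<omega>) \<partial>M')"
    proof (rule weighted_law_unique[OF assms(1,2) _ _ _ _ _ _ _ _ Aq])
      show "\<bar>?P \<omega> * cos (Z T c \<omega> + b)\<bar> \<le> 1" for \<omega>
        using Pb(1)[of \<omega>] by (subst abs_mult, intro mult_le_one) auto
      show "\<bar>?P' \<omega> * cos (Z' T c \<omega> + b)\<bar> \<le> 1" for \<omega>
        using Pb(2)[of \<omega>] by (subst abs_mult, intro mult_le_one) auto
      show "(\<integral>\<omega>. cos (s * Y q \<omega> + b) \<partial>M) = (\<integral>\<omega>. cos (s * Y' q \<omega> + b) \<partial>M')" for s b
        using M.char_eq_cos[of "Z {q} (\<lambda>_. s)", where b=b and s=1] M'.char_eq_cos[of "Z' {q} (\<lambda>_. s)", where b=b and s=1]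
          ch[of "{q}" "\<lambda>_. s"] q Zm[of "{q}"] by (simp add: Z_def Z'_def)
      show "(\<integral>\<omega>. ?P \<omega> * cos (Z T c \<omega> + b) * cos (s * Y q \<omega> + b') \<partial>M)
          = (\<integral>\<omega>. ?P' \<omega> * cos (Z' T c \<omega> + b) * cos (s * Y' q \<omega> + b') \<partial>M')" for s b'
      proof -
        obtain d1 where d1: "\<And>\<omega>. Z (insert q T) d1 \<omega> = Z T c \<omega> + s * Y q \<omega>"
            "\<And>\<omega>. Z' (insert q T) d1 \<omega> = Z' T c \<omega> + s * Y' q \<omega>" using Zadd[OF insert.prems(3)] by metis
        obtain d2 where d2: "\<And>\<omega>. Z (insert q T) d2 \<omega> = Z T c \<omega> + (-s) * Y q \<omega>"
            "\<And>\<omega>. Z' (insert q T) d2 \<omega> = Z' T c \<omega> + (-s) * Y' q \<omega>" using Zadd[OF insert.prems(3)] by metis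
        have T': "finite (insert q T)" "insert q T \<subseteq> I" using insert.prems q by auto
        \<comment> \<open>Product-to-sum formula: the two cosines become cosines of linear
          combinations again, to which the induction hypothesis applies.\<close>
        have split: "x * cos (z + b) * cos (s * y + b')
            = x * cos ((z + s * y) + (b + b')) / 2 + x * cos ((z + (-s) * y) + (b - b')) / 2" for x z y :: real
        proof -
          have "cos (z + b) * cos (s * y + b') = (cos ((z + b) - (s * y + b')) + cos ((z + b) + (s * y + b'))) / 2"
            by (rule cos_times_cos)
          moreover have "(z + b) - (s * y + b') = (z + (-s) * y) + (b - b')"
            "(z + b) + (s * y + b') = (z + s * y) + (b + b')" by simp_all
          ultimately show ?thesis by (simp only: mult.assoc) (simp add: field_simps)
        qed
        have i: "integrable M (\<lambda>\<omega>. ?P \<omega> * cos (Z T c \<omega> + s * Y q \<omega> + b) / 2)" for s b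
          by (rule M.integrable_const_bound[of _ 1])
            (use Pb in \<open>auto simp: abs_mult intro!: order_trans[OF mult_le_one[OF _ _ abs_cos_le_one]]\<close>)
        have i': "integrable M' (\<lambda>\<omega>. ?P' \<omega> * cos (Z' T c \<omega> + s * Y' q \<omega> + b) / 2)" for s b
          by (rule M'.integrable_const_bound[of _ 1])
            (use Pb in \<open>auto simp: abs_mult intro!: order_trans[OF mult_le_one[OF _ _ abs_cos_le_one]]\<close>)
        have e1: "(\<integral>\<omega>. ?P \<omega> * cos (Z T c \<omega> + s * Y q \<omega> + (b + b')) / 2 \<partial>M)
            = (\<integral>\<omega>. ?P' \<omega> * cos (Z' T c \<omega> + s * Y' q \<omega> + (b + b')) / 2 \<partial>M')"
          using IH[OF T', of d1 "b + b'"] unfolding d1 by simp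
        have e2: "(\<integral>\<omega>. ?P \<omega> * cos (Z T c \<omega> + (-s) * Y q \<omega> + (b - b')) / 2 \<partial>M)
            = (\<integral>\<omega>. ?P' \<omega> * cos (Z' T c \<omega> + (-s) * Y' q \<omega> + (b - b')) / 2 \<partial>M')"
          using IH[OF T', of d2 "b - b'"] unfolding d2 by simp
        show ?thesis unfolding split
          by (subst (1 2) Bochner_Integration.integral_add) (rule i i' | simp only: e1 e2)+
      qed
    qed measurable
    then show ?case using insert.hyps by (simp add: mult_ac)
  qed
  \<comment> \<open>The empty combination with phase 0 makes the cosine equal to 1.\<close>
  from this[of "{}" "\<lambda>_. 0" 0] show ?thesis by (simp add: Z_def Z'_def)
qed

section \<open>Separability and Borel sets of the path space\<close>

lemma finite_coords [simp]: "finite (coords n J K)"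
proof -
  have "coords n J K \<subseteq> (\<lambda>(a, j). Arr a j) ` ({1..n} \<times> {1..J}) \<union>
      (\<lambda>(a, j, k, i). Srv a j k i) ` ({1..n} \<times> {1..J} \<times> {1..K} \<times> {1..J})"
    by (auto simp: coords_def image_def)
  then show ?thesis by (rule finite_subset) simp
qed

lemma compact_triangle: "compact (triangle T)"
proof -
  have "triangle T = {x. 0 \<le> fst x} \<inter> {x. fst x \<le> snd x} \<inter> {x. snd x \<le> T}"
    by (auto simp: triangle_def)
  then have "closed (triangle T)"
    by (simp only:) (intro closed_Int closed_Collect_le continuous_intros)
  moreover have "triangle T \<subseteq> cbox (0, 0) (T, T)" by (auto simp: triangle_def)
  then have "bounded (triangle T)" using bounded_cbox bounded_subset by blast
  ultimately show ?thesis by (simp add: compact_eq_bounded_closed)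
qed

lemma topspace_index_space [simp]: "topspace (index_space n J K T) = coords n J K \<times> triangle T"
  by (simp add: index_space_def)

lemma continuous_map_index_space:
  fixes f :: "coord \<times> real \<times> real \<Rightarrow> real"
  shows "continuous_map (index_space n J K T) euclidean f \<longleftrightarrow>
    (\<forall>c\<in>coords n J K. continuous_on (triangle T) (\<lambda>x. f (c, x)))"
proof (intro iffI ballI)
  fix c assume f: "continuous_map (index_space n J K T) euclidean f" and c: "c \<in> coords n J K"
  have "continuous_map (top_of_set (triangle T)) (index_space n J K T) (\<lambda>x. (c, x))"
    unfolding index_space_def using c by (intro continuous_map_pairedI) auto
  then have "continuous_map (top_of_set (triangle T)) euclidean (f \<circ> (\<lambda>x. (c, x)))"
    by (rule continuous_map_compose[OF _ f])
  then show "continuous_on (triangle T) (\<lambda>x. f (c, x))" by (simp add: comp_def)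
next
  assume f: "\<forall>c\<in>coords n J K. continuous_on (triangle T) (\<lambda>x. f (c, x))"
  show "continuous_map (index_space n J K T) euclidean f"
    unfolding continuous_map_def
  proof (intro conjI allI impI)
    fix U :: "real set" assume U: "openin euclidean U"
    have eq: "{q \<in> topspace (index_space n J K T). f q \<in> U} =
        (\<Union>c\<in>coords n J K. {c} \<times> {x \<in> triangle T. f (c, x) \<in> U})" by auto
    show "openin (index_space n J K T) {q \<in> topspace (index_space n J K T). f q \<in> U}"
      unfolding eq
    proof (intro openin_Union, safe)
      fix c assume c: "c \<in> coords n J K"
      have "openin (top_of_set (triangle T)) (triangle T \<inter> (\<lambda>x. f (c, x)) -` U)"
        using f c U by (intro continuous_openin_preimage_gen) auto
      moreover have "triangle T \<inter> (\<lambda>x. f (c, x)) -` U = {x \<in> triangle T. f (c, x) \<in> U}" by auto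
      ultimately show "openin (index_space n J K T) ({c} \<times> {x \<in> triangle T. f (c, x) \<in> U})"
        using c by (simp add: index_space_def openin_prod_Times_iff)
    qed
  qed auto
qed

lemma mspace_path_space:
  "mspace (path_space n J K T) = {f \<in> extensional (coords n J K \<times> triangle T).
     continuous_map (index_space n J K T) euclidean f}"
proof -
  have "compact_space (index_space n J K T)"
    unfolding index_space_def
    by (simp add: compact_space_prod_topology compact_space_discrete_topology compact_triangle
        compact_space_subtopology)
  then have "compactin (index_space n J K T) (topspace (index_space n J K T))"
    by (simp add: compact_space_def)
  from compactin_mspace_cfunspace[OF this, of euclidean_metric] show ?thesis
    by (auto simp: path_space_def)
qed

lemma triangle_nets:
  obtains G :: "nat \<Rightarrow> (real \<times> real) set"
  where "\<And>N. finite (G N)" "\<And>N. G N \<subseteq> triangle T"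
    "\<And>N x. x \<in> triangle T \<Longrightarrow> \<exists>y\<in>G N. dist x y < 1 / Suc N"
proof -
  have "\<exists>k. finite k \<and> k \<subseteq> triangle T \<and> triangle T \<subseteq> (\<Union>x\<in>k. ball x (1 / Suc N))" for N
    using seq_compact_imp_totally_bounded[of "triangle T"] compact_triangle[of T]
    by (auto simp: compact_eq_seq_compact_metric)
  then obtain G where "\<And>N. finite (G N) \<and> G N \<subseteq> triangle T \<and> triangle T \<subseteq> (\<Union>x\<in>G N. ball x (1 / Suc N))"
    by metis
  then show ?thesis by (intro that[of G]) (auto simp: dist_commute subset_iff)
qed

text \<open>A path is determined up to \<open>3 / (m + 1)\<close> by a net on which it oscillates by less than
  \<open>1 / (m + 1)\<close> together with its values on the net, rounded to multiples of \<open>1 / (m + 1)\<close>.\<close>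

lemma path_space_separable:
  "\<exists>G. countable G \<and> G \<subseteq> mspace (path_space n J K T) \<and>
     (\<forall>f\<in>mspace (path_space n J K T). \<forall>m. \<exists>g\<in>G. \<forall>q\<in>coords n J K \<times> triangle T. \<bar>f q - g q\<bar> \<le> 3 / Suc m)"
proof -
  let ?F = "mspace (path_space n J K T)"
  obtain G :: "nat \<Rightarrow> (real \<times> real) set" where
    G: "\<And>N. finite (G N)" "\<And>N. G N \<subseteq> triangle T"
      "\<And>N x. x \<in> triangle T \<Longrightarrow> \<exists>y\<in>G N. dist x y < 1 / Suc N"
    using triangle_nets by blast
  define osc where "osc = (\<lambda>f m N. \<forall>c\<in>coords n J K. \<forall>x\<in>triangle T. \<forall>y\<in>triangle T.
      dist x y < 1 / Suc N \<longrightarrow> \<bar>f (c, x) - f (c, y)\<bar> \<le> 1 / real (Suc m))"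
  have osc: "\<exists>N. osc f m N" if f: "f \<in> ?F" for f m
  proof -
    have "\<exists>d>0. \<forall>x\<in>triangle T. \<forall>y\<in>triangle T. dist x y < d \<longrightarrow> \<bar>f (c, x) - f (c, y)\<bar> \<le> 1 / real (Suc m)"
      if c: "c \<in> coords n J K" for c
    proof -
      have "continuous_on (triangle T) (\<lambda>x. f (c, x))"
        using f c by (auto simp: mspace_path_space continuous_map_index_space)
      then have "uniformly_continuous_on (triangle T) (\<lambda>x. f (c, x))"
        by (rule compact_uniformly_continuous[OF _ compact_triangle])
      then obtain d where "d > 0" "\<And>x y. x \<in> triangle T \<Longrightarrow> y \<in> triangle T \<Longrightarrow> dist x y < d \<Longrightarrow>
          dist (f (c, x)) (f (c, y)) < 1 / real (Suc m)"
        unfolding uniformly_continuous_on_def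
        by (metis dist_commute of_nat_0_less_iff zero_less_Suc zero_less_divide_1_iff)
      then show ?thesis by (intro exI[of _ d]) (auto simp: dist_real_def intro!: less_imp_le)
    qed
    then obtain d where d: "\<And>c. c \<in> coords n J K \<Longrightarrow> d c > 0"
        "\<And>c x y. c \<in> coords n J K \<Longrightarrow> x \<in> triangle T \<Longrightarrow> y \<in> triangle T \<Longrightarrow> dist x y < d c \<Longrightarrow>
          \<bar>f (c, x) - f (c, y)\<bar> \<le> 1 / real (Suc m)"
      by metis
    \<comment> \<open>The extra 1 keeps the set nonempty when there are no coordinates.\<close>
    define e where "e = Min (insert 1 (d ` coords n J K))"
    have "e > 0" unfolding e_def using d(1) by (subst Min_gr_iff) auto
    then obtain N where N: "1 / Suc N < e" using reals_Archimedean[of e] by (auto simp: inverse_eq_divide)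
    have "e \<le> d c" if "c \<in> coords n J K" for c unfolding e_def using that by (intro Min_le) auto
    then have "osc f m N"
      unfolding osc_def using d(2) N by (meson less_le_trans less_trans)
    then show ?thesis ..
  qed
  define code :: "(coord \<times> real \<times> real \<Rightarrow> real) \<Rightarrow> nat \<Rightarrow> nat \<Rightarrow> (coord \<times> real \<times> real \<Rightarrow> int)"
    where "code = (\<lambda>f m N. \<lambda>q\<in>coords n J K \<times> G N. \<lfloor>real (Suc m) * f q\<rfloor>)"
  define C :: "(nat \<times> nat \<times> (coord \<times> real \<times> real \<Rightarrow> int)) set" where
    "C = (\<Union>m. \<Union>N. {m} \<times> {N} \<times> (PiE (coords n J K \<times> G N) (\<lambda>_. UNIV)))"
  have C: "countable C"
    unfolding C_def by (intro countable_UN countable_SIGMA countable_PiE) (auto simp: G)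
  define P where "P = (\<lambda>(m, N, v) g. g \<in> ?F \<and> osc g m N \<and> code g m N = v)"
  \<comment> \<open>Some path with the given code if there is one. For other codes the value is
    arbitrary, and the later intersection with \<open>?F\<close> keeps the family inside the path
    space.\<close>
  define rep where "rep = (\<lambda>k. SOME g. P k g)"
  have close: "\<bar>f q - g q\<bar> \<le> 3 / Suc m"
    if "osc f m N" "osc g m N" "code f m N = code g m N" and q: "q \<in> coords n J K \<times> triangle T" for f g m N q
  proof -
    obtain c x where qc: "q = (c, x)" "c \<in> coords n J K" "x \<in> triangle T" using q by auto
    obtain y where y: "y \<in> G N" "dist x y < 1 / Suc N" using G(3)[OF qc(3)] by blast
    have yt: "y \<in> triangle T" using y G(2) by blast
    have 1: "\<bar>f (c, x) - f (c, y)\<bar> \<le> 1 / real (Suc m)" "\<bar>g (c, x) - g (c, y)\<bar> \<le> 1 / real (Suc m)"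
      using that(1,2) qc y yt by (auto simp: osc_def)
    have "code f m N (c, y) = code g m N (c, y)" using that(3) by simp
    then have "\<lfloor>real (Suc m) * f (c, y)\<rfloor> = \<lfloor>real (Suc m) * g (c, y)\<rfloor>"
      using qc y by (simp add: code_def)
    then have "\<bar>real (Suc m) * f (c, y) - real (Suc m) * g (c, y)\<bar> \<le> 1" by linarith
    then have "real (Suc m) * \<bar>f (c, y) - g (c, y)\<bar> \<le> 1"
      by (simp add: right_diff_distrib[symmetric] abs_mult del: of_nat_Suc)
    then have "\<bar>f (c, y) - g (c, y)\<bar> \<le> 1 / real (Suc m)"
      by (simp add: field_simps)
    with 1 show ?thesis unfolding qc by linarith
  qed
  show ?thesis
  proof (intro exI[of _ "rep ` C \<inter> ?F"] conjI ballI allI)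
    show "countable (rep ` C \<inter> ?F)" using C by auto
    fix f m assume f: "f \<in> ?F"
    obtain N where N: "osc f m N" using osc[OF f] by blast
    let ?k = "(m, N, code f m N)"
    have "P ?k f" using f N by (simp add: P_def)
    then have r: "P ?k (rep ?k)" unfolding rep_def by (rule someI[of "P ?k"])
    have "?k \<in> C" by (auto simp: C_def code_def)
    then have "rep ?k \<in> rep ` C \<inter> ?F" using r by (auto simp: P_def)
    moreover have "\<forall>q\<in>coords n J K \<times> triangle T. \<bar>f q - rep ?k q\<bar> \<le> 3 / Suc m"
      using close[OF N, of "rep ?k"] r by (auto simp: P_def)
    ultimately show "\<exists>g\<in>rep ` C \<inter> ?F. \<forall>q\<in>coords n J K \<times> triangle T. \<bar>f q - g q\<bar> \<le> 3 / Suc m" by blast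
  qed auto
qed

text \<open>By continuity the bound need only hold on the countable union of the nets, so countably
  many evaluations cut the ball out of the path space. The balls are closed because a non-strict
  bound survives limits.\<close>

lemma path_space_ball_cylinder:
  assumes g: "g \<in> mspace (path_space n J K T)"
  shows "\<exists>V\<in>sets (PiM (coords n J K \<times> triangle T) (\<lambda>_. borel)).
    {f \<in> mspace (path_space n J K T). \<forall>q\<in>coords n J K \<times> triangle T. \<bar>f q - g q\<bar> \<le> r}
      = mspace (path_space n J K T) \<inter> V"
proof -
  let ?F = "mspace (path_space n J K T)" and ?Q = "coords n J K \<times> triangle T"
  let ?P = "PiM ?Q (\<lambda>_. borel :: real measure)"
  obtain G :: "nat \<Rightarrow> (real \<times> real) set" where
    G: "\<And>N. finite (G N)" "\<And>N. G N \<subseteq> triangle T"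
      "\<And>N x. x \<in> triangle T \<Longrightarrow> \<exists>y\<in>G N. dist x y < 1 / Suc N"
    using triangle_nets by blast
  define D where "D = coords n J K \<times> (\<Union>N. G N)"
  have D: "D \<subseteq> ?Q" using G(2) by (auto simp: D_def)
  define V where "V = {x \<in> space ?P. \<forall>q\<in>D. \<bar>x q - g q\<bar> \<le> r}"
  have V_eq: "V = {x \<in> space ?P. \<forall>N. \<forall>q\<in>coords n J K \<times> G N. \<bar>x q - g q\<bar> \<le> r}"
    by (auto simp: V_def D_def)
  have "V \<in> sets ?P" unfolding V_eq pred_def[symmetric]
  proof (intro pred_intros_countable pred_intros_finite)
    fix N q assume "q \<in> coords n J K \<times> G N"
    then have "(\<lambda>x. x q) \<in> borel_measurable ?P" using G(2) by (intro measurable_component_singleton) auto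
    then show "Measurable.pred ?P (\<lambda>x. \<bar>x q - g q\<bar> \<le> r)"
      by (rule measurable_compose[where N=borel and g="\<lambda>y. \<bar>y - g q\<bar> \<le> r"]) measurable
  qed (simp add: G(1))
  have "\<bar>f q - g q\<bar> \<le> r" if f: "f \<in> ?F" and le: "\<And>q. q \<in> D \<Longrightarrow> \<bar>f q - g q\<bar> \<le> r" and q: "q \<in> ?Q" for f q
  proof -
    obtain c x where qc: "q = (c, x)" "c \<in> coords n J K" "x \<in> triangle T" using q by auto
    obtain y where y: "\<And>N. y N \<in> G N" "\<And>N. dist x (y N) < 1 / Suc N" using G(3)[OF qc(3)] by metis
    have "(\<lambda>N. dist (y N) x) \<longlonglongrightarrow> 0"
    proof (rule tendsto_sandwich[OF _ _ tendsto_const LIMSEQ_Suc[OF lim_1_over_n]])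
      show "\<forall>\<^sub>F N in sequentially. dist (y N) x \<le> 1 / real (Suc N)"
        using y(2) by (auto simp: dist_commute intro!: always_eventually less_imp_le)
    qed simp
    then have lim: "y \<longlonglongrightarrow> x" by (rule tendsto_dist_iff[THEN iffD2])
    have "continuous_on (triangle T) (\<lambda>x. f (c, x))" "continuous_on (triangle T) (\<lambda>x. g (c, x))"
      using f g qc(2) by (simp_all add: mspace_path_space continuous_map_index_space)
    then have cont: "continuous_on (triangle T) (\<lambda>x. \<bar>f (c, x) - g (c, x)\<bar>)"
      by (intro continuous_intros)
    have "(\<lambda>N. \<bar>f (c, y N) - g (c, y N)\<bar>) \<longlonglongrightarrow> \<bar>f (c, x) - g (c, x)\<bar>"
      using continuous_on_tendsto_compose[OF cont lim qc(3) always_eventually[OF allI[OF subsetD[OF G(2) y(1)]]]] .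
    moreover have "\<bar>f (c, y N) - g (c, y N)\<bar> \<le> r" for N
      by (rule le) (use y(1) qc(2) in \<open>simp add: D_def\<close>, blast)
    ultimately have "\<bar>f (c, x) - g (c, x)\<bar> \<le> r"
      by (intro LIMSEQ_le_const2) blast+
    then show ?thesis by (simp add: qc)
  qed
  moreover have "?F \<subseteq> space ?P" by (auto simp: space_PiM mspace_path_space PiE_def)
  ultimately have "{f \<in> ?F. \<forall>q\<in>?Q. \<bar>f q - g q\<bar> \<le> r} = ?F \<inter> V"
    using D unfolding V_def by blast
  with \<open>V \<in> sets ?P\<close> show ?thesis by (rule bexI[rotated])
qed

text \<open>Separability makes every open set a countable union of closed balls around members of a
  countable dense family, and each of these balls is already known to be a trace.\<close>

lemma sets_path_borel_cylinder:
  assumes "B \<in> sets (path_borel n J K T)"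
  shows "\<exists>V\<in>sets (PiM (coords n J K \<times> triangle T) (\<lambda>_. borel)). B = mspace (path_space n J K T) \<inter> V"
proof -
  let ?F = "mspace (path_space n J K T)" and ?Q = "coords n J K \<times> triangle T"
  let ?P = "PiM ?Q (\<lambda>_. borel :: real measure)"
  let ?R = "restrict_space ?P ?F"
  interpret MS: Metric_space ?F "mdist (path_space n J K T)" by (rule Metric_space_mspace_mdist)
  have FP: "?F \<subseteq> space ?P" by (auto simp: space_PiM mspace_path_space PiE_def)
  obtain G where G: "countable G" "G \<subseteq> ?F"
      "\<And>f m. f \<in> ?F \<Longrightarrow> \<exists>g\<in>G. \<forall>q\<in>?Q. \<bar>f q - g q\<bar> \<le> 3 / Suc m"
    using path_space_separable[of n J K T] by metis
  let ?B = "\<lambda>(g, m). {f \<in> ?F. \<forall>q\<in>?Q. \<bar>f q - g q\<bar> \<le> 3 / real (Suc m)}"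
  have open_sets: "U \<in> sets ?R" if U: "openin (mtopology_of (path_space n J K T)) U" for U
  proof -
    have UF: "U \<subseteq> ?F" and ball: "\<And>f. f \<in> U \<Longrightarrow> \<exists>r>0. MS.mball f r \<subseteq> U"
      using U by (auto simp: mtopology_of_def MS.openin_mtopology)
    let ?I = "{k \<in> G \<times> UNIV. ?B k \<subseteq> U}"
    have "U \<subseteq> (\<Union>k\<in>?I. ?B k)"
    proof
      fix f assume f: "f \<in> U"
      obtain r where r: "r > 0" "MS.mball f r \<subseteq> U" using ball[OF f] by blast
      \<comment> \<open>f lies within 3 / (m + 1) of some g in the family, so points in the closed
        ball of that radius about g are within 6 / (m + 1) of f.\<close>
      obtain m where "inverse (real (Suc m)) < r / 6" using reals_Archimedean[of "r / 6"] r by auto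
      then have m: "6 / real (Suc m) < r" by (simp add: field_simps)
      obtain g where g: "g \<in> G" "\<And>q. q \<in> ?Q \<Longrightarrow> \<bar>f q - g q\<bar> \<le> 3 / Suc m" using G(3)[of f m] f UF by blast
      have "?B (g, m) \<subseteq> MS.mball f r"
      proof
        fix h assume h: "h \<in> ?B (g, m)"
        have "\<bar>f q - h q\<bar> \<le> 6 / Suc m" if "q \<in> ?Q" for q
        proof -
          have "\<bar>h q - g q\<bar> \<le> 3 / real (Suc m)" using h that by auto
          then show ?thesis using g(2)[OF that] by linarith
        qed
        then have "mdist (path_space n J K T) f h \<le> 6 / Suc m"
          unfolding path_space_def by (intro mdist_cfunspace_le) (auto simp: dist_real_def)
        then show "h \<in> MS.mball f r" using h m f UF by auto
      qed
      then have "(g, m) \<in> ?I" using r g by auto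
      moreover have "f \<in> ?B (g, m)" using f UF g(2) by auto
      ultimately show "f \<in> (\<Union>k\<in>?I. ?B k)" by blast
    qed
    then have eq: "U = (\<Union>k\<in>?I. ?B k)" by blast
    have "countable ?I" using G(1) by (intro countable_subset[of ?I "G \<times> UNIV"]) auto
    moreover have "?B k \<in> sets ?R" if "k \<in> ?I" for k
    proof -
      obtain g m where k: "k = (g, m)" by (cases k)
      then have "g \<in> ?F" using that G(2) by auto
      from path_space_ball_cylinder[OF this, of "3 / Suc m"] show ?thesis
        unfolding k by (auto simp: sets_restrict_space)
    qed
    ultimately have "(\<Union>k\<in>?I. ?B k) \<in> sets ?R" by (intro sets.countable_UN') auto
    then show ?thesis using eq by simp
  qed
  have "{U. openin (mtopology_of (path_space n J K T)) U} \<subseteq> Pow ?F"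
    using openin_subset[of "mtopology_of (path_space n J K T)"] by auto
  then have "sets (path_borel n J K T) = sigma_sets ?F {U. openin (mtopology_of (path_space n J K T)) U}"
    unfolding path_borel_def by (rule sets_measure_of)
  also have "\<dots> \<subseteq> sets ?R"
    using sets.sigma_sets_subset[of "{U. openin (mtopology_of (path_space n J K T)) U}" ?R] open_sets FP
    by (auto simp: space_restrict_space Int_absorb2)
  finally show ?thesis using assms by (auto simp: sets_restrict_space)
qed

lemma path_law_unique:
  assumes M: "prob_space M" "prob_space M'"
    and Y: "\<And>q. q \<in> coords n J K \<times> triangle T \<Longrightarrow> Y q \<in> borel_measurable M"
    and Y': "\<And>q. q \<in> coords n J K \<times> triangle T \<Longrightarrow> Y' q \<in> borel_measurable M'"
    and cont: "\<And>\<omega>. \<omega> \<in> space M \<Longrightarrow> continuous_map (index_space n J K T) euclidean (\<lambda>q. Y q \<omega>)"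
    and cont': "\<And>\<omega>. \<omega> \<in> space M' \<Longrightarrow> continuous_map (index_space n J K T) euclidean (\<lambda>q. Y' q \<omega>)"
    and ch: "\<And>S c. finite S \<Longrightarrow> S \<subseteq> coords n J K \<times> triangle T \<Longrightarrow>
      char (distr M borel (\<lambda>\<omega>. \<Sum>q\<in>S. c q * Y q \<omega>)) 1 = char (distr M' borel (\<lambda>\<omega>. \<Sum>q\<in>S. c q * Y' q \<omega>)) 1"
  shows "path_law n J K T M Y = path_law n J K T M' Y'"
proof -
  let ?F = "mspace (path_space n J K T)" and ?Q = "coords n J K \<times> triangle T"
  let ?P = "PiM ?Q (\<lambda>_. borel :: real measure)"
  let ?y = "\<lambda>\<omega>. restrict (\<lambda>q. Y q \<omega>) ?Q" and ?y' = "\<lambda>\<omega>. restrict (\<lambda>q. Y' q \<omega>) ?Q"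
  interpret M: prob_space M by fact
  interpret M': prob_space M' by fact
  have ym [measurable]: "?y \<in> measurable M ?P" "?y' \<in> measurable M' ?P"
    using Y Y' by (auto intro!: measurable_restrict)
  have restr: "continuous_map (index_space n J K T) euclidean (restrict h ?Q)"
    if "continuous_map (index_space n J K T) euclidean h" for h :: "_ \<Rightarrow> real"
    using that by (subst continuous_map_eq[of _ _ h]) auto
  have yF: "?y \<omega> \<in> ?F" if "\<omega> \<in> space M" for \<omega>
    unfolding mspace_path_space using restr[OF cont[OF that]] by simp
  have yF': "?y' \<omega> \<in> ?F" if "\<omega> \<in> space M'" for \<omega>
    unfolding mspace_path_space using restr[OF cont'[OF that]] by simp
  have space: "space (path_borel n J K T) = ?F" by (simp add: path_borel_def space_measure_of_conv)
  \<comment> \<open>The path map takes values in \<open>?F\<close>, so a Borel set and its cylinder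
    have the same preimage. Measurability and equality of laws are thereby inherited from the
    product space.\<close>
  have pre: "?y -` B \<inter> space M = ?y -` V \<inter> space M" "?y' -` B \<inter> space M' = ?y' -` V \<inter> space M'"
    if "B = ?F \<inter> V" for B V
    using that yF yF' by auto
  have yb: "?y \<in> measurable M (path_borel n J K T)" "?y' \<in> measurable M' (path_borel n J K T)"
  proof -
    show "?y \<in> measurable M (path_borel n J K T)"
    proof (rule measurableI)
      fix B assume B: "B \<in> sets (path_borel n J K T)"
      obtain V where V: "V \<in> sets ?P" "B = ?F \<inter> V" using sets_path_borel_cylinder[OF B] by blast
      show "?y -` B \<inter> space M \<in> sets M" unfolding pre(1)[OF V(2)] by (rule measurable_sets[OF ym(1) V(1)])
    qed (use yF space in simp)
    show "?y' \<in> measurable M' (path_borel n J K T)"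
    proof (rule measurableI)
      fix B assume B: "B \<in> sets (path_borel n J K T)"
      obtain V where V: "V \<in> sets ?P" "B = ?F \<inter> V" using sets_path_borel_cylinder[OF B] by blast
      show "?y' -` B \<inter> space M' \<in> sets M'" unfolding pre(2)[OF V(2)] by (rule measurable_sets[OF ym(2) V(1)])
    qed (use yF' space in simp)
  qed
  have law: "distr M ?P ?y = distr M' ?P ?y'"
  proof (rule measure_eqI_PiM_infinite)
    fix S A assume S: "finite S" "S \<subseteq> ?Q" and A: "\<And>i. i \<in> S \<Longrightarrow> A i \<in> sets (borel :: real measure)"
    have cyl: "prod_emb ?Q (\<lambda>_. borel) S (Pi\<^sub>E S A) \<in> sets ?P"
      using S A by (intro sets_PiM_I) auto
    have prod: "(\<Prod>q\<in>S. indicator (A q) (h q)) = (indicator (prod_emb ?Q (\<lambda>_. borel :: real measure) S (Pi\<^sub>E S A)) (restrict h ?Q) :: real)" for h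
    proof (cases "\<forall>q\<in>S. h q \<in> A q")
      case True
      then have "restrict h ?Q \<in> prod_emb ?Q (\<lambda>_. borel :: real measure) S (Pi\<^sub>E S A)"
        using S(2) by (auto simp: prod_emb_def restrict_PiE_iff subset_iff)
      then show ?thesis using True by simp
    next
      case False
      then have "restrict h ?Q \<notin> prod_emb ?Q (\<lambda>_. borel :: real measure) S (Pi\<^sub>E S A)"
        using S(2) by (auto simp: prod_emb_def PiE_iff subset_iff)
      moreover obtain q where "q \<in> S" "h q \<notin> A q" using False by blast
      then have "(\<Prod>q\<in>S. indicat_real (A q) (h q)) = 0" using S(1) by (intro prod_zero bexI[of _ q]) simp_all
      ultimately show ?thesis by simp
    qed
    have "(\<integral>\<omega>. indicator (prod_emb ?Q (\<lambda>_. borel) S (Pi\<^sub>E S A)) (?y \<omega>) \<partial>M)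
        = (\<integral>\<omega>. indicator (prod_emb ?Q (\<lambda>_. borel) S (Pi\<^sub>E S A)) (?y' \<omega>) \<partial>M' :: real)"
      using joint_law_unique[OF M Y Y' ch S, of A] A unfolding prod by blast
    then have "(\<integral>x. indicator (prod_emb ?Q (\<lambda>_. borel) S (Pi\<^sub>E S A)) x \<partial>distr M ?P ?y)
        = (\<integral>x. indicator (prod_emb ?Q (\<lambda>_. borel) S (Pi\<^sub>E S A)) x \<partial>distr M' ?P ?y' :: real)"
      by (subst (1 2) integral_distr) (use cyl in \<open>simp_all add: ym\<close>)
    then have "measure (distr M ?P ?y) (prod_emb ?Q (\<lambda>_. borel) S (Pi\<^sub>E S A))
        = measure (distr M' ?P ?y') (prod_emb ?Q (\<lambda>_. borel) S (Pi\<^sub>E S A))"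
      using cyl by (simp add: prod_emb_def)
    then show "emeasure (distr M ?P ?y) (prod_emb ?Q (\<lambda>_. borel) S (Pi\<^sub>E S A))
        = emeasure (distr M' ?P ?y') (prod_emb ?Q (\<lambda>_. borel) S (Pi\<^sub>E S A))"
      using M.prob_space_distr[OF ym(1)] M'.prob_space_distr[OF ym(2)]
      by (simp add: finite_measure.emeasure_eq_measure prob_space_def)
  next
    show "finite_measure (distr M ?P ?y)" by (rule M.finite_measure_distr) simp
  qed simp_all
  show ?thesis
  proof (rule measure_eqI)
    fix B assume "B \<in> sets (path_law n J K T M Y)"
    then have B: "B \<in> sets (path_borel n J K T)" by (simp add: path_law_def)
    obtain V where V: "V \<in> sets ?P" "B = ?F \<inter> V" using sets_path_borel_cylinder[OF B] by blast
    have "emeasure (path_law n J K T M Y) B = emeasure (distr M ?P ?y) V"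
      unfolding path_law_def emeasure_distr[OF yb(1) B] emeasure_distr[OF ym(1) V(1)] pre(1)[OF V(2)] ..
    also have "\<dots> = emeasure (distr M' ?P ?y') V" unfolding law ..
    also have "\<dots> = emeasure (path_law n J K T M' Y') B"
      unfolding path_law_def emeasure_distr[OF yb(2) B] emeasure_distr[OF ym(2) V(1)] pre(2)[OF V(2)] ..
    finally show "emeasure (path_law n J K T M Y) B = emeasure (path_law n J K T M' Y') B" .
  qed (simp add: path_law_def)
qed

section \<open>Continuous Gaussian fields\<close>

definition square :: "real \<Rightarrow> (real \<times> real) set" where
  "square T = {0..T} \<times> {0..T}"

definition grid :: "nat \<Rightarrow> real \<times> real \<Rightarrow> real \<times> real" where
  "grid m x = (\<lfloor>2 ^ m * fst x\<rfloor> / 2 ^ m, \<lfloor>2 ^ m * snd x\<rfloor> / 2 ^ m)"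

definition grid_points :: "real \<Rightarrow> nat \<Rightarrow> (real \<times> real) set" where
  "grid_points T m = square T \<inter> range (\<lambda>(i, j). (of_nat i / 2 ^ m, of_nat j / 2 ^ m))"

definition adjacent :: "nat \<Rightarrow> real \<times> real \<Rightarrow> real \<times> real \<Rightarrow> bool" where
  "adjacent m u v \<longleftrightarrow> \<bar>fst u - fst v\<bar> \<le> 1 / 2 ^ m \<and> \<bar>snd u - snd v\<bar> \<le> 1 / 2 ^ m"

lemma finite_grid_points: "finite (grid_points T m)"
  and card_grid_points: "0 \<le> T \<Longrightarrow> real (card (grid_points T m)) \<le> ((T + 1) * 2 ^ m)\<^sup>2"
proof -
  let ?N = "nat \<lfloor>T * 2 ^ m\<rfloor>"
  have sub: "grid_points T m \<subseteq> (\<lambda>(i, j). (of_nat i / 2 ^ m, of_nat j / 2 ^ m)) ` ({..?N} \<times> {..?N})"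
  proof
    fix x assume "x \<in> grid_points T m"
    then obtain i j :: nat where x: "x = (i / 2 ^ m, j / 2 ^ m)" and "i / 2 ^ m \<le> T" "j / 2 ^ m \<le> T"
      by (auto simp: grid_points_def square_def)
    then have "real i \<le> T * 2 ^ m" "real j \<le> T * 2 ^ m" by (simp_all add: field_simps)
    then have "i \<le> ?N" "j \<le> ?N" by (simp_all add: le_nat_floor)
    then show "x \<in> (\<lambda>(i, j). (of_nat i / 2 ^ m, of_nat j / 2 ^ m)) ` ({..?N} \<times> {..?N})"
      unfolding x by (intro image_eqI[of _ _ "(i, j)"]) auto
  qed
  then show "finite (grid_points T m)" by (rule finite_subset) simp
  assume T: "0 \<le> T"
  have "card (grid_points T m) \<le> card ({..?N} \<times> {..?N})"
    using sub by (rule surj_card_le[rotated]) simp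
  then have "real (card (grid_points T m)) \<le> (real ?N + 1)\<^sup>2"
    using of_nat_mono[where ?'a=real, of "card (grid_points T m)" "Suc ?N * Suc ?N"]
    by (simp add: card_cartesian_product power2_eq_square algebra_simps)
  also have "\<dots> \<le> ((T + 1) * 2 ^ m)\<^sup>2"
  proof (rule power_mono)
    have "real ?N \<le> T * 2 ^ m" using T by (simp add: of_nat_nat)
    moreover have "(1::real) \<le> 2 ^ m" by simp
    ultimately show "real ?N + 1 \<le> (T + 1) * 2 ^ m" unfolding distrib_right by linarith
  qed simp
  finally show "real (card (grid_points T m)) \<le> ((T + 1) * 2 ^ m)\<^sup>2" .
qed

lemma grid_points_square: "grid_points T m \<subseteq> square T"
  by (auto simp: grid_points_def)

lemma grid_in_grid_points:
  assumes "x \<in> square T"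
  shows "grid m x \<in> grid_points T m"
proof -
  have le: "\<lfloor>2 ^ m * s\<rfloor> / 2 ^ m \<le> s" for s :: real
    by (simp add: field_simps)
  have nat: "\<lfloor>2 ^ m * s\<rfloor> / 2 ^ m = real (nat \<lfloor>2 ^ m * s\<rfloor>) / 2 ^ m" if "0 \<le> s" for s :: real
    using that by (simp add: of_nat_nat)
  have "0 \<le> \<lfloor>2 ^ m * s\<rfloor> / 2 ^ m \<and> \<lfloor>2 ^ m * s\<rfloor> / 2 ^ m \<le> T" if "0 \<le> s" "s \<le> T" for s :: real
    using le[of s] that by simp
  then have "grid m x \<in> square T"
    using assms by (simp add: square_def grid_def mem_Times_iff)
  moreover have "grid m x = (\<lambda>(i, j). (of_nat i / 2 ^ m, of_nat j / 2 ^ m)) (nat \<lfloor>2 ^ m * fst x\<rfloor>, nat \<lfloor>2 ^ m * snd x\<rfloor>)"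
    unfolding grid_def prod.case using assms nat[of "fst x"] nat[of "snd x"]
    by (simp add: square_def mem_Times_iff)
  ultimately show ?thesis unfolding grid_points_def by (simp only: IntI rangeI)
qed

lemma grid_points_Suc: "grid_points T m \<subseteq> grid_points T (Suc m)"
proof
  fix x assume "x \<in> grid_points T m"
  then obtain i j :: nat where x: "x \<in> square T" "x = (i / 2 ^ m, j / 2 ^ m)"
    by (auto simp: grid_points_def)
  then have "x = (\<lambda>(i, j). (of_nat i / 2 ^ Suc m, of_nat j / 2 ^ Suc m)) (2 * i, 2 * j)" by simp
  then show "x \<in> grid_points T (Suc m)" using x(1) unfolding grid_points_def by (simp only: IntI rangeI)
qed

text \<open>The floor of 2y is either twice the floor of y or one more, so refining moves each
  coordinate by at most one mesh of the finer grid.\<close>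

lemma grid_Suc_adjacent: "adjacent (Suc m) (grid (Suc m) x) (grid m x)"
proof -
  have "\<bar>\<lfloor>2 ^ Suc m * s\<rfloor> / 2 ^ Suc m - \<lfloor>2 ^ m * s\<rfloor> / 2 ^ m\<bar> \<le> 1 / 2 ^ Suc m" for s :: real
  proof -
    define y where "y = 2 ^ m * s"
    have "2 * real_of_int \<lfloor>y\<rfloor> \<le> 2 * y" "2 * y < 2 * real_of_int \<lfloor>y\<rfloor> + 2"
      using of_int_floor_le[of y] real_of_int_floor_add_one_gt[of y] by linarith+
    then have "2 * \<lfloor>y\<rfloor> \<le> \<lfloor>2 * y\<rfloor>" "\<lfloor>2 * y\<rfloor> \<le> 2 * \<lfloor>y\<rfloor> + 1"
      by (simp_all add: le_floor_iff floor_le_iff)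
    then have "\<bar>real_of_int \<lfloor>2 * y\<rfloor> - 2 * real_of_int \<lfloor>y\<rfloor>\<bar> \<le> 1" by linarith
    then have "\<bar>real_of_int \<lfloor>2 * y\<rfloor> - 2 * real_of_int \<lfloor>y\<rfloor>\<bar> / 2 ^ Suc m \<le> 1 / 2 ^ Suc m"
      by (intro divide_right_mono) auto
    moreover have "\<lfloor>2 ^ Suc m * s\<rfloor> / 2 ^ Suc m - \<lfloor>2 ^ m * s\<rfloor> / 2 ^ m
        = (real_of_int \<lfloor>2 * y\<rfloor> - 2 * real_of_int \<lfloor>y\<rfloor>) / 2 ^ Suc m"
      by (simp add: y_def field_simps)
    ultimately show ?thesis by (simp only: abs_divide) simp
  qed
  then show ?thesis by (simp add: adjacent_def grid_def)
qed

lemma grid_adjacent: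
  assumes "dist x y < 1 / 2 ^ m"
  shows "adjacent m (grid m x) (grid m y)"
proof -
  have *: "\<bar>\<lfloor>2 ^ m * s\<rfloor> / 2 ^ m - \<lfloor>2 ^ m * t\<rfloor> / 2 ^ m\<bar> \<le> 1 / 2 ^ m" if "\<bar>s - t\<bar> < 1 / 2 ^ m" for s t :: real
  proof -
    have "\<bar>2 ^ m * s - 2 ^ m * t\<bar> < 1"
    proof -
      have "2 ^ m * \<bar>s - t\<bar> < 1" using that by (simp add: field_simps)
      then show ?thesis by (simp add: abs_mult flip: right_diff_distrib)
    qed
    then have "\<lfloor>2 ^ m * s\<rfloor> - \<lfloor>2 ^ m * t\<rfloor> \<le> 1" "\<lfloor>2 ^ m * t\<rfloor> - \<lfloor>2 ^ m * s\<rfloor> \<le> 1"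
      using floor_mono[of "2 ^ m * s" "2 ^ m * t + 1"] floor_mono[of "2 ^ m * t" "2 ^ m * s + 1"]
      unfolding abs_less_iff one_add_floor[symmetric] by linarith+
    then have "\<bar>real_of_int \<lfloor>2 ^ m * s\<rfloor> - real_of_int \<lfloor>2 ^ m * t\<rfloor>\<bar> \<le> 1" by linarith
    then show ?thesis by (simp add: divide_right_mono flip: diff_divide_distrib)
  qed
  have "\<bar>fst x - fst y\<bar> < 1 / 2 ^ m" "\<bar>snd x - snd y\<bar> < 1 / 2 ^ m"
    using dist_fst_le[of x y] dist_snd_le[of x y] assms by (auto simp: dist_real_def)
  then show ?thesis using * by (simp add: adjacent_def grid_def)
qed

lemma grid_tendsto: "(\<lambda>m. grid m x) \<longlonglongrightarrow> x"
proof -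
  have *: "(\<lambda>m. \<lfloor>2 ^ m * s\<rfloor> / 2 ^ m) \<longlonglongrightarrow> s" for s :: real
  proof (rule tendsto_sandwich)
    show "(\<lambda>m. s - (1 / 2) ^ m) \<longlonglongrightarrow> s"
      by (rule tendsto_eq_intros LIMSEQ_power_zero refl | simp)+
    show "\<forall>\<^sub>F m in sequentially. s - (1 / 2) ^ m \<le> \<lfloor>2 ^ m * s\<rfloor> / 2 ^ m"
    proof (intro always_eventually allI)
      fix m
      have "2 ^ m * s - 1 \<le> \<lfloor>2 ^ m * s\<rfloor>" by linarith
      then have "(2 ^ m * s - 1) / 2 ^ m \<le> \<lfloor>2 ^ m * s\<rfloor> / 2 ^ m" by (intro divide_right_mono) auto
      then show "s - (1 / 2) ^ m \<le> \<lfloor>2 ^ m * s\<rfloor> / 2 ^ m" by (simp add: diff_divide_distrib power_divide)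
    qed
    show "\<forall>\<^sub>F m in sequentially. \<lfloor>2 ^ m * s\<rfloor> / 2 ^ m \<le> s"
    proof (intro always_eventually allI)
      fix m
      have "\<lfloor>2 ^ m * s\<rfloor> / 2 ^ m \<le> 2 ^ m * s / 2 ^ m" by (intro divide_right_mono of_int_floor_le) auto
      then show "\<lfloor>2 ^ m * s\<rfloor> / 2 ^ m \<le> s" by simp
    qed
  qed simp
  have "(\<lambda>m. (\<lfloor>2 ^ m * fst x\<rfloor> / 2 ^ m, \<lfloor>2 ^ m * snd x\<rfloor> / 2 ^ m)) \<longlonglongrightarrow> (fst x, snd x)"
    by (intro tendsto_Pair *)
  then show ?thesis by (simp add: grid_def)
qed

text \<open>The deterministic half of the Kolmogorov-Chentsov argument. Roundings of one point at
  successive levels are adjacent, so the values form a Cauchy sequence with a geometric tail; two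
  close points are compared at a single level, where their roundings are adjacent.\<close>

lemma chain_limit:
  fixes f :: "real \<times> real \<Rightarrow> real"
  assumes \<rho>: "0 < \<rho>" "\<rho> < 1"
    and osc: "\<And>m u v. m0 \<le> m \<Longrightarrow> u \<in> grid_points T m \<Longrightarrow> v \<in> grid_points T m \<Longrightarrow> adjacent m u v \<Longrightarrow>
      \<bar>f u - f v\<bar> \<le> \<rho> ^ m"
  shows "x \<in> square T \<Longrightarrow> convergent (\<lambda>m. f (grid m x))"
    and "continuous_on (square T) (\<lambda>x. lim (\<lambda>m. f (grid m x)))"
proof -
  have chain: "\<bar>f (grid (m + j) x) - f (grid m x)\<bar> \<le> (\<rho> ^ m - \<rho> ^ (m + j)) / (1 - \<rho>)"
    if m: "m0 \<le> m" and x: "x \<in> square T" for m j x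
  proof (induction j)
    case (Suc j)
    have "\<bar>f (grid (Suc (m + j)) x) - f (grid (m + j) x)\<bar> \<le> \<rho> ^ Suc (m + j)"
      using grid_in_grid_points[OF x, of "Suc (m + j)"] grid_in_grid_points[OF x, of "m + j"]
        grid_points_Suc[of T "m + j"] m
      by (intro osc grid_Suc_adjacent) auto
    \<comment> \<open>Giving away one factor \<rho> lets the increments telescope exactly.\<close>
    also have "\<dots> \<le> \<rho> ^ (m + j)" using \<rho> by (intro power_decreasing) auto
    also have "\<dots> = (\<rho> ^ (m + j) - \<rho> ^ Suc (m + j)) / (1 - \<rho>)" using \<rho> by (simp add: field_simps)
    finally have "\<bar>f (grid (Suc (m + j)) x) - f (grid m x)\<bar>
        \<le> (\<rho> ^ (m + j) - \<rho> ^ Suc (m + j)) / (1 - \<rho>) + (\<rho> ^ m - \<rho> ^ (m + j)) / (1 - \<rho>)"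
      using Suc by linarith
    also have "\<dots> = (\<rho> ^ m - \<rho> ^ (m + Suc j)) / (1 - \<rho>)" by (simp flip: add_divide_distrib)
    finally show ?case by simp
  qed simp
  have tail: "\<bar>f (grid n x) - f (grid m x)\<bar> \<le> \<rho> ^ m / (1 - \<rho>)"
    if mn: "m0 \<le> m" "m \<le> n" "x \<in> square T" for m n x
  proof -
    obtain j where n: "n = m + j" using mn(2) le_Suc_ex by blast
    have "(\<rho> ^ m - \<rho> ^ (m + j)) / (1 - \<rho>) \<le> \<rho> ^ m / (1 - \<rho>)" using \<rho> by (intro divide_right_mono) auto
    then show ?thesis using chain[OF mn(1,3), of j] unfolding n by linarith
  qed
  have small: "\<exists>m\<ge>m0. c * \<rho> ^ m < e" if "e > 0" for c e
  proof -
    have "(\<lambda>m. c * \<rho> ^ m) \<longlonglongrightarrow> c * 0" using \<rho> by (intro tendsto_intros LIMSEQ_power_zero) auto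
    then have "\<forall>\<^sub>F m in sequentially. c * \<rho> ^ m < e" using that by (simp add: order_tendsto_iff)
    then have "\<forall>\<^sub>F m in sequentially. m0 \<le> m \<and> c * \<rho> ^ m < e"
      using eventually_ge_at_top[of m0] by eventually_elim simp
    then show ?thesis by (auto simp: eventually_sequentially)
  qed
  show conv: "convergent (\<lambda>m. f (grid m x))" if x: "x \<in> square T" for x
    unfolding Cauchy_convergent_iff[symmetric]
  proof (rule metric_CauchyI)
    fix e :: real assume "e > 0"
    then obtain m where m: "m0 \<le> m" "2 / (1 - \<rho>) * \<rho> ^ m < e" using small by blast
    have "dist (f (grid i x)) (f (grid j x)) < e" if "m \<le> i" "m \<le> j" for i j
    proof -
      have "\<bar>f (grid i x) - f (grid j x)\<bar> \<le> \<rho> ^ m / (1 - \<rho>) + \<rho> ^ m / (1 - \<rho>)"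
        using tail[OF m(1) that(1) x] tail[OF m(1) that(2) x] by linarith
      then show ?thesis using m(2) by (simp add: dist_real_def)
    qed
    then show "\<exists>m. \<forall>i\<ge>m. \<forall>j\<ge>m. dist (f (grid i x)) (f (grid j x)) < e" by blast
  qed
  have limit: "\<bar>lim (\<lambda>m. f (grid m x)) - f (grid m x)\<bar> \<le> \<rho> ^ m / (1 - \<rho>)"
    if "m0 \<le> m" "x \<in> square T" for m x
  proof (rule LIMSEQ_le_const2)
    have "(\<lambda>m. f (grid m x)) \<longlonglongrightarrow> lim (\<lambda>m. f (grid m x))"
      using conv[OF that(2)] by (simp add: convergent_LIMSEQ_iff)
    then show "(\<lambda>n. \<bar>f (grid n x) - f (grid m x)\<bar>) \<longlonglongrightarrow> \<bar>lim (\<lambda>m. f (grid m x)) - f (grid m x)\<bar>"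
      by (intro tendsto_intros)
    show "\<exists>N. \<forall>n\<ge>N. \<bar>f (grid n x) - f (grid m x)\<bar> \<le> \<rho> ^ m / (1 - \<rho>)" using tail that by blast
  qed
  show "continuous_on (square T) (\<lambda>x. lim (\<lambda>m. f (grid m x)))"
    unfolding continuous_on_iff
  proof (intro ballI allI impI)
    fix x e assume x: "x \<in> square T" and e: "0 < (e::real)"
    \<comment> \<open>The constant collects the tails at x and y, 1 / (1 - \<rho>) each, and the
      oscillation between the two roundings.\<close>
    obtain m where m: "m0 \<le> m" "(2 / (1 - \<rho>) + 1) * \<rho> ^ m < e" using small[OF e] by blast
    have "dist (lim (\<lambda>m. f (grid m y))) (lim (\<lambda>m. f (grid m x))) < e"
      if y: "y \<in> square T" and d: "dist y x < 1 / 2 ^ m" for y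
    proof -
      have "\<bar>f (grid m y) - f (grid m x)\<bar> \<le> \<rho> ^ m"
        by (intro osc m grid_in_grid_points x y grid_adjacent d)
      then have "\<bar>lim (\<lambda>m. f (grid m y)) - lim (\<lambda>m. f (grid m x))\<bar> \<le> \<rho> ^ m / (1 - \<rho>) + \<rho> ^ m + \<rho> ^ m / (1 - \<rho>)"
        using limit[OF m(1) x] limit[OF m(1) y] by linarith
      then show ?thesis using m(2) by (simp add: dist_real_def distrib_right)
    qed
    then show "\<exists>d>0. \<forall>y\<in>square T. dist y x < d \<longrightarrow> dist (lim (\<lambda>m. f (grid m y))) (lim (\<lambda>m. f (grid m x))) < e"
      by (intro exI[of _ "1 / 2 ^ m"]) auto
  qed
qed

text \<open>Almost sure convergence carries the characteristic functions to the limit, dominated by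
  1, and the variances converge by assumption.\<close>

lemma (in prob_space) centred_gaussian_limit:
  assumes G: "\<And>m. centred_gaussian M (Z m) (v m)" and [measurable]: "X \<in> borel_measurable M"
    and Z: "AE \<omega> in M. (\<lambda>m. Z m \<omega>) \<longlonglongrightarrow> X \<omega>" and v: "v \<longlonglongrightarrow> w"
  shows "centred_gaussian M X w"
  unfolding centred_gaussian_def
proof (intro conjI allI)
  have [measurable]: "Z m \<in> borel_measurable M" for m using G by (simp add: centred_gaussian_def)
  show "0 \<le> w" using G by (intro LIMSEQ_le_const[OF v]) (auto simp: centred_gaussian_def)
  fix s
  have "(\<lambda>m. \<integral>\<omega>. iexp (s * Z m \<omega>) \<partial>M) \<longlonglongrightarrow> (\<integral>\<omega>. iexp (s * X \<omega>) \<partial>M)"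
  proof (rule integral_dominated_convergence[where w="\<lambda>_. 1"])
    show "AE \<omega> in M. (\<lambda>m. iexp (s * Z m \<omega>)) \<longlonglongrightarrow> iexp (s * X \<omega>)"
      using Z by eventually_elim (intro tendsto_intros)
  qed auto
  then have "(\<lambda>m. char (distr M borel (Z m)) s) \<longlonglongrightarrow> char (distr M borel X) s"
    by (simp add: char_def integral_distr)
  moreover have "(\<lambda>m. char (distr M borel (Z m)) s) = (\<lambda>m. complex_of_real (exp (- (s\<^sup>2 * v m) / 2)))"
    using G by (auto simp: centred_gaussian_def)
  moreover have "(\<lambda>m. complex_of_real (exp (- (s\<^sup>2 * v m) / 2))) \<longlonglongrightarrow> complex_of_real (exp (- (s\<^sup>2 * w) / 2))"
    by (intro tendsto_intros v) auto
  ultimately show "char (distr M borel X) s = complex_of_real (exp (- (s\<^sup>2 * w) / 2))"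
    using LIMSEQ_unique by metis
qed simp

text \<open>Points of a family may repeat, so semidefiniteness is inherited by every kernel pulled
  back along a map of index sets.\<close>

definition psd_on :: "'q set \<Rightarrow> ('q \<Rightarrow> 'q \<Rightarrow> real) \<Rightarrow> bool" where
  "psd_on Q k \<longleftrightarrow> (\<forall>q\<in>Q. \<forall>r\<in>Q. k q r = k r q) \<and>
     (\<forall>(N::nat) x c. x ` {..<N} \<subseteq> Q \<longrightarrow> 0 \<le> (\<Sum>n<N. \<Sum>m<N. c n * c m * k (x n) (x m)))"

lemma psd_onD:
  fixes N :: nat
  assumes "psd_on Q k" "x ` {..<N} \<subseteq> Q"
  shows "0 \<le> (\<Sum>n<N. \<Sum>m<N. c n * c m * k (x n) (x m))"
  using assms unfolding psd_on_def by blast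

lemma psd_on_nat:
  assumes "psd_on Q k" "range x \<subseteq> Q"
  shows "psd_nat (\<lambda>n m. k (x n) (x m))"
  using assms unfolding psd_on_def psd_nat_def by (meson image_mono rangeI subsetD subset_UNIV subset_trans)

lemma psd_on_diag:
  assumes k: "psd_on Q k" and q: "q \<in> Q"
  shows "0 \<le> k q q"
  using psd_onD[OF k, of "\<lambda>_. q" 1 "\<lambda>_. 1"] q by (simp add: lessThan_Suc)

lemma psd_on_increment:
  assumes k: "psd_on Q k" and q: "q \<in> Q" "q' \<in> Q"
  shows "0 \<le> k q q + k q' q' - 2 * k q q'"
proof -
  have "k q' q = k q q'" using k q by (simp add: psd_on_def)
  then show ?thesis
    using psd_onD[OF k, of "\<lambda>n. if n = 0 then q else q'" 2 "\<lambda>n. if n = 0 then 1 else - 1"] q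
    by (simp add: numeral_2_eq_2 lessThan_Suc image_subset_iff algebra_simps)
qed

text \<open>Cauchy-Schwarz for the covariance of the increment between q and \<open>q'\<close> with
  the variable at r. Together with a variance bound it makes the kernel continuous in each
  argument.\<close>

lemma psd_on_Cauchy_Schwarz:
  assumes k: "psd_on Q k" and q: "q \<in> Q" "q' \<in> Q" "r \<in> Q"
  shows "(k q r - k q' r)\<^sup>2 \<le> (k q q + k q' q' - 2 * k q q') * k r r"
proof -
  define d where "d = k q q + k q' q' - 2 * k q q'"
  define \<Delta> where "\<Delta> = k q r - k q' r"
  have sym: "k q' q = k q q'" "k r q = k q r" "k r q' = k q' r" using k q by (simp_all add: psd_on_def)
  \<comment> \<open>The variance of s times the increment plus the variable at r, as a quadratic in
    s. Its discriminant gives the inequality; a vanishing leading coefficient forces the linear one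
    to vanish.\<close>
  have *: "0 \<le> s\<^sup>2 * d + 2 * s * \<Delta> + k r r" for s
    using psd_onD[OF k, of "\<lambda>n. if n = 0 then q else if n = 1 then q' else r" 3
        "\<lambda>n. if n = 0 then s else if n = 1 then - s else 1"] q
    by (simp add: numeral_3_eq_3 lessThan_Suc image_subset_iff sym d_def \<Delta>_def algebra_simps power2_eq_square)
  have d: "0 \<le> d" unfolding d_def by (rule psd_on_increment[OF k q(1,2)])
  have "\<Delta>\<^sup>2 \<le> d * k r r"
  proof (cases "d = 0")
    case True
    have "\<Delta> = 0"
    proof (rule ccontr)
      assume "\<Delta> \<noteq> 0"
      then show False using *[of "- (k r r + 1) / (2 * \<Delta>)"] True by (simp add: field_simps)
    qed
    then show ?thesis using True by simp
  next
    case False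
    then show ?thesis using *[of "- \<Delta> / d"] d by (simp add: field_simps power2_eq_square)
  qed
  then show ?thesis by (simp add: d_def \<Delta>_def)
qed

text \<open>The indexing map need not be injective; \<open>d\<close> adds up the coefficients of
  points that share an index.\<close>

lemma centred_gaussian_family:
  fixes X :: "nat \<Rightarrow> 'w \<Rightarrow> real" and i :: "'q \<Rightarrow> nat"
  assumes G: "\<And>N c. centred_gaussian M (\<lambda>\<omega>. \<Sum>n<N. c n * X n \<omega>) (\<Sum>n<N. \<Sum>m<N. c n * c m * k n m)"
    and S: "finite S"
  shows "centred_gaussian M (\<lambda>\<omega>. \<Sum>q\<in>S. c q * X (i q) \<omega>) (\<Sum>q\<in>S. \<Sum>r\<in>S. c q * c r * k (i q) (i r))"
proof -
  obtain N where N: "\<And>q. q \<in> S \<Longrightarrow> i q < N"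
    using finite_nat_bounded[of "i ` S"] S by auto
  define d where "d = (\<lambda>n. \<Sum>q\<in>S. if i q = n then c q else 0)"
  have sum: "(\<Sum>n<N. d n * f n) = (\<Sum>q\<in>S. c q * f (i q))" for f :: "nat \<Rightarrow> real"
  proof -
    have "(\<Sum>n<N. d n * f n) = (\<Sum>q\<in>S. \<Sum>n<N. (if i q = n then c q else 0) * f n)"
      unfolding d_def sum_distrib_right by (rule sum.swap)
    also have "\<dots> = (\<Sum>q\<in>S. \<Sum>n<N. if i q = n then c q * f n else 0)"
      by (intro sum.cong refl) auto
    also have "\<dots> = (\<Sum>q\<in>S. c q * f (i q))" using N by (intro sum.cong refl) simp
    finally show ?thesis .
  qed
  have "(\<Sum>n<N. \<Sum>m<N. d n * d m * k n m) = (\<Sum>n<N. d n * (\<Sum>m<N. d m * k n m))"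
    by (simp add: sum_distrib_left mult.assoc)
  also have "\<dots> = (\<Sum>q\<in>S. \<Sum>r\<in>S. c q * c r * k (i q) (i r))"
    unfolding sum by (simp add: sum_distrib_left mult.assoc)
  finally show ?thesis using G[of d N] unfolding sum by simp
qed

text \<open>This identifies the covariance of the limiting field. The variance bound controls the
  change of k when one argument is rounded, and the two arguments are rounded one after the
  other.\<close>

lemma kernel_grid_tendsto:
  fixes k :: "('c \<times> real \<times> real) \<Rightarrow> ('c \<times> real \<times> real) \<Rightarrow> real"
  assumes psd: "psd_on (C \<times> square T) k" and h: "0 < h" and B: "0 \<le> B"
    and diag: "\<And>q. q \<in> C \<times> square T \<Longrightarrow> k q q \<le> B"
    and inc: "\<And>c x y. c \<in> C \<Longrightarrow> x \<in> square T \<Longrightarrow> y \<in> square T \<Longrightarrow>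
      k (c, x) (c, x) + k (c, y) (c, y) - 2 * k (c, x) (c, y) \<le> B * (\<bar>fst x - fst y\<bar> + \<bar>snd x - snd y\<bar>) powr h"
    and c: "c \<in> C" "x \<in> square T" and d: "d \<in> C" "y \<in> square T"
  shows "(\<lambda>m. k (c, grid m x) (d, grid m y)) \<longlonglongrightarrow> k (c, x) (d, y)"
proof (rule Lim_null[THEN iffD2])
  define w where "w = (\<lambda>x m. (\<bar>fst (grid m x) - fst x\<bar> + \<bar>snd (grid m x) - snd x\<bar>) powr h)"
  have w0: "w x \<longlonglongrightarrow> 0" for x
  proof -
    have "(\<lambda>m. \<bar>fst (grid m x) - fst x\<bar> + \<bar>snd (grid m x) - snd x\<bar>) \<longlonglongrightarrow> \<bar>fst x - fst x\<bar> + \<bar>snd x - snd x\<bar>"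
      by (intro tendsto_intros grid_tendsto)
    then have "w x \<longlonglongrightarrow> 0 powr h"
      unfolding w_def using h by (intro tendsto_powr') auto
    then show ?thesis by simp
  qed
  have g: "grid m x \<in> square T" if "x \<in> square T" for m x
    using grid_in_grid_points[OF that] grid_points_square by blast
  have bound: "\<bar>k (c, grid m x) r - k (c, x) r\<bar> \<le> sqrt (B * w x m * B)"
    if "c \<in> C" "x \<in> square T" "r \<in> C \<times> square T" for c x r m
  proof (rule real_le_rsqrt)
    have q: "(c, grid m x) \<in> C \<times> square T" "(c, x) \<in> C \<times> square T" using that g by auto
    have "(k (c, grid m x) r - k (c, x) r)\<^sup>2
        \<le> (k (c, grid m x) (c, grid m x) + k (c, x) (c, x) - 2 * k (c, grid m x) (c, x)) * k r r"
      by (rule psd_on_Cauchy_Schwarz[OF psd q that(3)])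
    also have "\<dots> \<le> (B * w x m) * B"
      using that g psd_on_increment[OF psd q] psd_on_diag[OF psd that(3)] diag[OF that(3)] B unfolding w_def
      by (intro mult_mono inc mult_nonneg_nonneg) auto
    finally show "\<bar>k (c, grid m x) r - k (c, x) r\<bar>\<^sup>2 \<le> B * w x m * B" by simp
  qed
  show "(\<lambda>m. k (c, grid m x) (d, grid m y) - k (c, x) (d, y)) \<longlonglongrightarrow> 0"
  proof (rule tendsto_rabs_zero_cancel, rule tendsto_sandwich[where f="\<lambda>_. 0"])
    show "\<forall>\<^sub>F m in sequentially. \<bar>k (c, grid m x) (d, grid m y) - k (c, x) (d, y)\<bar>
        \<le> sqrt (B * w x m * B) + sqrt (B * w y m * B)"
    proof (intro always_eventually allI)
      fix m
      have "k (c, x) (d, grid m y) = k (d, grid m y) (c, x)" "k (c, x) (d, y) = k (d, y) (c, x)"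
        using psd c d g by (auto simp: psd_on_def)
      then show "\<bar>k (c, grid m x) (d, grid m y) - k (c, x) (d, y)\<bar> \<le> sqrt (B * w x m * B) + sqrt (B * w y m * B)"
        using bound[OF c, of "(d, grid m y)" m] bound[OF d, of "(c, x)" m] c d g[OF d(2)] by simp
    qed
    have "(\<lambda>m. sqrt (B * w x m * B) + sqrt (B * w y m * B)) \<longlonglongrightarrow> sqrt (B * 0 * B) + sqrt (B * 0 * B)"
      by (intro tendsto_intros w0)
    then show "(\<lambda>m. sqrt (B * w x m * B) + sqrt (B * w y m * B)) \<longlonglongrightarrow> 0" by simp
  qed auto
qed

text \<open>Borel-Cantelli over the dyadic levels. The variance of an increment between neighbours
  at level m decays like the m-th power of 2 powr (- h), while the number of pairs is bounded by a
  multiple of 16 ^ m; a moment of high order, chosen from h alone, outweighs that number.\<close>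

lemma (in prob_space) gaussian_oscillation:
  fixes X :: "'c \<times> real \<times> real \<Rightarrow> 'a \<Rightarrow> real"
  assumes C: "finite C" and T: "0 \<le> T" and h: "0 < h" and B: "0 \<le> B"
    and inc: "\<And>c m u v. c \<in> C \<Longrightarrow> u \<in> grid_points T m \<Longrightarrow> v \<in> grid_points T m \<Longrightarrow>
      \<exists>s. centred_gaussian M (\<lambda>\<omega>. X (c, u) \<omega> - X (c, v) \<omega>) s \<and>
        s \<le> B * (\<bar>fst u - fst v\<bar> + \<bar>snd u - snd v\<bar>) powr h"
  defines "\<rho> \<equiv> 2 powr (- h / 4)"
  shows "AE \<omega> in M. \<forall>\<^sub>F m in sequentially. \<forall>c\<in>C. \<forall>u\<in>grid_points T m. \<forall>v\<in>grid_points T m.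
    adjacent m u v \<longrightarrow> \<bar>X (c, u) \<omega> - X (c, v) \<omega>\<bar> < \<rho> ^ m"
proof -
  define \<theta> where "\<theta> = (2::real) powr (- h / 2)"
  have \<rho>: "0 < \<rho>" and \<theta>: "0 < \<theta>" "\<theta> < 1" using h by (auto simp: \<rho>_def \<theta>_def powr_less_one)
  have \<rho>\<theta>: "\<rho>\<^sup>2 = \<theta>" by (simp add: \<rho>_def \<theta>_def power2_eq_square flip: powr_add)
  \<comment> \<open>The order k is chosen so that 16 * \<theta> ^ k is below 1 / 2, which makes the
    probabilities of the bad events summable.\<close>
  have "(\<lambda>k. \<theta> ^ k) \<longlonglongrightarrow> 0" using \<theta> by (intro LIMSEQ_power_zero) auto
  then have "\<forall>\<^sub>F k in sequentially. \<theta> ^ k < 1 / 32" by (rule order_tendstoD) simp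
  then obtain k where k: "\<theta> ^ k < 1 / 32" by (auto simp: eventually_sequentially)
  define c\<^sub>k :: real where "c\<^sub>k = fact (2 * k) / (2 ^ k * fact k)"
  define I where "I = (\<lambda>m. {(c, u, v) \<in> C \<times> grid_points T m \<times> grid_points T m. adjacent m u v})"
  define A where "A = (\<lambda>m (c, u, v). {\<omega> \<in> space M. \<rho> ^ m \<le> \<bar>X (c, u) \<omega> - X (c, v) \<omega>\<bar>})"
  have finI: "finite (I m)" for m
    unfolding I_def by (rule finite_subset[of _ "C \<times> grid_points T m \<times> grid_points T m"])
      (auto simp: C finite_grid_points)
  have A: "A m i \<in> events \<and> prob (A m i) \<le> c\<^sub>k * (B * 2 powr h) ^ k * (\<theta> ^ k) ^ m" if i_I: "i \<in> I m" for m i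
  proof -
    from i_I obtain c u v where i: "i = (c, u, v)" "c \<in> C" "u \<in> grid_points T m" "v \<in> grid_points T m" "adjacent m u v"
      by (auto simp: I_def)
    obtain s where s: "centred_gaussian M (\<lambda>\<omega>. X (c, u) \<omega> - X (c, v) \<omega>) s"
        "s \<le> B * (\<bar>fst u - fst v\<bar> + \<bar>snd u - snd v\<bar>) powr h"
      using inc[OF i(2-4)] by blast
    have [measurable]: "(\<lambda>\<omega>. X (c, u) \<omega> - X (c, v) \<omega>) \<in> borel_measurable M"
      using s by (simp add: centred_gaussian_def)
    have s0: "0 \<le> s" using s by (simp add: centred_gaussian_def)
    have "(\<bar>fst u - fst v\<bar> + \<bar>snd u - snd v\<bar>) powr h \<le> (2 / 2 ^ m) powr h"
      using i(5) h by (intro powr_mono2) (auto simp: adjacent_def)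
    also have "\<dots> = 2 powr h * (2 powr (- h)) ^ m"
      by (simp add: powr_divide powr_minus_divide power_divide powr_powr flip: powr_realpow)
         (simp add: mult.commute)
    \<comment> \<open>Half of the decay, \<open>\<rho>\<^sup>2\<close> per level, pays for the
      squared threshold; the other half, \<theta>, is left for the tail bound.\<close>
    also have "2 powr (- h) = \<theta> * \<rho>\<^sup>2" unfolding \<rho>\<theta> by (simp add: \<theta>_def flip: powr_add)
    finally have "s \<le> B * (2 powr h * (\<theta> * \<rho>\<^sup>2) ^ m)"
      using s(2) B by (meson mult_left_mono order_trans)
    then have "s / (\<rho> ^ m)\<^sup>2 \<le> B * 2 powr h * \<theta> ^ m"
      using \<rho> by (simp add: divide_le_eq power_mult_distrib mult_ac flip: power_mult)
    then have "(s / (\<rho> ^ m)\<^sup>2) ^ k \<le> (B * 2 powr h * \<theta> ^ m) ^ k"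
      using s0 by (intro power_mono) auto
    then have "c\<^sub>k * (s / (\<rho> ^ m)\<^sup>2) ^ k \<le> c\<^sub>k * (B * 2 powr h * \<theta> ^ m) ^ k"
      by (intro mult_left_mono) (auto simp: c\<^sub>k_def)
    moreover have "prob (A m i) \<le> c\<^sub>k * (s / (\<rho> ^ m)\<^sup>2) ^ k"
      using centred_gaussian_tail[OF s(1), of "\<rho> ^ m" k] \<rho> by (simp add: A_def i c\<^sub>k_def)
    moreover have "c\<^sub>k * (B * 2 powr h * \<theta> ^ m) ^ k = c\<^sub>k * (B * 2 powr h) ^ k * (\<theta> ^ k) ^ m"
      by (simp add: power_mult_distrib mult_ac flip: power_mult)
    moreover have "A m i \<in> events" by (simp add: A_def i)
    ultimately show ?thesis by linarith
  qed
  define bad where "bad = (\<lambda>m. \<Union>i\<in>I m. A m i)"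
  define c0 where "c0 = real (card C) * (T + 1) ^ 4 * (c\<^sub>k * (B * 2 powr h) ^ k)"
  have c0: "0 \<le> c0" using T B by (auto simp: c0_def c\<^sub>k_def)
  have bad: "bad m \<in> events" for m
    unfolding bad_def using A finI by (intro sets.finite_UN) auto
  have pbad: "prob (bad m) \<le> c0 * (1 / 2) ^ m" for m
  proof -
    let ?b = "c\<^sub>k * (B * 2 powr h) ^ k * (\<theta> ^ k) ^ m"
    \<comment> \<open>All pairs of grid points are counted, adjacent or not; the resulting crude
      power 16 ^ m is absorbed by the choice of k.\<close>
    have "card (I m) \<le> card (C \<times> grid_points T m \<times> grid_points T m)"
      unfolding I_def using C finite_grid_points by (intro card_mono) auto
    then have "real (card (I m)) \<le> real (card C) * (real (card (grid_points T m)))\<^sup>2"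
      using of_nat_mono[where ?'a=real] by (fastforce simp: card_cartesian_product power2_eq_square)
    also have "\<dots> \<le> real (card C) * (((T + 1) * 2 ^ m)\<^sup>2)\<^sup>2"
      using card_grid_points[OF T] by (intro mult_left_mono power_mono) auto
    also have "\<dots> = real (card C) * (T + 1) ^ 4 * 16 ^ m"
      by (simp add: power_mult_distrib flip: power_mult) (simp add: power_mult mult.commute[of m])
    finally have card: "real (card (I m)) \<le> real (card C) * (T + 1) ^ 4 * 16 ^ m" .
    have "prob (bad m) \<le> (\<Sum>i\<in>I m. prob (A m i))"
      unfolding bad_def using A finI by (intro finite_measure_subadditive_finite) auto
    also have "\<dots> \<le> (\<Sum>i\<in>I m. ?b)" using A by (intro sum_mono) auto
    also have "\<dots> = real (card (I m)) * ?b" by simp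
    also have "\<dots> \<le> (real (card C) * (T + 1) ^ 4 * 16 ^ m) * ?b"
      using B \<theta> by (intro mult_right_mono card) (auto simp: c\<^sub>k_def)
    also have "\<dots> = c0 * (16 * \<theta> ^ k) ^ m" by (simp add: c0_def power_mult_distrib mult_ac)
    also have "\<dots> \<le> c0 * (1 / 2) ^ m" using c0 k \<theta> by (intro mult_left_mono power_mono) auto
    finally show ?thesis .
  qed
  have "summable (\<lambda>m. c0 * (1 / 2) ^ m)" by (intro summable_mult summable_geometric) simp
  then have "summable (\<lambda>m. prob (bad m))"
    by (rule summable_comparison_test'[where N=0]) (simp add: pbad)
  then have "AE \<omega> in M. \<forall>\<^sub>F m in sequentially. \<omega> \<in> space M - bad m"
    by (intro borel_cantelli_AE1 bad) (auto simp: less_top[symmetric])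
  then show ?thesis
  proof eventually_elim
    fix \<omega> assume "\<forall>\<^sub>F m in sequentially. \<omega> \<in> space M - bad m"
    then show "\<forall>\<^sub>F m in sequentially. \<forall>c\<in>C. \<forall>u\<in>grid_points T m. \<forall>v\<in>grid_points T m.
        adjacent m u v \<longrightarrow> \<bar>X (c, u) \<omega> - X (c, v) \<omega>\<bar> < \<rho> ^ m"
    proof eventually_elim
      fix m assume *: "\<omega> \<in> space M - bad m"
      show "\<forall>c\<in>C. \<forall>u\<in>grid_points T m. \<forall>v\<in>grid_points T m.
        adjacent m u v \<longrightarrow> \<bar>X (c, u) \<omega> - X (c, v) \<omega>\<bar> < \<rho> ^ m"
      proof (intro ballI impI)
        fix c u v assume "c \<in> C" "u \<in> grid_points T m" "v \<in> grid_points T m" "adjacent m u v"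
        then have "(c, u, v) \<in> I m" by (simp add: I_def)
        then have "\<omega> \<notin> A m (c, u, v)" using * by (auto simp: bad_def)
        then show "\<bar>X (c, u) \<omega> - X (c, v) \<omega>\<bar> < \<rho> ^ m" using * by (simp add: A_def)
      qed
    qed
  qed
qed

text \<open>The field is realised on the dyadic points as a Gaussian sequence and extended by limits
  along rounded points. The limits keep joint Gaussianity and, by continuity of the kernel, the
  covariance.\<close>

theorem continuous_gaussian_field:
  fixes k :: "('c \<times> real \<times> real) \<Rightarrow> ('c \<times> real \<times> real) \<Rightarrow> real" and e :: "nat \<Rightarrow> 'i"
  assumes e: "inj e" and C: "finite C" and T: "0 \<le> T"
    and psd: "psd_on (C \<times> square T) k" and h: "0 < h" and B: "0 \<le> B"
    and diag: "\<And>q. q \<in> C \<times> square T \<Longrightarrow> k q q \<le> B"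
    and inc: "\<And>c x y. c \<in> C \<Longrightarrow> x \<in> square T \<Longrightarrow> y \<in> square T \<Longrightarrow>
      k (c, x) (c, x) + k (c, y) (c, y) - 2 * k (c, x) (c, y) \<le> B * (\<bar>fst x - fst y\<bar> + \<bar>snd x - snd y\<bar>) powr h"
  shows "\<exists>(M :: ('i \<Rightarrow> real) measure) Y. prob_space M \<and>
    (\<forall>q\<in>C \<times> square T. Y q \<in> borel_measurable M) \<and>
    (\<forall>\<omega>\<in>space M. \<forall>c\<in>C. continuous_on (square T) (\<lambda>x. Y (c, x) \<omega>)) \<and>
    (\<forall>S a. finite S \<longrightarrow> S \<subseteq> C \<times> square T \<longrightarrow>
      centred_gaussian M (\<lambda>\<omega>. \<Sum>q\<in>S. a q * Y q \<omega>) (\<Sum>q\<in>S. \<Sum>r\<in>S. a q * a r * k q r))"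
proof (cases "C = {}")
  case True
  \<comment> \<open>Without coordinates only a probability space is required, and the zero kernel
    supplies one.\<close>
  have "psd_nat (\<lambda>_ _. 0)" by (simp add: psd_nat_def)
  from gaussian_sequence[OF this e] obtain M :: "('i \<Rightarrow> real) measure" and X where
    *: "prob_space M \<and> (\<forall>(N :: nat) c. centred_gaussian M (\<lambda>\<omega>. \<Sum>n<N. c n * X n \<omega>) (\<Sum>n<N. \<Sum>m<N. c n * c m * 0))"
    by blast
  from * have "prob_space M" "centred_gaussian M (\<lambda>_. 0) 0" by (auto dest: spec[of _ 0])
  then show ?thesis using True by (intro exI[of _ M] exI[of _ "\<lambda>_ _. 0"]) (auto simp: subset_empty)
next
  case False
  define D where "D = C \<times> (\<Union>m. grid_points T m)"
  have "countable (\<Union>m. grid_points T m)"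
    by (intro countable_UN) (auto intro: countable_finite finite_grid_points)
  then have cD: "countable D" using C by (auto simp: D_def intro: countable_finite)
  have "(0, 0) \<in> square T" using T by (simp add: square_def)
  then have "grid 0 (0, 0) \<in> grid_points T 0" by (rule grid_in_grid_points)
  then have neD: "D \<noteq> {}" using False by (auto simp: D_def)
  have DQ: "D \<subseteq> C \<times> square T" using grid_points_square by (fastforce simp: D_def)
  define x where "x = from_nat_into D"
  define idx where "idx = to_nat_on D"
  have xi: "x (idx q) = q" if "q \<in> D" for q
    unfolding x_def idx_def by (rule from_nat_into_to_nat_on[OF cD that])
  have "range x \<subseteq> C \<times> square T" unfolding x_def using from_nat_into[OF neD] DQ by blast
  then have "psd_nat (\<lambda>n m. k (x n) (x m))" by (rule psd_on_nat[OF psd])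
  from gaussian_sequence[OF this e] obtain M :: "('i \<Rightarrow> real) measure" and X where
    *: "prob_space M \<and> (\<forall>(N :: nat) c. centred_gaussian M (\<lambda>\<omega>. \<Sum>n<N. c n * X n \<omega>) (\<Sum>n<N. \<Sum>m<N. c n * c m * k (x n) (x m)))"
    by blast
  then have M: "prob_space M" by blast
  have G: "centred_gaussian M (\<lambda>\<omega>. \<Sum>n<N. c n * X n \<omega>) (\<Sum>n<N. \<Sum>m<N. c n * c m * k (x n) (x m))" for N c
    using * by blast
  interpret prob_space M by (rule M)
  note fam = centred_gaussian_family[OF G]
  define Z where "Z = (\<lambda>q. X (idx q))"
  have Zm [measurable]: "Z q \<in> borel_measurable M" for q
    using fam[of "{()}" "\<lambda>_. 1" "\<lambda>_. idx q"] by (simp add: Z_def centred_gaussian_def)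
  have gD: "(c, u) \<in> D" if "c \<in> C" "u \<in> grid_points T m" for c u m using that by (auto simp: D_def)
  define \<rho> where "\<rho> = (2::real) powr (- h / 4)"
  have \<rho>: "0 < \<rho>" "\<rho> < 1" using h by (auto simp: \<rho>_def powr_less_one)
  define good where "good = (\<lambda>\<omega>. \<forall>\<^sub>F m in sequentially. \<forall>c\<in>C. \<forall>u\<in>grid_points T m. \<forall>v\<in>grid_points T m.
    adjacent m u v \<longrightarrow> \<bar>Z (c, u) \<omega> - Z (c, v) \<omega>\<bar> < \<rho> ^ m)"
  have good: "AE \<omega> in M. good \<omega>"
    unfolding good_def \<rho>_def
  proof (rule gaussian_oscillation[OF C T h B])
    fix c m u v assume c: "c \<in> C" and u: "u \<in> grid_points T m" and v: "v \<in> grid_points T m"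
    have sq: "u \<in> square T" "v \<in> square T" using u v grid_points_square by blast+
    have "k (c, v) (c, u) = k (c, u) (c, v)" using psd c sq by (simp add: psd_on_def)
    \<comment> \<open>The two Booleans serve as labels of the two points, so that u = v is
      covered.\<close>
    then have "centred_gaussian M (\<lambda>\<omega>. Z (c, u) \<omega> - Z (c, v) \<omega>)
        (k (c, u) (c, u) + k (c, v) (c, v) - 2 * k (c, u) (c, v))"
      using fam[of "UNIV :: bool set" "\<lambda>b. if b then 1 else - 1" "\<lambda>b. if b then idx (c, u) else idx (c, v)"]
      by (simp add: UNIV_bool Z_def xi[OF gD[OF c u]] xi[OF gD[OF c v]] algebra_simps)
    then show "\<exists>s. centred_gaussian M (\<lambda>\<omega>. Z (c, u) \<omega> - Z (c, v) \<omega>) s \<and>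
        s \<le> B * (\<bar>fst u - fst v\<bar> + \<bar>snd u - snd v\<bar>) powr h"
      using inc[OF c sq] by blast
  qed
  have good_meas [measurable]: "Measurable.pred M good"
    unfolding good_def eventually_sequentially
    using C finite_grid_points[of T] by measurable
  \<comment> \<open>On the exceptional event the path is set to 0, which makes every sample path
    continuous and not just almost every one.\<close>
  define Y where "Y = (\<lambda>(c, y) \<omega>. if good \<omega> then lim (\<lambda>m. Z (c, grid m y) \<omega>) else 0)"
  have Ym: "Y q \<in> borel_measurable M" for q
    by (cases q) (simp add: Y_def)
  have chain: "(\<forall>y\<in>square T. convergent (\<lambda>m. Z (c, grid m y) \<omega>)) \<and>
      continuous_on (square T) (\<lambda>y. lim (\<lambda>m. Z (c, grid m y) \<omega>))" if gc: "good \<omega>" "c \<in> C" for \<omega> c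
  proof -
    obtain m0 where m0: "\<forall>m\<ge>m0. \<forall>c\<in>C. \<forall>u\<in>grid_points T m. \<forall>v\<in>grid_points T m.
        adjacent m u v \<longrightarrow> \<bar>Z (c, u) \<omega> - Z (c, v) \<omega>\<bar> < \<rho> ^ m"
      using gc(1) unfolding good_def eventually_sequentially by blast
    have osc: "\<bar>Z (c, u) \<omega> - Z (c, v) \<omega>\<bar> \<le> \<rho> ^ m"
      if "m0 \<le> m" "u \<in> grid_points T m" "v \<in> grid_points T m" "adjacent m u v" for m u v
      using m0 gc(2) that by (meson less_imp_le)
    show ?thesis
      using chain_limit(1)[where f="\<lambda>u. Z (c, u) \<omega>", OF \<rho>, of m0 T]
        chain_limit(2)[where f="\<lambda>u. Z (c, u) \<omega>", OF \<rho>, of m0 T] osc by blast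
  qed
  have cont: "continuous_on (square T) (\<lambda>y. Y (c, y) \<omega>)" if "c \<in> C" for c \<omega>
    using chain[OF _ that, of \<omega>] by (cases "good \<omega>") (auto simp: Y_def)
  have lim: "AE \<omega> in M. (\<lambda>m. Z (c, grid m y) \<omega>) \<longlonglongrightarrow> Y (c, y) \<omega>" if "c \<in> C" "y \<in> square T" for c y
    using good
  proof eventually_elim
    fix \<omega> assume "good \<omega>"
    then show "(\<lambda>m. Z (c, grid m y) \<omega>) \<longlonglongrightarrow> Y (c, y) \<omega>"
      using chain[of \<omega> c] that by (simp add: Y_def convergent_LIMSEQ_iff)
  qed
  have "centred_gaussian M (\<lambda>\<omega>. \<Sum>q\<in>S. a q * Y q \<omega>) (\<Sum>q\<in>S. \<Sum>r\<in>S. a q * a r * k q r)"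
    if S: "finite S" "S \<subseteq> C \<times> square T" for S a
  proof (rule centred_gaussian_limit)
    let ?g = "\<lambda>m q. (fst q, grid m (snd q))"
    have gq: "x (idx (?g m q)) = ?g m q" if "q \<in> S" for m q
    proof (rule xi)
      have "fst q \<in> C" "snd q \<in> square T" using that S by auto
      then show "?g m q \<in> D" by (rule gD[OF _ grid_in_grid_points])
    qed
    have "(\<Sum>q\<in>S. \<Sum>r\<in>S. a q * a r * k (x (idx (?g m q))) (x (idx (?g m r))))
        = (\<Sum>q\<in>S. \<Sum>r\<in>S. a q * a r * k (?g m q) (?g m r))" for m
      by (intro sum.cong refl) (simp add: gq)
    then show "centred_gaussian M (\<lambda>\<omega>. \<Sum>q\<in>S. a q * Z (?g m q) \<omega>)
        (\<Sum>q\<in>S. \<Sum>r\<in>S. a q * a r * k (?g m q) (?g m r))" for m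
      using fam[OF S(1), of a "\<lambda>q. idx (?g m q)"] by (simp add: Z_def)
    show "(\<lambda>\<omega>. \<Sum>q\<in>S. a q * Y q \<omega>) \<in> borel_measurable M"
      by (intro borel_measurable_sum borel_measurable_times borel_measurable_const Ym)
    have "AE \<omega> in M. \<forall>q\<in>S. (\<lambda>m. Z (?g m q) \<omega>) \<longlonglongrightarrow> Y q \<omega>"
      using S lim by (intro AE_finite_allI) auto
    then show "AE \<omega> in M. (\<lambda>m. \<Sum>q\<in>S. a q * Z (?g m q) \<omega>) \<longlonglongrightarrow> (\<Sum>q\<in>S. a q * Y q \<omega>)"
      by eventually_elim (intro tendsto_sum tendsto_mult tendsto_const, blast)
    show "(\<lambda>m. \<Sum>q\<in>S. \<Sum>r\<in>S. a q * a r * k (?g m q) (?g m r)) \<longlonglongrightarrow> (\<Sum>q\<in>S. \<Sum>r\<in>S. a q * a r * k q r)"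
    proof (intro tendsto_sum tendsto_mult tendsto_const)
      fix q r assume "q \<in> S" "r \<in> S"
      then have "fst q \<in> C" "snd q \<in> square T" "fst r \<in> C" "snd r \<in> square T" using S by auto
      from kernel_grid_tendsto[OF psd h B diag inc this]
      show "(\<lambda>m. k (?g m q) (?g m r)) \<longlonglongrightarrow> k q r" by simp
    qed
  qed
  then show ?thesis using M Ym cont by blast
qed

section \<open>Transport of mass in the fluid model\<close>

text \<open>Equal to x^2 / (1 + x^2) for x > 0. The square makes the derivative vanish at 0, so the
  function is C^1 on the whole line; rescaling its argument approximates the indicator of the
  positive half line.\<close>

definition smooth_step :: "real \<Rightarrow> real" where
  "smooth_step x = 1 - 1 / (1 + (max x 0)\<^sup>2)"

definition smooth_step' :: "real \<Rightarrow> real" where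
  "smooth_step' x = 2 * max x 0 / (1 + (max x 0)\<^sup>2)\<^sup>2"

lemma DERIV_max_square: "((\<lambda>x::real. (max x 0)\<^sup>2) has_real_derivative 2 * max x 0) (at x)"
proof (cases "x = 0")
  case False
  show ?thesis
  proof (cases "x < 0")
    case True
    have "((\<lambda>x::real. 0) has_real_derivative 2 * max x 0) (at x)" using True by simp
    then show ?thesis
      by (rule has_field_derivative_transform_within_open[where S="{..<0}"]) (use True in auto)
  next
    assume "\<not> x < 0"
    then have x: "0 < x" using False by simp
    have "((\<lambda>x::real. x\<^sup>2) has_real_derivative 2 * max x 0) (at x)"
      using x by (auto intro!: derivative_eq_intros)
    then show ?thesis
      by (rule has_field_derivative_transform_within_open[where S="{0<..}"]) (use x in auto)
  qed
next
  case True
  have "(\<lambda>h. ((max (0 + h) 0)\<^sup>2 - (max 0 0)\<^sup>2) / h) \<midarrow>0\<rightarrow> (0::real)"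
  proof (rule Lim_null_comparison)
    show "\<forall>\<^sub>F h in at 0. norm (((max (0 + h) 0)\<^sup>2 - (max 0 0)\<^sup>2) / h) \<le> \<bar>h::real\<bar>"
      by (intro always_eventually allI) (auto simp: max_def power2_eq_square)
    show "((\<lambda>h::real. \<bar>h\<bar>) \<longlongrightarrow> 0) (at 0)" by (intro tendsto_eq_intros) auto
  qed
  then show ?thesis using True by (simp add: DERIV_def)
qed

lemma DERIV_smooth_step: "(smooth_step has_real_derivative smooth_step' x) (at x)"
proof -
  have "1 + (max x 0)\<^sup>2 \<noteq> 0" by (metis add_pos_nonneg less_irrefl zero_le_power2 zero_less_one)
  then have outer: "((\<lambda>z. 1 - 1 / (1 + z)) has_real_derivative 1 / (1 + (max x 0)\<^sup>2)\<^sup>2) (at ((max x 0)\<^sup>2))"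
    by (auto intro!: derivative_eq_intros simp: power2_eq_square[of "1 + _"])
  show ?thesis
    using DERIV_chain2[where f="\<lambda>z. 1 - 1 / (1 + z)" and Da="1 / (1 + (max x 0)\<^sup>2)\<^sup>2", OF outer DERIV_max_square[of x]]
    unfolding smooth_step_def[abs_def] smooth_step'_def by simp
qed

lemma smooth_step_nonpos [simp]: "x \<le> 0 \<Longrightarrow> smooth_step x = 0" "x \<le> 0 \<Longrightarrow> smooth_step' x = 0"
  by (simp_all add: smooth_step_def smooth_step'_def)

lemma smooth_step_bounds: "0 \<le> smooth_step x" "smooth_step x \<le> 1"
proof -
  have "1 / (1 + (max x 0)\<^sup>2) \<le> 1 / 1" by (intro divide_left_mono) (auto simp: add_pos_nonneg)
  then show "0 \<le> smooth_step x" by (simp add: smooth_step_def)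
  show "smooth_step x \<le> 1" by (simp add: smooth_step_def add_nonneg_nonneg)
qed

lemma smooth_step_mono: "x \<le> y \<Longrightarrow> smooth_step x \<le> smooth_step y"
proof -
  assume "x \<le> y"
  then have "(max x 0)\<^sup>2 \<le> (max y 0)\<^sup>2" by (intro power_mono) auto
  then show ?thesis unfolding smooth_step_def
    by (intro diff_left_mono divide_left_mono) (auto intro!: mult_pos_pos add_pos_nonneg)
qed

text \<open>This replaces a bound on the second derivative, which jumps at 0: the rational function
  has a derivative of modulus at most 6, and the positive part is 1-Lipschitz.\<close>

lemma smooth_step'_lipschitz: "\<bar>smooth_step' x - smooth_step' y\<bar> \<le> 6 * \<bar>x - y\<bar>"
proof -
  let ?r = "\<lambda>m::real. 2 * m / (1 + m\<^sup>2)\<^sup>2"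
  have "\<bar>?r a - ?r b\<bar> \<le> 6 * \<bar>a - b\<bar>" for a b
  proof -
    have d: "(?r has_real_derivative (2 - 6 * m\<^sup>2) / (1 + m\<^sup>2) ^ 3) (at m within UNIV)" for m
    proof -
      have p: "0 < 1 + m\<^sup>2" by (simp add: add_pos_nonneg)
      have "(?r has_real_derivative (2 * (1 + m\<^sup>2)\<^sup>2 - 2 * m * (2 * (1 + m\<^sup>2) * (2 * m))) / ((1 + m\<^sup>2)\<^sup>2 * (1 + m\<^sup>2)\<^sup>2)) (at m)"
        using p by (auto intro!: derivative_eq_intros simp: power2_eq_square)
      moreover have "(2 * (1 + m\<^sup>2)\<^sup>2 - 2 * m * (2 * (1 + m\<^sup>2) * (2 * m))) / ((1 + m\<^sup>2)\<^sup>2 * (1 + m\<^sup>2)\<^sup>2)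
          = (2 - 6 * m\<^sup>2) / (1 + m\<^sup>2) ^ 3"
      proof -
        have "2 * z\<^sup>2 - 2 * m * (2 * z * (2 * m)) = z * (2 - 6 * m\<^sup>2)" if "z = 1 + m\<^sup>2" for z
          unfolding that by algebra
        then show ?thesis using p by (simp add: power2_eq_square power3_eq_cube)
      qed
      ultimately show ?thesis by simp
    qed
    have b: "norm ((2 - 6 * m\<^sup>2) / (1 + m\<^sup>2) ^ 3) \<le> 6" for m :: real
    proof -
      have p: "1 \<le> 1 + m\<^sup>2" by simp
      have "\<bar>2 - 6 * m\<^sup>2\<bar> \<le> 6 * (1 + m\<^sup>2)" by (auto simp: abs_if)
      also have "\<dots> \<le> 6 * (1 + m\<^sup>2) ^ 3" using p power_increasing[of 1 3 "1 + m\<^sup>2"] by simp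
      finally have "\<bar>2 - 6 * m\<^sup>2\<bar> \<le> 6 * (1 + m\<^sup>2) ^ 3" .
      moreover have "0 < (1 + m\<^sup>2) ^ 3" by (intro zero_less_power add_pos_nonneg) auto
      ultimately show ?thesis by (simp only: real_norm_def abs_divide abs_of_pos pos_divide_le_eq)
    qed
    show ?thesis using field_differentiable_bound[OF convex_UNIV d b, of a b] by simp
  qed
  from this[of "max x 0" "max y 0"] show ?thesis
    unfolding smooth_step'_def by (rule order_trans) (auto simp: max_def)
qed

lemma smooth_step'_bound: "\<bar>smooth_step' x\<bar> \<le> 2"
proof -
  define m where "m = max x 0"
  have m: "0 \<le> m" by (simp add: m_def)
  have "m \<le> 1 + m\<^sup>2" using sum_squares_bound[of 1 m] m by (simp add: power2_eq_square)
  also have "\<dots> \<le> (1 + m\<^sup>2)\<^sup>2" using power_increasing[of 1 2 "1 + m\<^sup>2"] by simp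
  finally have "2 * m / (1 + m\<^sup>2)\<^sup>2 \<le> 2"
    by (subst divide_le_eq) (auto simp: add_pos_nonneg zero_less_power)
  then show ?thesis using m by (simp add: smooth_step'_def flip: m_def)
qed

lemma smooth_step_tendsto: "(\<lambda>k. smooth_step (real k * x)) \<longlonglongrightarrow> (if 0 < x then 1 else 0)"
proof (cases "0 < x")
  case True
  have eq: "smooth_step (real k * x) = 1 - 1 / (1 + (real k * x)\<^sup>2)" for k
    using True by (simp add: smooth_step_def max_def mult_le_0_iff)
  have "filterlim (\<lambda>k. real k * x) at_top sequentially"
    using True by (intro filterlim_at_top_mult_tendsto_pos[OF tendsto_const _ filterlim_real_sequentially])
  then have "filterlim (\<lambda>k. (real k * x)\<^sup>2) at_top sequentially" by (intro filterlim_pow_at_top) auto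
  then have "filterlim (\<lambda>k. 1 + (real k * x)\<^sup>2) at_top sequentially"
    by (rule filterlim_tendsto_add_at_top[OF tendsto_const])
  then have "(\<lambda>k. 1 / (1 + (real k * x)\<^sup>2)) \<longlonglongrightarrow> 0"
    by (intro tendsto_divide_0[OF tendsto_const]) (rule filterlim_at_top_imp_at_infinity)
  from tendsto_diff[OF tendsto_const[of 1] this] show ?thesis using True by (simp add: eq)
next
  case False
  then have "smooth_step (real k * x) = 0" for k by (intro smooth_step_nonpos) (simp add: mult_nonneg_nonpos)
  then show ?thesis using False by simp
qed

text \<open>A C^1 approximation of the indicator of the half-open interval (0, d]. For d >= 0 it
  vanishes on the nonpositive axis, so its shifts to the right are admissible test
  functions.\<close>

definition bump :: "nat \<Rightarrow> real \<Rightarrow> real \<Rightarrow> real" where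
  "bump k d x = smooth_step (real k * x) - smooth_step (real k * (x - d))"

definition bump' :: "nat \<Rightarrow> real \<Rightarrow> real \<Rightarrow> real" where
  "bump' k d x = real k * smooth_step' (real k * x) - real k * smooth_step' (real k * (x - d))"

lemma DERIV_bump: "(bump k d has_real_derivative bump' k d x) (at x)"
proof -
  have 1: "((\<lambda>x. smooth_step (real k * x)) has_real_derivative smooth_step' (real k * x) * real k) (at x)"
    by (rule DERIV_chain2[OF DERIV_smooth_step]) (auto intro!: derivative_eq_intros)
  have 2: "((\<lambda>x. smooth_step (real k * (x - d))) has_real_derivative smooth_step' (real k * (x - d)) * real k) (at x)"
    by (rule DERIV_chain2[OF DERIV_smooth_step]) (auto intro!: derivative_eq_intros)
  have "((\<lambda>x. smooth_step (real k * x) - smooth_step (real k * (x - d))) has_real_derivative bump' k d x) (at x)"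
    using DERIV_diff[OF 1 2] by (simp add: bump'_def mult.commute)
  moreover have "bump k d = (\<lambda>x. smooth_step (real k * x) - smooth_step (real k * (x - d)))"
    by (simp add: bump_def fun_eq_iff)
  ultimately show ?thesis by simp
qed

lemma bump_bounds: "0 \<le> d \<Longrightarrow> 0 \<le> bump k d x" "\<bar>bump k d x\<bar> \<le> 1"
proof -
  show "0 \<le> bump k d x" if "0 \<le> d"
    unfolding bump_def using that by (simp add: smooth_step_mono mult_left_mono)
  show "\<bar>bump k d x\<bar> \<le> 1"
    unfolding bump_def using smooth_step_bounds[of "real k * x"] smooth_step_bounds[of "real k * (x - d)"]
    by linarith
qed

lemma bump_nonpos: "0 \<le> d \<Longrightarrow> x \<le> 0 \<Longrightarrow> bump k d x = 0"
  by (simp add: bump_def mult_nonneg_nonpos)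

lemma bump'_bound: "\<bar>bump' k d x\<bar> \<le> 4 * real k"
proof -
  have "\<bar>bump' k d x\<bar> \<le> real k * \<bar>smooth_step' (real k * x)\<bar> + real k * \<bar>smooth_step' (real k * (x - d))\<bar>"
    unfolding bump'_def by (rule order_trans[OF abs_triangle_ineq4]) (simp add: abs_mult)
  also have "\<dots> \<le> real k * 2 + real k * 2"
    by (intro add_mono mult_left_mono smooth_step'_bound) auto
  finally show ?thesis by simp
qed

lemma bump'_lipschitz: "\<bar>bump' k d x - bump' k d y\<bar> \<le> 12 * (real k)\<^sup>2 * \<bar>x - y\<bar>"
proof -
  have s: "\<bar>smooth_step' (real k * x) - smooth_step' (real k * y)\<bar> \<le> 6 * (real k * \<bar>x - y\<bar>)" for x y
    using smooth_step'_lipschitz[of "real k * x" "real k * y"] by (simp add: abs_mult flip: right_diff_distrib)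
  have "\<bar>bump' k d x - bump' k d y\<bar> = real k * \<bar>(smooth_step' (real k * x) - smooth_step' (real k * y))
      - (smooth_step' (real k * (x - d)) - smooth_step' (real k * (y - d)))\<bar>"
  proof -
    have "bump' k d x - bump' k d y = real k * ((smooth_step' (real k * x) - smooth_step' (real k * y))
      - (smooth_step' (real k * (x - d)) - smooth_step' (real k * (y - d))))"
      by (simp add: bump'_def algebra_simps)
    then show ?thesis by (simp add: abs_mult)
  qed
  also have "\<dots> \<le> real k * (6 * (real k * \<bar>x - y\<bar>) + 6 * (real k * \<bar>x - y\<bar>))"
  proof (rule mult_left_mono)
    have "\<bar>smooth_step' (real k * (x - d)) - smooth_step' (real k * (y - d))\<bar> \<le> 6 * (real k * \<bar>x - y\<bar>)"
      using s[of "x - d" "y - d"] by simp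
    with s[of x y] show "\<bar>(smooth_step' (real k * x) - smooth_step' (real k * y))
        - (smooth_step' (real k * (x - d)) - smooth_step' (real k * (y - d)))\<bar>
      \<le> 6 * (real k * \<bar>x - y\<bar>) + 6 * (real k * \<bar>x - y\<bar>)" by linarith
  qed simp
  finally show ?thesis by (simp add: power2_eq_square algebra_simps)
qed

lemma bump_lipschitz: "\<bar>bump k d x - bump k d y\<bar> \<le> 4 * real k * \<bar>x - y\<bar>"
  using field_differentiable_bound[OF convex_UNIV, of "bump k d" "bump' k d" "4 * real k" x y]
    DERIV_bump bump'_bound by auto

text \<open>Mean value theorem with the Lipschitz bound of the derivative. The error is quadratic in
  v - u, so it disappears when short steps are summed.\<close>

lemma bump_taylor:
  assumes "u \<le> v"
  shows "bump k d (x + v) - bump k d (x + u) \<le> (v - u) * (bump' k d (x + u) + 12 * (real k)\<^sup>2 * (v - u))"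
proof (cases "u = v")
  case False
  then obtain z where z: "x + u < z" "z < x + v"
      "bump k d (x + v) - bump k d (x + u) = ((x + v) - (x + u)) * bump' k d z"
    using MVT2[of "x + u" "x + v" "bump k d" "bump' k d"] DERIV_bump assms by auto
  have "bump' k d z \<le> bump' k d (x + u) + 12 * (real k)\<^sup>2 * \<bar>z - (x + u)\<bar>"
    using bump'_lipschitz[of k d z "x + u"] by linarith
  also have "\<dots> \<le> bump' k d (x + u) + 12 * (real k)\<^sup>2 * (v - u)"
    using z by (intro add_left_mono mult_left_mono) auto
  finally show ?thesis using z(3) assms by (simp add: mult_left_mono)
qed simp

lemma bump_tendsto:
  assumes "0 \<le> d"
  shows "(\<lambda>k. bump k d x) \<longlonglongrightarrow> indicator {0<..d} x"
proof -
  have "(\<lambda>k. bump k d x) \<longlonglongrightarrow> (if 0 < x then 1 else 0) - (if 0 < x - d then 1 else 0)"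
    unfolding bump_def by (intro tendsto_diff smooth_step_tendsto)
  moreover have "(if 0 < x then 1 else 0) - (if 0 < x - d then 1 else 0) = (indicator {0<..d} x :: real)"
    using assms by (auto simp: indicator_def)
  ultimately show ?thesis by simp
qed

text \<open>Every point of the half line is a limit of larger ones, so the derivative within the
  half line is unique and agrees with the two-sided one.\<close>

lemma rderiv_eq:
  assumes "(f has_real_derivative f') (at x)" "0 \<le> x"
  shows "rderiv f x = f'"
proof -
  have "at_right x \<le> at x within {0..}" using assms(2) by (intro at_le) auto
  then have "at x within {0..} \<noteq> bot" using trivial_limit_at_right_real[of x] by (auto simp: bot_unique)
  moreover have "(f has_vector_derivative f') (at x within {0..})"
    using assms(1) has_real_derivative_iff_has_vector_derivative has_vector_derivative_at_within by blast
  ultimately show ?thesis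
    unfolding rderiv_def by (intro vector_derivative_within)
qed

text \<open>The shift is to the right, a <= 0, which keeps the value 0 at the origin required of a
  test function.\<close>

lemma bump_test_function:
  assumes "0 \<le> d" "a \<le> 0"
  shows "(\<lambda>y. bump k d (y + a)) \<in> \<C>" "0 \<le> y \<Longrightarrow> rderiv (\<lambda>y. bump k d (y + a)) y = bump' k d (y + a)"
proof -
  have D: "((\<lambda>y. bump k d (y + a)) has_real_derivative bump' k d (y + a)) (at y)" for y
  proof -
    have "((\<lambda>y. y + a) has_real_derivative 1) (at y)" by (auto intro!: derivative_eq_intros)
    from DERIV_chain2[OF DERIV_bump this, of k d] show ?thesis by simp
  qed
  show r: "rderiv (\<lambda>y. bump k d (y + a)) y = bump' k d (y + a)" if "0 \<le> y" for y
    by (rule rderiv_eq[OF D that])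
  have "continuous_on UNIV (\<lambda>y. bump' k d (y + a))"
  proof (rule lipschitz_on_continuous_on)
    show "(12 * (real k)\<^sup>2)-lipschitz_on UNIV (\<lambda>y. bump' k d (y + a))"
      by (rule lipschitz_onI) (use bump'_lipschitz[of k d "_ + a" "_ + a"] in \<open>auto simp: dist_real_def\<close>)
  qed
  then have "continuous_on {0..} (rderiv (\<lambda>y. bump k d (y + a)))"
    by (subst continuous_on_cong[OF refl r]) (auto intro: continuous_on_subset)
  moreover have "bounded (rderiv (\<lambda>y. bump k d (y + a)) ` {0..})"
    unfolding bounded_iff using r bump'_bound by (intro exI[of _ "4 * real k"]) auto
  moreover have "bounded ((\<lambda>y. bump k d (y + a)) ` {0..})"
    unfolding bounded_iff using bump_bounds(2) by (intro exI[of _ 1]) auto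
  moreover have "continuous_on {0..} (\<lambda>y. bump k d (y + a))"
    using D by (intro DERIV_continuous_on) (auto intro: has_field_derivative_at_within)
  moreover have "(\<lambda>y. bump k d (y + a)) differentiable_on {0..}"
    unfolding differentiable_on_def using D
    by (meson differentiable_at_withinI real_differentiable_def)
  ultimately show "(\<lambda>y. bump k d (y + a)) \<in> \<C>"
    using assms by (simp add: test_functions_def Cb1_def bump_nonpos)
qed

lemma test_function_lipschitz:
  assumes "f \<in> \<C>"
  shows "\<exists>D L. 0 \<le> D \<and> 0 \<le> L \<and> (\<forall>y\<ge>0. \<bar>f y\<bar> \<le> D) \<and> (\<forall>x\<ge>0. \<forall>y\<ge>0. \<bar>f x - f y\<bar> \<le> L * \<bar>x - y\<bar>)"
proof -
  have f: "bounded (f ` {0..})" "f differentiable_on {0..}" "bounded (rderiv f ` {0..})"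
    using assms by (auto simp: test_functions_def Cb1_def)
  obtain D where D: "0 < D" "\<And>y. 0 \<le> y \<Longrightarrow> \<bar>f y\<bar> \<le> D"
    using f(1) by (auto simp: bounded_pos)
  obtain L where L: "0 < L" "\<And>y. 0 \<le> y \<Longrightarrow> \<bar>rderiv f y\<bar> \<le> L"
    using f(3) by (auto simp: bounded_pos)
  have "(f has_real_derivative rderiv f y) (at y within {0..})" if "0 \<le> y" for y
    using f(2) that unfolding rderiv_def has_real_derivative_iff_has_vector_derivative
    by (auto simp: differentiable_on_def vector_derivative_works)
  then have "\<bar>f x - f y\<bar> \<le> L * \<bar>x - y\<bar>" if "0 \<le> x" "0 \<le> y" for x y
    using field_differentiable_bound[of "{0..}" f "rderiv f" L x y] L that by auto
  then show ?thesis using D L by (intro exI[of _ D] exI[of _ L]) auto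
qed

section \<open>Finite measures and weak continuity\<close>

lemma finite_measures_space: "\<xi> \<in> finite_measures \<Longrightarrow> space \<xi> = {0..}"
  using sets_eq_imp_space_eq[of \<xi> Rplus] by (simp add: finite_measures_def space_restrict_space)

lemma finite_measures_sets: "\<xi> \<in> finite_measures \<Longrightarrow> sets \<xi> = sets Rplus"
  by (simp add: finite_measures_def)

lemma finite_measures_measurable_continuous:
  fixes g :: "real \<Rightarrow> real"
  shows "\<xi> \<in> finite_measures \<Longrightarrow> continuous_on {0..} g \<Longrightarrow> g \<in> borel_measurable \<xi>"
  using borel_measurable_continuous_on_restrict[of "{0..}" g]
    measurable_cong_sets[OF finite_measures_sets refl, of \<xi> "borel :: real measure"] by simp

lemma finite_measures_measurable_borel:
  fixes g :: "real \<Rightarrow> real"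
  assumes \<xi>: "\<xi> \<in> finite_measures" and g: "g \<in> borel_measurable borel"
  shows "g \<in> borel_measurable \<xi>"
proof -
  have "g \<in> borel_measurable Rplus" by (rule measurable_restrict_space1[OF g])
  then show ?thesis unfolding measurable_cong_sets[OF finite_measures_sets[OF \<xi>] refl] .
qed

lemma finite_measures_integrable:
  fixes g :: "real \<Rightarrow> real"
  assumes \<xi>: "\<xi> \<in> finite_measures" and g: "g \<in> borel_measurable \<xi>" "\<And>y. 0 \<le> y \<Longrightarrow> \<bar>g y\<bar> \<le> D"
  shows "integrable \<xi> g" "\<bar>\<langle>g, \<xi>\<rangle>\<bar> \<le> D * measure \<xi> {0..}"
proof -
  interpret finite_measure \<xi> using \<xi> by (simp add: finite_measures_def)
  show i: "integrable \<xi> g"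
    using g finite_measures_space[OF \<xi>] by (intro integrable_const_bound[of _ D] AE_I2) auto
  have "\<bar>\<langle>g, \<xi>\<rangle>\<bar> \<le> (\<integral>y. \<bar>g y\<bar> \<partial>\<xi>)" by (rule integral_abs_bound)
  also have "\<dots> \<le> (\<integral>y. D \<partial>\<xi>)"
    using i g finite_measures_space[OF \<xi>] by (intro integral_mono) auto
  also have "\<dots> = D * measure \<xi> {0..}" by (simp add: finite_measures_space[OF \<xi>])
  finally show "\<bar>\<langle>g, \<xi>\<rangle>\<bar> \<le> D * measure \<xi> {0..}" .
qed

lemma finite_measures_mono:
  fixes f g :: "real \<Rightarrow> real"
  assumes "\<xi> \<in> finite_measures" "integrable \<xi> f" "integrable \<xi> g" "\<And>y. 0 \<le> y \<Longrightarrow> f y \<le> g y"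
  shows "\<langle>f, \<xi>\<rangle> \<le> \<langle>g, \<xi>\<rangle>"
  using assms finite_measures_space[OF assms(1)] by (intro integral_mono) auto

definition weakly_continuous :: "(real \<Rightarrow> real measure) \<Rightarrow> bool" where
  "weakly_continuous \<nu> \<longleftrightarrow> (\<forall>u\<ge>0. \<nu> u \<in> finite_measures) \<and>
     (\<forall>g. continuous_on {0..} g \<and> bounded (g ` {0..}) \<longrightarrow> continuous_on {0..} (\<lambda>u. \<langle>g, \<nu> u\<rangle>))"

lemma weakly_continuous_const: "\<xi> \<in> finite_measures \<Longrightarrow> weakly_continuous (\<lambda>_. \<xi>)"
  by (simp add: weakly_continuous_def)

lemma weakly_continuous_map:
  assumes "continuous_map (top_of_set {0..}) weak_topology \<nu>"
  shows "weakly_continuous \<nu>"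
proof -
  have "topspace weak_topology \<subseteq> finite_measures"
    unfolding weak_topology_def by auto
  then have fm: "\<nu> u \<in> finite_measures" if "0 \<le> u" for u
    using assms that by (auto simp: continuous_map_def Pi_iff)
  have "continuous_on {0..} (\<lambda>u. \<langle>g, \<nu> u\<rangle>)" if g: "continuous_on {0..} g" "bounded (g ` {0..})" for g
  proof (subst continuous_on_open_gen[where T=UNIV], simp, intro allI impI)
    fix U :: "real set" assume "openin (top_of_set UNIV) U"
    then have U: "open U" by simp
    have "openin weak_topology {\<xi> \<in> finite_measures. \<langle>g, \<xi>\<rangle> \<in> U}"
      unfolding weak_topology_def
      by (intro topology_generated_by_Basis CollectI exI[of _ g] exI[of _ U] conjI g U refl)
    then have "openin (top_of_set {0..}) {u \<in> topspace (top_of_set {0..}). \<nu> u \<in> {\<xi> \<in> finite_measures. \<langle>g, \<xi>\<rangle> \<in> U}}"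
      using assms by (rule openin_continuous_map_preimage[rotated])
    moreover have "{u \<in> topspace (top_of_set {0..}). \<nu> u \<in> {\<xi> \<in> finite_measures. \<langle>g, \<xi>\<rangle> \<in> U}}
        = {0..} \<inter> (\<lambda>u. \<langle>g, \<nu> u\<rangle>) -` U" by (auto intro!: fm)
    ultimately show "openin (top_of_set {0..}) ({0..} \<inter> (\<lambda>u. \<langle>g, \<nu> u\<rangle>) -` U)" by simp
  qed
  then show ?thesis using fm by (simp add: weakly_continuous_def)
qed

lemma weakly_continuousD:
  assumes "weakly_continuous \<nu>"
  shows "0 \<le> u \<Longrightarrow> \<nu> u \<in> finite_measures"
    and "continuous_on {0..} g \<Longrightarrow> (\<And>y. 0 \<le> y \<Longrightarrow> \<bar>g y\<bar> \<le> D) \<Longrightarrow> continuous_on {0..} (\<lambda>u. \<langle>g, \<nu> u\<rangle>)"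
    and "continuous_on {0..} (\<lambda>u. measure (\<nu> u) {0..})"
proof -
  show fm: "0 \<le> u \<Longrightarrow> \<nu> u \<in> finite_measures" for u using assms by (simp add: weakly_continuous_def)
  show cont: "continuous_on {0..} (\<lambda>u. \<langle>g, \<nu> u\<rangle>)"
    if "continuous_on {0..} g" "\<And>y. 0 \<le> y \<Longrightarrow> \<bar>g y\<bar> \<le> D" for g D
    using assms that unfolding weakly_continuous_def bounded_iff by (auto intro!: exI[of _ D])
  have "continuous_on {0..} (\<lambda>u. \<langle>\<lambda>_. 1, \<nu> u\<rangle>)" by (rule cont[of _ 1]) auto
  then show "continuous_on {0..} (\<lambda>u. measure (\<nu> u) {0..})"
    by (rule continuous_on_eq) (simp add: finite_measures_space fm)
qed

text \<open>Function and measure move together. The change of the function is uniformly small by the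
  Lipschitz bound and is multiplied by a mass that converges; the change of the measure against a
  fixed function is weak continuity.\<close>

lemma pairing_continuous:
  fixes \<sigma> :: "'a :: metric_space \<Rightarrow> real"
  assumes \<nu>: "weakly_continuous \<nu>"
    and \<sigma>: "continuous_on A \<sigma>" "\<And>x. x \<in> A \<Longrightarrow> 0 \<le> \<sigma> x"
    and cont: "\<And>x. x \<in> A \<Longrightarrow> continuous_on {0..} (\<Psi> x)"
    and bound: "\<And>x y. x \<in> A \<Longrightarrow> 0 \<le> y \<Longrightarrow> \<bar>\<Psi> x y\<bar> \<le> D"
    and lip: "\<And>x x' y. x \<in> A \<Longrightarrow> x' \<in> A \<Longrightarrow> 0 \<le> y \<Longrightarrow> \<bar>\<Psi> x y - \<Psi> x' y\<bar> \<le> L * dist x x'"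
  shows "continuous_on A (\<lambda>x. \<langle>\<Psi> x, \<nu> (\<sigma> x)\<rangle>)"
  unfolding continuous_on_def
proof
  fix a assume a: "a \<in> A"
  have fm: "\<nu> (\<sigma> x) \<in> finite_measures" if "x \<in> A" for x
    by (rule weakly_continuousD(1)[OF \<nu> \<sigma>(2)[OF that]])
  have int: "integrable (\<nu> (\<sigma> x)) (\<Psi> x')" if "x \<in> A" "x' \<in> A" for x x'
    using that by (intro finite_measures_integrable(1)[where D=D] fm finite_measures_measurable_continuous cont bound)
  have comp: "continuous_on A (\<lambda>x. h (\<sigma> x))" if "continuous_on {0..} h" for h :: "real \<Rightarrow> real"
    by (rule continuous_on_compose2[OF that \<sigma>(1)]) (use \<sigma>(2) in auto)
  have 1: "((\<lambda>x. \<langle>\<Psi> a, \<nu> (\<sigma> x)\<rangle>) \<longlongrightarrow> \<langle>\<Psi> a, \<nu> (\<sigma> a)\<rangle>) (at a within A)"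
    using comp[OF weakly_continuousD(2)[OF \<nu> cont[OF a] bound[OF a]]] a by (auto simp: continuous_on_def)
  have mass: "((\<lambda>x. measure (\<nu> (\<sigma> x)) {0..}) \<longlongrightarrow> measure (\<nu> (\<sigma> a)) {0..}) (at a within A)"
    using comp[OF weakly_continuousD(3)[OF \<nu>]] a by (auto simp: continuous_on_def)
  have 2: "((\<lambda>x. \<langle>\<Psi> x, \<nu> (\<sigma> x)\<rangle> - \<langle>\<Psi> a, \<nu> (\<sigma> x)\<rangle>) \<longlongrightarrow> 0) (at a within A)"
  proof (rule Lim_null_comparison)
    show "\<forall>\<^sub>F x in at a within A. norm (\<langle>\<Psi> x, \<nu> (\<sigma> x)\<rangle> - \<langle>\<Psi> a, \<nu> (\<sigma> x)\<rangle>) \<le> L * dist x a * measure (\<nu> (\<sigma> x)) {0..}"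
      unfolding eventually_at_filter
    proof (intro always_eventually allI impI)
      fix x assume x: "x \<in> A"
      have "\<langle>\<Psi> x, \<nu> (\<sigma> x)\<rangle> - \<langle>\<Psi> a, \<nu> (\<sigma> x)\<rangle> = \<langle>\<lambda>y. \<Psi> x y - \<Psi> a y, \<nu> (\<sigma> x)\<rangle>"
        using int x a by simp
      also have "\<bar>\<dots>\<bar> \<le> L * dist x a * measure (\<nu> (\<sigma> x)) {0..}"
        by (intro finite_measures_integrable(2) fm x borel_measurable_diff finite_measures_measurable_continuous
            cont a lip)
      finally show "norm (\<langle>\<Psi> x, \<nu> (\<sigma> x)\<rangle> - \<langle>\<Psi> a, \<nu> (\<sigma> x)\<rangle>) \<le> L * dist x a * measure (\<nu> (\<sigma> x)) {0..}"
        by simp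
    qed
    have "((\<lambda>x. dist x a) \<longlongrightarrow> dist a a) (at a within A)" by (intro tendsto_intros)
    then have "((\<lambda>x. L * dist x a * measure (\<nu> (\<sigma> x)) {0..}) \<longlongrightarrow> L * dist a a * measure (\<nu> (\<sigma> a)) {0..}) (at a within A)"
      by (intro tendsto_mult tendsto_const mass)
    then show "((\<lambda>x. L * dist x a * measure (\<nu> (\<sigma> x)) {0..}) \<longlongrightarrow> 0) (at a within A)" by simp
  qed
  from tendsto_add[OF 2 1] show "((\<lambda>x. \<langle>\<Psi> x, \<nu> (\<sigma> x)\<rangle>) \<longlongrightarrow> \<langle>\<Psi> a, \<nu> (\<sigma> a)\<rangle>) (at a within A)" by simp
qed

text \<open>Substitute for a derivative argument: H need not be differentiable, but if short
  increments have slope at most \<epsilon>, summing over a fine partition of [0, u] gives the claim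
  up to \<epsilon> * u.\<close>

lemma slope_nonpos_imp_le:
  fixes H :: "real \<Rightarrow> real"
  assumes slope: "\<And>\<epsilon>. \<epsilon> > 0 \<Longrightarrow> \<exists>\<delta>>0. \<forall>u v. 0 \<le> u \<longrightarrow> u \<le> v \<longrightarrow> v \<le> t \<longrightarrow> v - u \<le> \<delta> \<longrightarrow> H v - H u \<le> \<epsilon> * (v - u)"
    and u: "0 \<le> u" "u \<le> t"
  shows "H u \<le> H 0"
proof (rule field_le_epsilon)
  fix e :: real assume e: "0 < e"
  \<comment> \<open>Adding 1 to u covers u = 0.\<close>
  define \<epsilon> where "\<epsilon> = e / (u + 1)"
  have \<epsilon>: "\<epsilon> > 0" and \<epsilon>u: "\<epsilon> * u \<le> e" using e u by (auto simp: \<epsilon>_def field_simps)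
  obtain \<delta> where \<delta>: "\<delta> > 0" "\<And>u v. 0 \<le> u \<Longrightarrow> u \<le> v \<Longrightarrow> v \<le> t \<Longrightarrow> v - u \<le> \<delta> \<Longrightarrow> H v - H u \<le> \<epsilon> * (v - u)"
    using slope[OF \<epsilon>] by blast
  obtain n :: nat where n: "u / \<delta> < n" using reals_Archimedean2 by blast
  then have n0: "0 < n" using u \<delta> by (metis divide_nonneg_pos less_le_trans of_nat_0 of_nat_less_iff not_less)
  have step: "u / n \<le> \<delta>" using n n0 \<delta> by (simp add: field_simps)
  have "H (u * i / n) - H 0 \<le> \<epsilon> * (u * i / n)" if "i \<le> n" for i
    using that
  proof (induction i)
    case (Suc i)
    have "u * Suc i / n \<le> t"
    proof -
      have "u * Suc i / n \<le> u * 1" using Suc.prems u n0 by (simp add: divide_le_eq mult_left_mono del: of_nat_Suc)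
      then show ?thesis using u by simp
    qed
    moreover have "u * Suc i / n - u * i / n = u / n" by (simp add: distrib_left add_divide_distrib)
    moreover have "0 \<le> u * i / n" "0 \<le> u / n" using u by auto
    ultimately have "H (u * Suc i / n) - H (u * i / n) \<le> \<epsilon> * (u * Suc i / n - u * i / n)"
      using step by (intro \<delta>(2)) auto
    then show ?case using Suc by (simp add: right_diff_distrib)
  qed simp
  from this[of n] have "H u - H 0 \<le> \<epsilon> * u" using n0 by simp
  then show "H u \<le> H 0 + e" using \<epsilon>u by linarith
qed

lemma set_lborel_integral_eq_integral:
  fixes g :: "real \<Rightarrow> real"
  assumes "continuous_on {0..} g" "0 \<le> a"
  shows "(LINT s:{a..b}|lborel. g s) = integral {a..b} g" "g integrable_on {a..b}"
proof -
  have "continuous_on {a..b} g" using assms by (auto intro: continuous_on_subset)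
  then have "set_integrable lborel {a..b} g" "g integrable_on {a..b}"
    by (auto intro: borel_integrable_atLeastAtMost' integrable_continuous_real)
  then show "(LINT s:{a..b}|lborel. g s) = integral {a..b} g" "g integrable_on {a..b}"
    by (auto intro: set_borel_integral_eq_integral)
qed

section \<open>Positivity and transport of mass in the fluid model solution\<close>

locale fluid =
  fixes J K :: nat and \<alpha> \<mu> p :: "nat \<Rightarrow> real" and \<theta> \<zeta>\<^sub>0 :: "nat \<Rightarrow> real measure"
    and \<zeta> :: "real \<Rightarrow> nat \<Rightarrow> real measure"
  assumes params: "fluid_params J K \<alpha> \<mu> p \<theta>"
    and intensity: "traffic_intensity J K \<alpha> \<mu> > 1"
    and solution: "fluid_solution J K \<alpha> \<mu> p \<theta> \<zeta>\<^sub>0 \<zeta>"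
    and nonzero: "nonzero_measures J \<zeta>\<^sub>0"
begin

lemma pos: "j \<in> {1..J} \<Longrightarrow> 0 < \<alpha> j" "j \<in> {1..J} \<Longrightarrow> 0 < \<mu> j" "j \<in> {1..J} \<Longrightarrow> 0 < p j"
  using params by (auto simp: fluid_params_def)

lemma \<theta>: "j \<in> {1..J} \<Longrightarrow> \<theta> j \<in> finite_measures" "j \<in> {1..J} \<Longrightarrow> measure (\<theta> j) {0..} = 1"
proof -
  show fm: "j \<in> {1..J} \<Longrightarrow> \<theta> j \<in> finite_measures" using params by (auto simp: fluid_params_def)
  assume j: "j \<in> {1..J}"
  then interpret prob_space "\<theta> j" using params by (auto simp: fluid_params_def)
  show "measure (\<theta> j) {0..} = 1" using prob_space finite_measures_space[OF fm[OF j]] by simp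
qed

lemma \<zeta>_weakly_continuous: "j \<in> {1..J} \<Longrightarrow> weakly_continuous (\<lambda>u. \<zeta> u j)"
  by (intro weakly_continuous_map) (rule solution[unfolded fluid_solution_def, THEN conjunct2, THEN conjunct1, rule_format])

lemma \<zeta>_finite: "0 \<le> u \<Longrightarrow> j \<in> {1..J} \<Longrightarrow> \<zeta> u j \<in> finite_measures"
  by (rule weakly_continuousD(1)[OF \<zeta>_weakly_continuous])

lemma masses_eq: "0 \<le> u \<Longrightarrow> j \<in> {1..J} \<Longrightarrow> masses (\<zeta> u) j = measure (\<zeta> u j) {0..}"
  by (simp add: masses_def finite_measures_space[OF \<zeta>_finite])

lemma masses_continuous: "j \<in> {1..J} \<Longrightarrow> continuous_on {0..} (\<lambda>u. masses (\<zeta> u) j)"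
  using weakly_continuousD(3)[OF \<zeta>_weakly_continuous[of j]]
  by (subst continuous_on_cong[OF refl, of _ _ "\<lambda>u. measure (\<zeta> u j) {0..}"]) (auto simp: masses_eq)

text \<open>At positive times this is the positivity condition of a solution with intensity above 1,
  and at time 0 it is the nonzero initial condition. It makes the denominators in the fluid equation
  and in the covariances positive.\<close>

lemma some_mass:
  assumes "0 \<le> u"
  shows "\<exists>j\<in>{1..J}. 0 < masses (\<zeta> u) j"
proof (cases "u = 0")
  case False
  then have "0 < u" using assms by simp
  from solution[unfolded fluid_solution_def, THEN conjunct2, THEN conjunct2, THEN conjunct2, THEN conjunct2,
      THEN conjunct2, rule_format, OF intensity this]
  show ?thesis by (simp add: masses_def)
next
  case True
  obtain j where j: "j \<in> {1..J}" "\<zeta>\<^sub>0 j \<noteq> null_measure Rplus"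
    using nonzero by (auto simp: nonzero_measures_def)
  have eq: "\<zeta> 0 j = \<zeta>\<^sub>0 j" 
    by (rule solution[unfolded fluid_solution_def, THEN conjunct2, THEN conjunct2, THEN conjunct1, rule_format, OF j(1)])
  have fm: "\<zeta>\<^sub>0 j \<in> finite_measures" using \<zeta>_finite[of 0 j] j eq by simp
  then interpret finite_measure "\<zeta>\<^sub>0 j" by (simp add: finite_measures_def)
  have "measure (\<zeta>\<^sub>0 j) {0..} \<noteq> 0"
  proof
    assume 0: "measure (\<zeta>\<^sub>0 j) {0..} = 0"
    have "\<zeta>\<^sub>0 j = null_measure Rplus"
    proof (rule measure_eqI)
      show "sets (\<zeta>\<^sub>0 j) = sets (null_measure Rplus)" using finite_measures_sets[OF fm] by simp
      fix A assume "A \<in> sets (\<zeta>\<^sub>0 j)"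
      then have "measure (\<zeta>\<^sub>0 j) A \<le> measure (\<zeta>\<^sub>0 j) (space (\<zeta>\<^sub>0 j))" by (intro bounded_measure)
      then have "measure (\<zeta>\<^sub>0 j) A = 0"
        using 0 finite_measures_space[OF fm] by (simp add: measure_le_0_iff)
      then show "emeasure (\<zeta>\<^sub>0 j) A = emeasure (null_measure Rplus) A" by (simp add: emeasure_eq_measure)
    qed
    then show False using j(2) by simp
  qed
  then have "0 < measure (\<zeta>\<^sub>0 j) {0..}" using measure_nonneg[of "\<zeta>\<^sub>0 j" "{0..}"] by linarith
  then show ?thesis using True masses_eq[of 0 j] eq j(1) by (intro bexI[of _ j]) auto
qed

lemma masses_nonneg: "0 \<le> masses (\<zeta> u) j"
  by (simp add: masses_def)

lemma Lp_pos: "0 \<le> u \<Longrightarrow> 0 < Lp J p (masses (\<zeta> u))"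
  and Lpmu_pos: "0 \<le> u \<Longrightarrow> 0 < Lpmu J \<mu> p (masses (\<zeta> u))"
proof -
  assume u: "0 \<le> u"
  obtain j where j: "j \<in> {1..J}" "0 < masses (\<zeta> u) j" using some_mass[OF u] by blast
  show "0 < Lp J p (masses (\<zeta> u))" unfolding Lp_def
    by (rule sum_pos2[of _ j]) (use j pos masses_nonneg in \<open>auto intro!: mult_nonneg_nonneg simp: less_imp_le\<close>)
  show "0 < Lpmu J \<mu> p (masses (\<zeta> u))" unfolding Lpmu_def
    by (rule sum_pos2[of _ j])
      (use j pos masses_nonneg in \<open>auto intro!: mult_nonneg_nonneg divide_nonneg_nonneg simp: less_imp_le\<close>)
qed

lemma nonzero_measures_\<zeta>: "0 \<le> u \<Longrightarrow> nonzero_measures J (\<zeta> u)"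
proof -
  assume "0 \<le> u"
  then obtain j where j: "j \<in> {1..J}" "0 < masses (\<zeta> u) j" using some_mass by blast
  have "\<zeta> u j \<noteq> null_measure Rplus"
  proof
    assume "\<zeta> u j = null_measure Rplus"
    then show False using j(2) by (simp add: masses_def measure_def)
  qed
  then show "nonzero_measures J (\<zeta> u)" using j(1) by (auto simp: nonzero_measures_def)
qed

text \<open>Only an inequality: the departure integral is nonnegative for f >= 0 and is dropped. The
  indicators in the fluid equation are identically 1 by
  \<open>nonzero_measures_\<zeta>\<close>.\<close>

lemma fluid_increment:
  assumes f: "f \<in> \<C>" "\<And>y. 0 \<le> y \<Longrightarrow> 0 \<le> f y" and j: "j \<in> {1..J}" and uv: "0 \<le> u" "u \<le> v"
  shows "\<langle>f, \<zeta> v j\<rangle> - \<langle>f, \<zeta> u j\<rangle>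
    \<le> \<alpha> j * \<langle>f, \<theta> j\<rangle> * (v - u) - integral {u..v} (\<lambda>s. \<langle>rderiv f, \<zeta> s j\<rangle>)"
proof -
  define d where "d = (\<lambda>s. real K * (p j * \<langle>f, \<zeta> s j\<rangle> / Lpmu J \<mu> p (masses (\<zeta> s))))"
  define e where "e = (\<lambda>s. \<langle>rderiv f, \<zeta> s j\<rangle>)"
  have bd: "continuous_on {0..} f" "bounded (f ` {0..})" "continuous_on {0..} (rderiv f)" "bounded (rderiv f ` {0..})"
    using f(1) by (auto simp: test_functions_def Cb1_def)
  have wc: "continuous_on {0..} (\<lambda>s. \<langle>g, \<zeta> s j\<rangle>)" if "continuous_on {0..} g" "bounded (g ` {0..})" for g
    using \<zeta>_weakly_continuous[OF j] that by (simp add: weakly_continuous_def)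
  have econt: "continuous_on {0..} e" unfolding e_def by (rule wc[OF bd(3,4)])
  have "continuous_on {0..} (\<lambda>s. Lpmu J \<mu> p (masses (\<zeta> s)))"
    unfolding Lpmu_def using masses_continuous by (intro continuous_intros) auto
  then have dcont: "continuous_on {0..} d"
    unfolding d_def using Lpmu_pos by (intro continuous_intros wc bd) (auto simp: less_imp_neq[symmetric])
  have d0: "0 \<le> d s" if "0 \<le> s" for s
  proof -
    have "0 \<le> \<langle>f, \<zeta> s j\<rangle>"
      using f(2) finite_measures_space[OF \<zeta>_finite[OF that j]] by (intro Bochner_Integration.integral_nonneg) auto
    then show ?thesis unfolding d_def using pos(3)[OF j] Lpmu_pos[OF that] by simp
  qed
  have eq: "\<langle>f, \<zeta> t j\<rangle> = \<langle>f, \<zeta> 0 j\<rangle> - integral {0..t} e - integral {0..t} d + \<alpha> j * \<langle>f, \<theta> j\<rangle> * t" if t: "0 \<le> t" for t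
  proof -
    have "(LINT s:{0..t}|lborel. real K * of_bool (nonzero_measures J (\<zeta> s)) *
               (p j * \<langle>f, \<zeta> s j\<rangle> / (\<Sum>i=1..J. p i / \<mu> i * \<langle>\<lambda>_. 1, \<zeta> s i\<rangle>))) = (LINT s:{0..t}|lborel. d s)"
      by (intro set_lebesgue_integral_cong) (auto simp: nonzero_measures_\<zeta> d_def Lpmu_def masses_def)
    also have "\<dots> = integral {0..t} d" by (rule set_lborel_integral_eq_integral[OF dcont]) simp
    finally have 1: "(LINT s:{0..t}|lborel. real K * of_bool (nonzero_measures J (\<zeta> s)) *
               (p j * \<langle>f, \<zeta> s j\<rangle> / (\<Sum>i=1..J. p i / \<mu> i * \<langle>\<lambda>_. 1, \<zeta> s i\<rangle>))) = integral {0..t} d" .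
    have 2: "(LINT s:{0..t}|lborel. \<langle>rderiv f, \<zeta> s j\<rangle>) = integral {0..t} e"
      unfolding e_def by (rule set_lborel_integral_eq_integral[OF wc[OF bd(3,4)]]) simp
    have "(LINT s:{0..t}|lborel. of_bool (nonzero_measures J (\<zeta> s))) = (LINT s:{0..t}|lborel. 1 :: real)"
      by (intro set_lebesgue_integral_cong) (auto simp: nonzero_measures_\<zeta>)
    then have 3: "(LINT s:{0..t}|lborel. of_bool (nonzero_measures J (\<zeta> s))) = t" using t by (simp add: set_lebesgue_integral_def)
    note solution[unfolded fluid_solution_def, THEN conjunct2, THEN conjunct2, THEN conjunct2, THEN conjunct2,
        THEN conjunct1, rule_format, OF f(1) j t]
    then show ?thesis unfolding 1 2 3 .
  qed
  have split: "integral {0..v} h = integral {0..u} h + integral {u..v} h" if "continuous_on {0..} h" for h :: "real \<Rightarrow> real"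
    using Henstock_Kurzweil_Integration.integral_combine[OF uv set_lborel_integral_eq_integral(2)[OF that order_refl]] by simp
  have "0 \<le> integral {u..v} d"
    using d0 uv by (intro Henstock_Kurzweil_Integration.integral_nonneg set_lborel_integral_eq_integral(2)[OF dcont]) auto
  moreover have "0 \<le> v" using uv by simp
  ultimately show ?thesis
    using eq[OF uv(1)] eq[of v] split[OF econt] split[OF dcont]
    unfolding e_def[symmetric] right_diff_distrib by linarith
qed

end

text \<open>The time of the measure and the shift of the function are separate maps \<sigma> and
  \<tau>, because the transport argument lets the two vary independently.\<close>

lemma bump_pairing_continuous:
  assumes \<nu>: "weakly_continuous \<nu>"
    and \<sigma>: "continuous_on A \<sigma>" "\<And>x. x \<in> A \<Longrightarrow> 0 \<le> \<sigma> x" and \<tau>: "\<And>x y. \<bar>\<tau> x - \<tau> y\<bar> \<le> dist x y"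
  shows "continuous_on A (\<lambda>x. \<langle>\<lambda>y. bump k d (y + \<tau> x), \<nu> (\<sigma> x)\<rangle>)"
    and "continuous_on A (\<lambda>x. \<langle>\<lambda>y. bump' k d (y + \<tau> x), \<nu> (\<sigma> x)\<rangle>)"
proof -
  have lip: "continuous_on UNIV h" if "\<And>x y. \<bar>h x - h y\<bar> \<le> L * \<bar>x - y\<bar>" "0 \<le> L" for h :: "real \<Rightarrow> real" and L
    by (rule lipschitz_on_continuous_on[of L], rule lipschitz_onI) (use that in \<open>auto simp: dist_real_def\<close>)
  have c: "continuous_on {0..} (\<lambda>y. h (y + a))" if "continuous_on UNIV h" for h :: "real \<Rightarrow> real" and a
    by (rule continuous_on_compose2[OF that]) (auto intro!: continuous_intros)
  show "continuous_on A (\<lambda>x. \<langle>\<lambda>y. bump k d (y + \<tau> x), \<nu> (\<sigma> x)\<rangle>)"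
  proof (rule pairing_continuous[OF \<nu> \<sigma>, where D=1 and L="4 * real k"])
    show "continuous_on {0..} (\<lambda>y. bump k d (y + \<tau> x))" for x
      by (intro c lip[of _ "4 * real k"] bump_lipschitz) simp
    show "\<bar>bump k d (y + \<tau> x) - bump k d (y + \<tau> x')\<bar> \<le> 4 * real k * dist x x'" for x x' y
      using \<tau>[of x x'] by (intro order_trans[OF bump_lipschitz] mult_left_mono) auto
  qed (auto intro: bump_bounds)
  show "continuous_on A (\<lambda>x. \<langle>\<lambda>y. bump' k d (y + \<tau> x), \<nu> (\<sigma> x)\<rangle>)"
  proof (rule pairing_continuous[OF \<nu> \<sigma>, where D="4 * real k" and L="12 * (real k)\<^sup>2"])
    show "continuous_on {0..} (\<lambda>y. bump' k d (y + \<tau> x))" for x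
      by (intro c lip[of _ "12 * (real k)\<^sup>2"] bump'_lipschitz) simp
    show "\<bar>bump' k d (y + \<tau> x) - bump' k d (y + \<tau> x')\<bar> \<le> 12 * (real k)\<^sup>2 * dist x x'" for x x' y
      using \<tau>[of x x'] by (intro order_trans[OF bump'_lipschitz] mult_left_mono) auto
  qed (auto intro: bump'_bound)
qed

lemma weakly_continuous_mass_bound:
  assumes "weakly_continuous \<nu>"
  shows "\<exists>Z\<ge>0. \<forall>s. 0 \<le> s \<longrightarrow> s \<le> t \<longrightarrow> measure (\<nu> s) {0..} \<le> Z"
proof -
  have "compact ((\<lambda>s. measure (\<nu> s) {0..}) ` {0..t})"
    using weakly_continuousD(3)[OF assms] by (intro compact_continuous_image compact_Icc) (auto intro: continuous_on_subset)
  then have "bounded ((\<lambda>s. measure (\<nu> s) {0..}) ` {0..t})" by (rule compact_imp_bounded)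
  then obtain B where "\<forall>s\<in>{0..t}. norm (measure (\<nu> s) {0..}) \<le> B"
    unfolding bounded_iff by blast
  then show ?thesis by (intro exI[of _ "max B 0"]) (auto simp: le_max_iff_disj)
qed

lemma bump_integrable:
  assumes "\<xi> \<in> finite_measures"
  shows "integrable \<xi> (\<lambda>y. bump k d (y + a))" "integrable \<xi> (\<lambda>y. bump' k d (y + a))"
proof -
  have lip: "h \<in> borel_measurable borel" if "\<And>x y. \<bar>h x - h y\<bar> \<le> L * \<bar>x - y\<bar>" "0 \<le> L" for h :: "real \<Rightarrow> real" and L
    by (rule borel_measurable_continuous_onI, rule lipschitz_on_continuous_on[of L], rule lipschitz_onI)
      (use that in \<open>auto simp: dist_real_def\<close>)
  have "bump k d \<in> borel_measurable borel" "bump' k d \<in> borel_measurable borel"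
    using lip[OF bump_lipschitz] lip[OF bump'_lipschitz] by auto
  then have "(\<lambda>y. bump k d (y + a)) \<in> borel_measurable borel" "(\<lambda>y. bump' k d (y + a)) \<in> borel_measurable borel"
    by measurable
  then show "integrable \<xi> (\<lambda>y. bump k d (y + a))" "integrable \<xi> (\<lambda>y. bump' k d (y + a))"
    using bump_bounds(2) bump'_bound
    by (auto intro!: finite_measures_integrable(1)[OF assms finite_measures_measurable_borel[OF assms]])
qed

context fluid
begin

text \<open>The initial mass is shifted to the left at unit speed, and so is the mass that arrives later;
  departures only decrease the left-hand side.\<close>

lemma bump_transport:
  assumes j: "j \<in> {1..J}" and d: "0 \<le> d" and u: "0 \<le> u" "u \<le> t"
  shows "\<langle>\<lambda>y. bump k d (y + (u - t)), \<zeta> u j\<rangle>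
    \<le> \<langle>\<lambda>y. bump k d (y + (0 - t)), \<zeta> 0 j\<rangle> + \<alpha> j * integral {0..u} (\<lambda>s. \<langle>\<lambda>y. bump k d (y + (s - t)), \<theta> j\<rangle>)"
proof -
  \<comment> \<open>\<open>P s v\<close> separates the time s of the measure from the shift v. Over
    short steps both are close to u, and the transport terms cancel.\<close>
  define P where "P = (\<lambda>s v. \<langle>\<lambda>y. bump' k d (y + (v - t)), \<zeta> s j\<rangle>)"
  define A where "A = (\<lambda>s. \<langle>\<lambda>y. bump k d (y + (s - t)), \<theta> j\<rangle>)"
  \<comment> \<open>The claim is H u <= H 0: moving the function at unit speed cancels the
    derivative term of the fluid equation, and the integral of A accounts for the arrivals.\<close>
  define H where "H = (\<lambda>s. \<langle>\<lambda>y. bump k d (y + (s - t)), \<zeta> s j\<rangle> - \<alpha> j * integral {0..s} A)"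
  note wc = \<zeta>_weakly_continuous[OF j] and \<alpha> = pos(1)[OF j]
  have A: "continuous_on {0..} A" unfolding A_def
    by (rule bump_pairing_continuous(1)[OF weakly_continuous_const[OF \<theta>(1)[OF j]] continuous_on_id]) (auto simp: dist_real_def)
  \<comment> \<open>Freezing the function at v gives the arrival term A v over the whole step, while
    H contains the integral of A; this estimate compares the two.\<close>
  have A_lip: "A s \<ge> A v - 4 * real k * (v - s)" if "s \<le> v" for s v
  proof -
    have "A v - A s = \<langle>\<lambda>y. bump k d (y + (v - t)) - bump k d (y + (s - t)), \<theta> j\<rangle>"
      unfolding A_def using bump_integrable(1)[OF \<theta>(1)[OF j]] by simp
    also have "\<dots> \<le> \<langle>\<lambda>_. 4 * real k * (v - s), \<theta> j\<rangle>"
    proof (rule finite_measures_mono[OF \<theta>(1)[OF j]])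
      show "integrable (\<theta> j) (\<lambda>y. bump k d (y + (v - t)) - bump k d (y + (s - t)))"
        using bump_integrable(1)[OF \<theta>(1)[OF j]] by simp
      show "integrable (\<theta> j) (\<lambda>_. 4 * real k * (v - s))"
        by (rule finite_measures_integrable(1)[OF \<theta>(1)[OF j]]) auto
      show "bump k d (y + (v - t)) - bump k d (y + (s - t)) \<le> 4 * real k * (v - s)" for y
        using bump_lipschitz[of k d "y + (v - t)" "y + (s - t)"] that by simp
    qed
    also have "\<dots> = 4 * real k * (v - s)" using \<theta>(2)[OF j] by (simp add: finite_measures_space[OF \<theta>(1)[OF j]])
    finally show ?thesis by simp
  qed
  have "continuous_on ({0..t} \<times> {0..t}) (\<lambda>x. P (fst x) (snd x))"
    unfolding P_def by (rule bump_pairing_continuous(2)[OF wc continuous_on_fst[OF continuous_on_id]])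
      (auto intro!: order_trans[OF _ dist_snd_le] simp: dist_real_def simp del: split_paired_All)
  then have "uniformly_continuous_on ({0..t} \<times> {0..t}) (\<lambda>x. P (fst x) (snd x))"
    by (rule compact_uniformly_continuous) (intro compact_Times compact_Icc)
  then have P: "\<exists>\<delta>>0. \<forall>x\<in>{0..t} \<times> {0..t}. \<forall>x'\<in>{0..t} \<times> {0..t}. dist x' x < \<delta> \<longrightarrow>
      dist (P (fst x') (snd x')) (P (fst x) (snd x)) < \<epsilon>" if "\<epsilon> > 0" for \<epsilon>
    using that unfolding uniformly_continuous_on_def by blast
  have Pcont: "continuous_on {0..} (\<lambda>s. P s v)" for v
    unfolding P_def by (rule bump_pairing_continuous(2)[OF wc continuous_on_id]) auto
  obtain Z where Z: "0 \<le> Z" "\<And>s. 0 \<le> s \<Longrightarrow> s \<le> t \<Longrightarrow> measure (\<zeta> s j) {0..} \<le> Z"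
    using weakly_continuous_mass_bound[OF wc, of t] by blast
  \<comment> \<open>The step from u to v is split into the fluid equation for the function frozen at
    shift v and a Taylor expansion of the shift against the measure at time u. The first contributes
    minus the integral of \<open>P s v\<close>, the second (v - u) * \<open>P u u\<close>; they
    cancel up to \<epsilon>, and the remaining errors are quadratic in v - u.\<close>
  have main: "H v - H u \<le> (v - u) * (\<epsilon> + (12 * (real k)\<^sup>2 * Z + 4 * real k * \<alpha> j) * (v - u))"
    if uv: "0 \<le> u" "u \<le> v" "v \<le> t" and close: "\<And>s. u \<le> s \<Longrightarrow> s \<le> v \<Longrightarrow> P u u - \<epsilon> \<le> P s v" for u v \<epsilon>
  proof -
    let ?\<Psi> = "\<lambda>v y. bump k d (y + (v - t))"
    have vt: "v - t \<le> 0" using uv by simp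
    note tf = bump_test_function[OF d vt, where k=k]
    have fu: "\<zeta> u j \<in> finite_measures" by (rule \<zeta>_finite[OF uv(1) j])
    interpret fu: finite_measure "\<zeta> u j" using fu by (simp add: finite_measures_def)
    have const_int: "integrable (\<zeta> u j) (\<lambda>_. c :: real)" for c by (rule fu.integrable_const)
    have "integral {u..v} (\<lambda>s. \<langle>rderiv (?\<Psi> v), \<zeta> s j\<rangle>) = integral {u..v} (\<lambda>s. P s v)"
    proof (intro Henstock_Kurzweil_Integration.integral_cong)
      fix s assume s: "s \<in> {u..v}"
      have "space (\<zeta> s j) = {0..}" using s uv j by (intro finite_measures_space \<zeta>_finite) auto
      then show "\<langle>rderiv (?\<Psi> v), \<zeta> s j\<rangle> = P s v"
        unfolding P_def by (intro Bochner_Integration.integral_cong refl) (simp add: tf(2))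
    qed
    moreover have "integral {u..v} (\<lambda>s. P u u - \<epsilon>) \<le> integral {u..v} (\<lambda>s. P s v)"
      using close uv(1) by (intro integral_le set_lborel_integral_eq_integral(2)[OF Pcont]) auto
    ultimately have "(v - u) * (P u u - \<epsilon>) \<le> integral {u..v} (\<lambda>s. \<langle>rderiv (?\<Psi> v), \<zeta> s j\<rangle>)"
      using uv by simp
    moreover have "\<langle>?\<Psi> v, \<zeta> v j\<rangle> - \<langle>?\<Psi> v, \<zeta> u j\<rangle>
        \<le> \<alpha> j * A v * (v - u) - integral {u..v} (\<lambda>s. \<langle>rderiv (?\<Psi> v), \<zeta> s j\<rangle>)"
      unfolding A_def by (rule fluid_increment[OF tf(1) _ j uv(1,2)]) (rule bump_bounds(1)[OF d])
    moreover have "\<langle>?\<Psi> v, \<zeta> u j\<rangle> - \<langle>?\<Psi> u, \<zeta> u j\<rangle> \<le> (v - u) * (P u u + 12 * (real k)\<^sup>2 * (v - u) * Z)"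
    proof -
      have "\<langle>?\<Psi> v, \<zeta> u j\<rangle> - \<langle>?\<Psi> u, \<zeta> u j\<rangle> = \<langle>\<lambda>y. ?\<Psi> v y - ?\<Psi> u y, \<zeta> u j\<rangle>"
        using bump_integrable(1)[OF fu] by simp
      also have "\<dots> \<le> \<langle>\<lambda>y. (v - u) * (bump' k d (y + (u - t)) + 12 * (real k)\<^sup>2 * (v - u)), \<zeta> u j\<rangle>"
      proof (rule finite_measures_mono[OF fu])
        show "integrable (\<zeta> u j) (\<lambda>y. ?\<Psi> v y - ?\<Psi> u y)" using bump_integrable(1)[OF fu] by simp
        show "integrable (\<zeta> u j) (\<lambda>y. (v - u) * (bump' k d (y + (u - t)) + 12 * (real k)\<^sup>2 * (v - u)))"
          by (intro integrable_mult_right Bochner_Integration.integrable_add bump_integrable(2)[OF fu] const_int)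
        show "?\<Psi> v y - ?\<Psi> u y \<le> (v - u) * (bump' k d (y + (u - t)) + 12 * (real k)\<^sup>2 * (v - u))" for y
          using bump_taylor[OF uv(2), of k d "y - t"] by (simp add: algebra_simps)
      qed
      also have "\<dots> = (v - u) * (P u u + 12 * (real k)\<^sup>2 * (v - u) * measure (\<zeta> u j) {0..})"
        using Bochner_Integration.integral_add[OF bump_integrable(2)[OF fu, of k d "u - t"] const_int[of "12 * (real k)\<^sup>2 * (v - u)"]]
        by (simp only: integral_mult_right_zero P_def) (simp add: finite_measures_space[OF fu])
      also have "\<dots> \<le> (v - u) * (P u u + 12 * (real k)\<^sup>2 * (v - u) * Z)"
        using uv Z(2)[of u] by (intro mult_left_mono add_left_mono) auto
      finally show ?thesis .
    qed
    moreover have "integral {0..v} A = integral {0..u} A + integral {u..v} A"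
      using Henstock_Kurzweil_Integration.integral_combine[OF uv(1,2) set_lborel_integral_eq_integral(2)[OF A order_refl]] by simp
    moreover have "(v - u) * (A v - 4 * real k * (v - u)) \<le> integral {u..v} A"
    proof -
      have "integral {u..v} (\<lambda>s. A v - 4 * real k * (v - u)) \<le> integral {u..v} A"
      proof (intro integral_le set_lborel_integral_eq_integral(2)[OF A uv(1)])
        fix s assume s: "s \<in> {u..v}"
        then have "4 * real k * (v - s) \<le> 4 * real k * (v - u)" by (intro mult_left_mono) auto
        then show "A v - 4 * real k * (v - u) \<le> A s" using A_lip[of s v] s by simp
      qed auto
      then show ?thesis using uv by simp
    qed
    then have "\<alpha> j * ((v - u) * (A v - 4 * real k * (v - u))) \<le> \<alpha> j * integral {u..v} A"
      using \<alpha> by (intro mult_left_mono) auto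
    ultimately show ?thesis unfolding H_def by (simp add: algebra_simps)
  qed
  have "H u \<le> H 0"
  proof (rule slope_nonpos_imp_le[OF _ u])
    fix \<epsilon> :: real assume \<epsilon>: "0 < \<epsilon>"
    define c where "c = 12 * (real k)\<^sup>2 * Z + 4 * real k * \<alpha> j"
    have c: "0 \<le> c" using Z \<alpha> by (auto simp: c_def)
    obtain \<delta> where \<delta>: "\<delta> > 0" "\<And>x x'. x \<in> {0..t} \<times> {0..t} \<Longrightarrow> x' \<in> {0..t} \<times> {0..t} \<Longrightarrow> dist x' x < \<delta> \<Longrightarrow>
        dist (P (fst x') (snd x')) (P (fst x) (snd x)) < \<epsilon> / 2"
      using P[of "\<epsilon> / 2"] \<epsilon> by auto
    \<comment> \<open>The third of \<delta> puts (s, v) within 2/3 of \<delta> from (u, u). The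
      second bound makes c * (v - u) at most \<epsilon> / 2, and c + 1 avoids dividing by
      zero.\<close>
    define \<delta>' where "\<delta>' = min (\<delta> / 3) (\<epsilon> / (2 * (c + 1)))"
    have "\<delta>' > 0" using \<delta> \<epsilon> c by (auto simp: \<delta>'_def)
    moreover have "H v - H u \<le> \<epsilon> * (v - u)" if uv: "0 \<le> u" "u \<le> v" "v \<le> t" "v - u \<le> \<delta>'" for u v
    proof -
      have "P u u - \<epsilon> / 2 \<le> P s v" if s: "u \<le> s" "s \<le> v" for s
      proof -
        have "dist (s, v) (u, u) \<le> \<bar>s - u\<bar> + \<bar>v - u\<bar>"
          unfolding dist_prod_def using sqrt_sum_squares_le_sum_abs[of "s - u" "v - u"] by (simp add: dist_real_def)
        also have "\<dots> < \<delta>" using s uv \<delta>(1) by (auto simp: \<delta>'_def)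
        finally have "dist (P s v) (P u u) < \<epsilon> / 2" using \<delta>(2)[of "(u, u)" "(s, v)"] s uv by auto
        then show ?thesis unfolding dist_real_def by linarith
      qed
      then have "H v - H u \<le> (v - u) * (\<epsilon> / 2 + c * (v - u))"
        unfolding c_def by (rule main[OF uv(1-3)])
      also have "\<dots> \<le> (v - u) * \<epsilon>"
      proof (rule mult_left_mono)
        have "c * (v - u) \<le> c * (\<epsilon> / (2 * (c + 1)))" using uv(4) c by (intro mult_left_mono) (auto simp: \<delta>'_def)
        also have "\<dots> \<le> \<epsilon> / 2" using c \<epsilon> by (simp add: field_simps)
        finally show "\<epsilon> / 2 + c * (v - u) \<le> \<epsilon>" by simp
      qed (use uv in simp)
      finally show ?thesis by (simp add: mult.commute)
    qed
    ultimately show "\<exists>\<delta>>0. \<forall>u v. 0 \<le> u \<longrightarrow> u \<le> v \<longrightarrow> v \<le> t \<longrightarrow> v - u \<le> \<delta> \<longrightarrow> H v - H u \<le> \<epsilon> * (v - u)"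
      by blast
  qed
  then show ?thesis unfolding H_def A_def by simp
qed

end

section \<open>From bump functions to intervals\<close>

lemma bump_pairing_tendsto:
  assumes \<xi>: "\<xi> \<in> finite_measures" and d: "0 \<le> d" and bc: "b \<le> c"
  shows "(\<lambda>k. \<langle>\<lambda>y. bump k d (y + (b - c)), \<xi>\<rangle>) \<longlonglongrightarrow> measure \<xi> {c - b<..c - b + d}"
proof -
  interpret finite_measure \<xi> using \<xi> by (simp add: finite_measures_def)
  have "(\<lambda>k. \<langle>\<lambda>y. bump k d (y + (b - c)), \<xi>\<rangle>) \<longlonglongrightarrow> \<langle>\<lambda>y. indicator {c - b<..c - b + d} y, \<xi>\<rangle>"
  proof (rule integral_dominated_convergence[where w="\<lambda>_. 1"])
    show "(\<lambda>y. indicator {c - b<..c - b + d} y :: real) \<in> borel_measurable \<xi>"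
      by (intro finite_measures_measurable_borel[OF \<xi>] borel_measurable_indicator) simp
    show "(\<lambda>y. bump k d (y + (b - c))) \<in> borel_measurable \<xi>" for k
      by (rule borel_measurable_integrable[OF bump_integrable(1)[OF \<xi>]])
    show "AE y in \<xi>. (\<lambda>k. bump k d (y + (b - c))) \<longlonglongrightarrow> indicator {c - b<..c - b + d} y"
    proof (intro AE_I2)
      fix y
      have "y + (b - c) \<in> {0<..d} \<longleftrightarrow> y \<in> {c - b<..c - b + d}" by auto
      then have "indicator {0<..d} (y + (b - c)) = (indicator {c - b<..c - b + d} y :: real)"
        by (simp only: indicator_def)
      then show "(\<lambda>k. bump k d (y + (b - c))) \<longlonglongrightarrow> indicator {c - b<..c - b + d} y"
        using bump_tendsto[OF d, of "y + (b - c)"] by (simp only:)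
    qed
    show "AE y in \<xi>. norm (bump k d (y + (b - c))) \<le> 1" for k
      unfolding real_norm_def by (intro AE_I2 bump_bounds(2))
    show "integrable \<xi> (\<lambda>_. 1 :: real)" by (rule integrable_const)
  qed
  moreover have "\<langle>\<lambda>y. indicator {c - b<..c - b + d} y, \<xi>\<rangle> = measure \<xi> {c - b<..c - b + d}"
  proof -
    have "{c - b<..c - b + d} \<inter> space \<xi> = {c - b<..c - b + d}"
      unfolding finite_measures_space[OF \<xi>] using bc by auto
    with Bochner_Integration.integral_indicator[of \<xi> "{c - b<..c - b + d}"] show ?thesis by (simp only:)
  qed
  ultimately show ?thesis by (simp only:)
qed

text \<open>The limit of the bump inequality, on both sides by dominated convergence. The half-open
  form of the intervals comes from the pointwise limit of the bumps.\<close>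

lemma (in fluid) interval_transport:
  assumes j: "j \<in> {1..J}" and d: "0 \<le> d" and u: "0 \<le> u" "u \<le> t"
    and c: "\<And>s. 0 \<le> s \<Longrightarrow> s \<le> u \<Longrightarrow> measure (\<theta> j) {t - s<..t - s + d} \<le> c"
  shows "measure (\<zeta> u j) {t - u<..t - u + d} \<le> measure (\<zeta> 0 j) {t<..t + d} + \<alpha> j * (u * c)"
proof -
  let ?A = "\<lambda>k s. \<langle>\<lambda>y. bump k d (y + (s - t)), \<theta> j\<rangle>"
  let ?a = "\<lambda>s. measure (\<theta> j) {t - s<..t - s + d}"
  note \<theta>f = \<theta>(1)[OF j]
  have cont: "continuous_on {0..} (?A k)" for k
    by (rule bump_pairing_continuous(1)[OF weakly_continuous_const[OF \<theta>f] continuous_on_id]) (auto simp: dist_real_def)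
  \<comment> \<open>Integrability of the interval mass in s comes out of dominated convergence
    itself, as the mass is a bounded limit of continuous functions.\<close>
  have dom: "?a integrable_on {0..u}" "(\<lambda>k. integral {0..u} (?A k)) \<longlonglongrightarrow> integral {0..u} ?a"
  proof -
    have b: "norm (?A k s) \<le> 1" for k s
      unfolding real_norm_def
      by (rule order_trans[OF finite_measures_integrable(2)[OF \<theta>f borel_measurable_integrable[OF bump_integrable(1)[OF \<theta>f]] bump_bounds(2)]])
        (simp add: \<theta>(2)[OF j])
    have l: "(\<lambda>k. ?A k s) \<longlonglongrightarrow> ?a s" if "s \<in> {0..u}" for s
      using that u by (intro bump_pairing_tendsto[OF \<theta>f d]) auto
    have i: "?A k integrable_on {0..u}" for k by (rule set_lborel_integral_eq_integral(2)[OF cont order_refl])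
    show "?a integrable_on {0..u}" "(\<lambda>k. integral {0..u} (?A k)) \<longlonglongrightarrow> integral {0..u} ?a"
      using dominated_convergence[OF i _ b l] by auto
  qed
  have "integral {0..u} ?a \<le> integral {0..u} (\<lambda>_. c)"
    using c by (intro integral_le dom) auto
  then have le: "integral {0..u} ?a \<le> u * c" using u by simp
  have "measure (\<zeta> u j) {t - u<..t - u + d} \<le> measure (\<zeta> 0 j) {t - 0<..t - 0 + d} + \<alpha> j * integral {0..u} ?a"
  proof (rule LIMSEQ_le)
    show "(\<lambda>k. \<langle>\<lambda>y. bump k d (y + (u - t)), \<zeta> u j\<rangle>) \<longlonglongrightarrow> measure (\<zeta> u j) {t - u<..t - u + d}"
      using u by (intro bump_pairing_tendsto[OF \<zeta>_finite[OF u(1) j] d]) auto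
    show "(\<lambda>k. \<langle>\<lambda>y. bump k d (y + (0 - t)), \<zeta> 0 j\<rangle> + \<alpha> j * integral {0..u} (?A k))
        \<longlonglongrightarrow> measure (\<zeta> 0 j) {t - 0<..t - 0 + d} + \<alpha> j * integral {0..u} ?a"
      using u by (intro tendsto_intros dom bump_pairing_tendsto[OF \<zeta>_finite[OF order_refl j] d]) auto
    show "\<exists>N. \<forall>k\<ge>N. \<langle>\<lambda>y. bump k d (y + (u - t)), \<zeta> u j\<rangle>
        \<le> \<langle>\<lambda>y. bump k d (y + (0 - t)), \<zeta> 0 j\<rangle> + \<alpha> j * integral {0..u} (?A k)"
      using bump_transport[OF j d u] by blast
  qed
  also have "\<dots> \<le> measure (\<zeta> 0 j) {t<..t + d} + \<alpha> j * (u * c)"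
    using le pos(1)[OF j] by (simp add: mult_left_mono)
  finally show ?thesis .
qed

section \<open>Regularity of translates\<close>

text \<open>With exponents at most 1, several bounds on [0, T] can be weakened to a common exponent
  at the price of the factor max 1 T.\<close>

definition holder_bound :: "real \<Rightarrow> (real \<Rightarrow> real \<Rightarrow> real \<Rightarrow> real) \<Rightarrow> bool" where
  "holder_bound T F \<longleftrightarrow> (\<exists>h H. 0 < h \<and> h \<le> 1 \<and> 0 \<le> H \<and>
     (\<forall>u t t'. 0 \<le> u \<longrightarrow> u \<le> t \<longrightarrow> t \<le> t' \<longrightarrow> t' \<le> T \<longrightarrow> F u t t' \<le> H * (t' - t) powr h))"

lemma powr_le_powr_smaller:
  fixes d h h' T :: real
  assumes "0 \<le> d" "d \<le> T" "h \<le> h'" "h' \<le> 1" "0 < h"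
  shows "d powr h' \<le> (max 1 T) * d powr h"
proof (cases "d = 0")
  case False
  have "d powr h' = d powr h * d powr (h' - h)" by (simp flip: powr_add)
  also have "\<dots> \<le> d powr h * (max 1 T)"
  proof (rule mult_left_mono)
    have "d powr (h' - h) \<le> (max 1 T) powr (h' - h)" using assms by (intro powr_mono2) auto
    also have "\<dots> \<le> (max 1 T) powr 1" using assms by (intro powr_mono) auto
    finally show "d powr (h' - h) \<le> max 1 T" by simp
  qed simp
  finally show ?thesis by (simp add: mult.commute)
qed simp

text \<open>The smallest exponent serves all members; the constants are added and multiplied by the
  cost of lowering an exponent.\<close>

lemma holder_bound_finite:
  assumes "finite A" "\<And>a. a \<in> A \<Longrightarrow> holder_bound T (F a)"
  shows "\<exists>h H. 0 < h \<and> h \<le> 1 \<and> 0 \<le> H \<and>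
     (\<forall>a\<in>A. \<forall>u t t'. 0 \<le> u \<longrightarrow> u \<le> t \<longrightarrow> t \<le> t' \<longrightarrow> t' \<le> T \<longrightarrow> F a u t t' \<le> H * (t' - t) powr h)"
  using assms
proof (induction A rule: finite_induct)
  case empty
  then show ?case by (intro exI[of _ 1]) auto
next
  case (insert b A)
  obtain h1 H1 where 1: "0 < h1" "h1 \<le> 1" "0 \<le> H1"
    "\<And>a u t t'. a \<in> A \<Longrightarrow> 0 \<le> u \<Longrightarrow> u \<le> t \<Longrightarrow> t \<le> t' \<Longrightarrow> t' \<le> T \<Longrightarrow> F a u t t' \<le> H1 * (t' - t) powr h1"
    using insert.IH insert.prems by (metis insertI2)
  obtain h2 H2 where 2: "0 < h2" "h2 \<le> 1" "0 \<le> H2"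
    "\<And>u t t'. 0 \<le> u \<Longrightarrow> u \<le> t \<Longrightarrow> t \<le> t' \<Longrightarrow> t' \<le> T \<Longrightarrow> F b u t t' \<le> H2 * (t' - t) powr h2"
    using insert.prems[of b] unfolding holder_bound_def by (metis insertI1)
  define h H where "h = min h1 h2" and "H = max 1 T * (H1 + H2)"
  have up: "H' * (t' - t) powr h' \<le> H * (t' - t) powr h"
    if "0 \<le> H'" "H' \<le> H1 + H2" "h \<le> h'" "h' \<le> 1" "0 \<le> u" "u \<le> t" "t \<le> t'" "t' \<le> T" for H' h' u t t'
  proof -
    have "H' * (t' - t) powr h' \<le> (H1 + H2) * (max 1 T * (t' - t) powr h)"
      using that 1 2 by (intro mult_mono powr_le_powr_smaller) (auto simp: h_def)
    then show ?thesis by (simp add: H_def mult_ac)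
  qed
  show ?case
  proof (rule exI[of _ h], rule exI[of _ H], intro conjI ballI allI impI)
    fix a u t t' assume a: "a \<in> insert b A" and u: "0 \<le> u" "u \<le> t" "t \<le> t'" "t' \<le> T"
    show "F a u t t' \<le> H * (t' - t) powr h"
    proof (cases "a = b")
      case True
      have "H2 * (t' - t) powr h2 \<le> H * (t' - t) powr h"
        by (rule up[OF _ _ _ _ u]) (use 1(1-3) 2(1-3) in \<open>auto simp: h_def\<close>)
      then show ?thesis using 2(4)[OF u] True by simp
    next
      case False
      have "H1 * (t' - t) powr h1 \<le> H * (t' - t) powr h"
        by (rule up[OF _ _ _ _ u]) (use 1(1-3) 2(1-3) in \<open>auto simp: h_def\<close>)
      then show ?thesis using 1(4)[OF _ u, of a] a False by simp
    qed
  qed (use 1(1-3) 2(1-3) in \<open>auto simp: h_def H_def\<close>)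
qed

lemma finite_measures_borel_sets: "\<xi> \<in> finite_measures \<Longrightarrow> A \<in> sets borel \<Longrightarrow> A \<subseteq> {0..} \<Longrightarrow> A \<in> sets \<xi>"
  using sets_restrict_space_iff[of "{0..}" borel A] by (simp add: finite_measures_sets)

lemma holder_cdf_interval:
  assumes \<xi>: "\<xi> \<in> finite_measures" and h: "holder_cdf \<xi>"
  shows "\<exists>h H. 0 < h \<and> h \<le> 1 \<and> 0 \<le> H \<and> (\<forall>a b. 0 \<le> a \<longrightarrow> a \<le> b \<longrightarrow> measure \<xi> {a<..b} \<le> H * (b - a) powr h)"
proof -
  interpret finite_measure \<xi> using \<xi> by (simp add: finite_measures_def)
  obtain h C where h: "0 < h" "h \<le> 1"
    "\<And>x y. 0 \<le> x \<Longrightarrow> 0 \<le> y \<Longrightarrow> \<bar>measure \<xi> {0..x} - measure \<xi> {0..y}\<bar> \<le> C * \<bar>x - y\<bar> powr h"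
    using h unfolding holder_cdf_def by blast
  have "measure \<xi> {a<..b} \<le> max C 0 * (b - a) powr h" if ab: "0 \<le> a" "a \<le> b" for a b
  proof -
    have "{a<..b} = {0..b} - {0..a}" using ab by auto
    then have "measure \<xi> {a<..b} = measure \<xi> {0..b} - measure \<xi> {0..a}"
      using ab by (simp add: finite_measure_Diff finite_measures_borel_sets[OF \<xi>])
    also have "\<dots> \<le> C * \<bar>b - a\<bar> powr h" using h(3)[of b a] ab by simp
    also have "\<dots> \<le> max C 0 * (b - a) powr h" using ab by (intro mult_mono) auto
    finally show ?thesis .
  qed
  then show ?thesis using h(1,2) by (intro exI[of _ h] exI[of _ "max C 0"]) auto
qed

text \<open>For \<theta> this is the assumption. For \<zeta> the transport bound adds the initial
  mass of a shifted interval and arrivals over a time of at most T; their exponents may differ, and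
  the smaller one is taken.\<close>

lemma (in fluid) interval_holder_bound:
  assumes j: "j \<in> {1..J}" and h: "holder_cdf (\<theta> j)" "holder_cdf (\<zeta> 0 j)" and T: "0 < T"
  shows "holder_bound T (\<lambda>u t t'. measure (\<theta> j) {t - u<..t' - u})"
    and "holder_bound T (\<lambda>u t t'. measure (\<zeta> u j) {t - u<..t' - u})"
proof -
  obtain h1 H1 where 1: "0 < h1" "h1 \<le> 1" "0 \<le> H1"
    "\<And>a b. 0 \<le> a \<Longrightarrow> a \<le> b \<Longrightarrow> measure (\<theta> j) {a<..b} \<le> H1 * (b - a) powr h1"
    using holder_cdf_interval[OF \<theta>(1)[OF j] h(1)] by blast
  obtain h2 H2 where 2: "0 < h2" "h2 \<le> 1" "0 \<le> H2"
    "\<And>a b. 0 \<le> a \<Longrightarrow> a \<le> b \<Longrightarrow> measure (\<zeta> 0 j) {a<..b} \<le> H2 * (b - a) powr h2"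
    using holder_cdf_interval[OF \<zeta>_finite[OF order_refl j] h(2)] by blast
  show "holder_bound T (\<lambda>u t t'. measure (\<theta> j) {t - u<..t' - u})"
    unfolding holder_bound_def
  proof (rule exI[of _ h1], rule exI[of _ H1], intro conjI allI impI)
    fix u t t' :: real assume "0 \<le> u" "u \<le> t" "t \<le> t'" "t' \<le> T"
    then show "measure (\<theta> j) {t - u<..t' - u} \<le> H1 * (t' - t) powr h1" using 1(4)[of "t - u" "t' - u"] by simp
  qed (use 1(1-3) in auto)
  define h H where "h = min h1 h2" and "H = max 1 T * (H2 + \<alpha> j * T * H1)"
  note \<alpha> = pos(1)[OF j]
  show "holder_bound T (\<lambda>u t t'. measure (\<zeta> u j) {t - u<..t' - u})"
    unfolding holder_bound_def
  proof (rule exI[of _ h], rule exI[of _ H], intro conjI allI impI)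
    fix u t t' :: real assume u: "0 \<le> u" "u \<le> t" "t \<le> t'" "t' \<le> T"
    define d where "d = t' - t"
    have d: "0 \<le> d" "d \<le> T" using u by (auto simp: d_def)
    have m: "d powr h1 \<le> max 1 T * d powr h" "d powr h2 \<le> max 1 T * d powr h"
      using d 1 2 by (auto intro!: powr_le_powr_smaller simp: h_def)
    have "measure (\<zeta> u j) {t - u<..t - u + d} \<le> measure (\<zeta> 0 j) {t<..t + d} + \<alpha> j * (u * (H1 * d powr h1))"
    proof (rule interval_transport[OF j d(1) u(1,2)])
      fix s assume "0 \<le> s" "s \<le> u"
      then show "measure (\<theta> j) {t - s<..t - s + d} \<le> H1 * d powr h1"
        using 1(4)[of "t - s" "t - s + d"] u d by simp
    qed
    also have "\<dots> \<le> H2 * (max 1 T * d powr h) + \<alpha> j * (T * (H1 * (max 1 T * d powr h)))"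
    proof (intro add_mono mult_left_mono mult_mono)
      have "measure (\<zeta> 0 j) {t<..t + d} \<le> H2 * d powr h2" using 2(4)[of t "t + d"] u d by simp
      also have "\<dots> \<le> H2 * (max 1 T * d powr h)" using 2 m by (intro mult_left_mono) auto
      finally show "measure (\<zeta> 0 j) {t<..t + d} \<le> H2 * (max 1 T * d powr h)" .
    qed (use u m 1 T \<alpha> in auto)
    also have "\<dots> = H * d powr h" by (simp add: H_def algebra_simps)
    finally show "measure (\<zeta> u j) {t - u<..t' - u} \<le> H * (t' - t) powr h" by (simp add: d_def)
  qed (use 1(1-3) 2(1-3) T \<alpha> in \<open>auto simp: h_def H_def\<close>)
qed

section \<open>Translates of bounded Lipschitz functions and their measurability in time\<close>

definition bounded_lipschitz :: "(real \<Rightarrow> real) \<Rightarrow> bool" where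
  "bounded_lipschitz f \<longleftrightarrow> (\<exists>D L. 0 \<le> D \<and> 0 \<le> L \<and> (\<forall>y\<ge>0. \<bar>f y\<bar> \<le> D) \<and>
     (\<forall>x\<ge>0. \<forall>y\<ge>0. \<bar>f x - f y\<bar> \<le> L * \<bar>x - y\<bar>))"

lemma bounded_lipschitz_test: "f \<in> \<C> \<Longrightarrow> bounded_lipschitz f"
  unfolding bounded_lipschitz_def by (rule test_function_lipschitz)

lemma bounded_lipschitz_one: "bounded_lipschitz (\<lambda>_. 1)"
  unfolding bounded_lipschitz_def by (intro exI[of _ 1]) auto

lemma bounded_lipschitz_continuous:
  assumes "bounded_lipschitz f"
  shows "continuous_on {0..} f"
proof -
  obtain L where L: "0 \<le> L" "\<And>x y. 0 \<le> x \<Longrightarrow> 0 \<le> y \<Longrightarrow> \<bar>f x - f y\<bar> \<le> L * \<bar>x - y\<bar>"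
    using assms by (auto simp: bounded_lipschitz_def)
  show ?thesis
    by (rule lipschitz_on_continuous_on[of L], rule lipschitz_onI) (use L in \<open>auto simp: dist_real_def\<close>)
qed

lemma translate_measurable:
  assumes "bounded_lipschitz f"
  shows "translate x f \<in> borel_measurable borel"
proof -
  have "continuous_on UNIV (\<lambda>y. f (max 0 (y - x)))"
    by (rule continuous_on_compose2[OF bounded_lipschitz_continuous[OF assms]]) (auto intro!: continuous_intros)
  then have [measurable]: "(\<lambda>y. f (max 0 (y - x))) \<in> borel_measurable borel"
    by (rule borel_measurable_continuous_onI)
  have "translate x f = (\<lambda>y. if y > x then f (max 0 (y - x)) else 0)"
    by (auto simp: translate_def fun_eq_iff max_def)
  moreover have "(\<lambda>y. if y > x then f (max 0 (y - x)) else 0) \<in> borel_measurable borel" by measurable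
  ultimately show ?thesis by simp
qed

lemma translate_bound: "(\<And>y. 0 \<le> y \<Longrightarrow> \<bar>f y\<bar> \<le> D) \<Longrightarrow> 0 \<le> D \<Longrightarrow> \<bar>translate x f y\<bar> \<le> D"
  by (simp add: translate_def)

text \<open>Multiplying by \<open>y \<mapsto> min 1 (n y)\<close> makes the function vanish at 0, so that its translates
  are jointly continuous; the translates themselves are the limits as \<open>n \<rightarrow> \<infinity>\<close>.\<close>

definition cut :: "nat \<Rightarrow> (real \<Rightarrow> real) \<Rightarrow> real \<Rightarrow> real" where
  "cut n f z = f (max 0 z) * min 1 (real n * max 0 z)"

lemma cut_tendsto: "(\<lambda>n. cut n f (y - x)) \<longlonglongrightarrow> translate x f y"
proof (cases "y > x")
  case True
  then obtain m :: nat where m: "1 / (y - x) < m" using reals_Archimedean2 by blast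
  have "cut n f (y - x) = translate x f y" if "m \<le> n" for n
  proof -
    have "1 \<le> real m * (y - x)" using m True by (simp add: field_simps)
    also have "\<dots> \<le> real n * (y - x)" using that True by (intro mult_right_mono) auto
    finally show ?thesis using True by (simp add: cut_def translate_def)
  qed
  then have "\<forall>\<^sub>F n in sequentially. cut n f (y - x) = translate x f y" by (auto simp: eventually_sequentially)
  then show ?thesis by (rule tendsto_eventually)
qed (simp add: cut_def translate_def)

lemma cut_bound:
  assumes "\<And>y. 0 \<le> y \<Longrightarrow> \<bar>f y\<bar> \<le> D"
  shows "\<bar>cut n f z\<bar> \<le> D"
proof -
  have "\<bar>cut n f z\<bar> \<le> D * 1"
    unfolding cut_def abs_mult using assms[of "max 0 z"] by (intro mult_mono) auto
  then show ?thesis by simp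
qed

lemma cut_lipschitz:
  assumes D: "\<And>y. 0 \<le> y \<Longrightarrow> \<bar>f y\<bar> \<le> D" and L: "\<And>x y. 0 \<le> x \<Longrightarrow> 0 \<le> y \<Longrightarrow> \<bar>f x - f y\<bar> \<le> L * \<bar>x - y\<bar>"
    and "0 \<le> L" "0 \<le> D"
  shows "\<bar>cut n f x - cut n f y\<bar> \<le> (L + D * real n) * \<bar>x - y\<bar>"
proof -
  define a b where "a = max 0 x" and "b = max 0 y"
  have ab: "0 \<le> a" "0 \<le> b" "\<bar>a - b\<bar> \<le> \<bar>x - y\<bar>" by (auto simp: a_def b_def max_def)
  have m: "\<bar>min 1 (real n * a) - min 1 (real n * b)\<bar> \<le> real n * \<bar>a - b\<bar>"
  proof -
    have "\<bar>min 1 (real n * a) - min 1 (real n * b)\<bar> \<le> \<bar>real n * a - real n * b\<bar>" by (auto simp: min_def)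
    then show ?thesis by (simp add: abs_mult flip: right_diff_distrib)
  qed
  have "cut n f x - cut n f y = (f a - f b) * min 1 (real n * a) + f b * (min 1 (real n * a) - min 1 (real n * b))"
    by (simp add: cut_def a_def b_def algebra_simps)
  also have "\<bar>\<dots>\<bar> \<le> \<bar>f a - f b\<bar> * \<bar>min 1 (real n * a)\<bar> + \<bar>f b\<bar> * \<bar>min 1 (real n * a) - min 1 (real n * b)\<bar>"
    by (rule order_trans[OF abs_triangle_ineq]) (simp add: abs_mult)
  also have "\<dots> \<le> (L * \<bar>a - b\<bar>) * 1 + D * (real n * \<bar>a - b\<bar>)"
    using ab D[OF ab(2)] L[OF ab(1,2)] m assms(3,4) by (intro add_mono mult_mono) auto
  also have "\<dots> = (L + D * real n) * \<bar>a - b\<bar>" by (simp add: algebra_simps)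
  also have "\<dots> \<le> (L + D * real n) * \<bar>x - y\<bar>" using ab assms(3,4) by (intro mult_left_mono) auto
  finally show ?thesis .
qed

text \<open>For the constant 1 the translates jump, so the pairing need not be continuous in u. The
  cut functions are Lipschitz, their pairings are continuous, and measurability passes to the
  pointwise limit.\<close>

lemma translate_pairing_measurable:
  assumes f: "bounded_lipschitz f" and g: "bounded_lipschitz g" and \<nu>: "weakly_continuous \<nu>"
  shows "(\<lambda>u. indicator {0..min t t'} u * \<langle>\<lambda>y. translate (t - u) f y * translate (t' - u) g y, \<nu> u\<rangle>) \<in> borel_measurable borel"
proof -
  obtain Df Lf where f': "0 \<le> Df" "0 \<le> Lf" "\<And>y. 0 \<le> y \<Longrightarrow> \<bar>f y\<bar> \<le> Df"
    "\<And>x y. 0 \<le> x \<Longrightarrow> 0 \<le> y \<Longrightarrow> \<bar>f x - f y\<bar> \<le> Lf * \<bar>x - y\<bar>" using f unfolding bounded_lipschitz_def by blast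
  obtain Dg Lg where g': "0 \<le> Dg" "0 \<le> Lg" "\<And>y. 0 \<le> y \<Longrightarrow> \<bar>g y\<bar> \<le> Dg"
    "\<And>x y. 0 \<le> x \<Longrightarrow> 0 \<le> y \<Longrightarrow> \<bar>g x - g y\<bar> \<le> Lg * \<bar>x - y\<bar>" using g unfolding bounded_lipschitz_def by blast
  define \<Psi> where "\<Psi> = (\<lambda>n u y. cut n f (y - (t - u)) * cut n g (y - (t' - u)))"
  have \<Psi>b: "\<bar>\<Psi> n u y\<bar> \<le> Df * Dg" for n u y
    unfolding \<Psi>_def abs_mult using cut_bound[OF f'(3)] cut_bound[OF g'(3)] f' g' by (intro mult_mono) auto
  \<comment> \<open>Both factors depend on u and y only through u + y, so a single estimate gives
    continuity in y for fixed u and in u for fixed y.\<close>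
  have lip: "\<bar>\<Psi> n u y - \<Psi> n u' y'\<bar> \<le> (Dg * (Lf + Df * real n) + Df * (Lg + Dg * real n)) * \<bar>(u + y) - (u' + y')\<bar>" for n u u' y y'
  proof -
    let ?f = "cut n f (y - (t - u))" and ?f' = "cut n f (y' - (t - u'))"
    let ?g = "cut n g (y - (t' - u))" and ?g' = "cut n g (y' - (t' - u'))"
    have "\<Psi> n u y - \<Psi> n u' y' = (?f - ?f') * ?g + ?f' * (?g - ?g')" by (simp add: \<Psi>_def algebra_simps)
    also have "\<bar>\<dots>\<bar> \<le> \<bar>?f - ?f'\<bar> * \<bar>?g\<bar> + \<bar>?f'\<bar> * \<bar>?g - ?g'\<bar>"
      by (rule order_trans[OF abs_triangle_ineq]) (simp add: abs_mult)
    also have "\<dots> \<le> ((Lf + Df * real n) * \<bar>(y - (t - u)) - (y' - (t - u'))\<bar>) * Dg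
        + Df * ((Lg + Dg * real n) * \<bar>(y - (t' - u)) - (y' - (t' - u'))\<bar>)"
      using f' g' by (intro add_mono mult_mono cut_lipschitz cut_bound) auto
    also have "\<dots> = (Dg * (Lf + Df * real n) + Df * (Lg + Dg * real n)) * \<bar>(u + y) - (u' + y')\<bar>"
      by (simp add: algebra_simps)
    finally show ?thesis .
  qed
  have cont: "continuous_on UNIV (\<Psi> n u)" for n u
    by (rule lipschitz_on_continuous_on[of "Dg * (Lf + Df * real n) + Df * (Lg + Dg * real n)"], rule lipschitz_onI)
      (use lip[of n u _ u] f' g' in \<open>auto simp: dist_real_def\<close>)
  let ?A = "{0..min t t'}"
  have n: "(\<lambda>u. indicator ?A u *\<^sub>R \<langle>\<Psi> n u, \<nu> u\<rangle>) \<in> borel_measurable borel" for n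
  proof (rule borel_measurable_continuous_on_indicator)
    show "continuous_on ?A (\<lambda>u. \<langle>\<Psi> n u, \<nu> u\<rangle>)"
    proof (rule pairing_continuous[OF \<nu> continuous_on_id, where D="Df * Dg"
          and L="Dg * (Lf + Df * real n) + Df * (Lg + Dg * real n)"])
      show "continuous_on {0..} (\<Psi> n u)" for u by (rule continuous_on_subset[OF cont]) simp
      show "\<bar>\<Psi> n u y - \<Psi> n u' y\<bar> \<le> (Dg * (Lf + Df * real n) + Df * (Lg + Dg * real n)) * dist u u'" for u u' y
        using lip[of n u y u' y] by (simp add: dist_real_def)
    qed (use \<Psi>b in auto)
  qed simp
  show ?thesis
  proof (rule borel_measurable_LIMSEQ_real[OF _ n])
    fix u
    show "(\<lambda>n. indicator ?A u *\<^sub>R \<langle>\<Psi> n u, \<nu> u\<rangle>) \<longlonglongrightarrow> indicator ?A u * \<langle>\<lambda>y. translate (t - u) f y * translate (t' - u) g y, \<nu> u\<rangle>"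
    proof (cases "u \<in> ?A")
      case True
      have fm: "\<nu> u \<in> finite_measures" using weakly_continuousD(1)[OF \<nu>] True by simp
      interpret finite_measure "\<nu> u" using fm by (simp add: finite_measures_def)
      have "(\<lambda>n. \<langle>\<Psi> n u, \<nu> u\<rangle>) \<longlonglongrightarrow> \<langle>\<lambda>y. translate (t - u) f y * translate (t' - u) g y, \<nu> u\<rangle>"
      proof (rule integral_dominated_convergence[where w="\<lambda>_. Df * Dg"])
        show "(\<lambda>y. translate (t - u) f y * translate (t' - u) g y) \<in> borel_measurable (\<nu> u)"
          by (intro borel_measurable_times finite_measures_measurable_borel[OF fm] translate_measurable f g)
        show "\<Psi> n u \<in> borel_measurable (\<nu> u)" for n
          by (intro finite_measures_measurable_borel[OF fm] borel_measurable_continuous_onI cont)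
        show "AE y in \<nu> u. (\<lambda>n. \<Psi> n u y) \<longlonglongrightarrow> translate (t - u) f y * translate (t' - u) g y"
          unfolding \<Psi>_def by (intro AE_I2 tendsto_mult cut_tendsto)
        show "AE y in \<nu> u. norm (\<Psi> n u y) \<le> Df * Dg" for n
          unfolding real_norm_def by (intro AE_I2 \<Psi>b)
        show "integrable (\<nu> u) (\<lambda>_. Df * Dg)" by (rule integrable_const)
      qed
      then show ?thesis using True by simp
    qed simp
  qed
qed

lemma translate_pairing_measurable1:
  assumes f: "bounded_lipschitz f" and \<nu>: "weakly_continuous \<nu>"
  shows "(\<lambda>u. indicator {0..t} u * \<langle>translate (t - u) f, \<nu> u\<rangle>) \<in> borel_measurable borel"
proof -
  \<comment> \<open>Multiplying by the translate of 1 with the same shift changes nothing, which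
    reduces one function to the case of two.\<close>
  have "(\<lambda>y. translate x f y * translate x (\<lambda>_. 1) y) = translate x f" for x
    by (simp add: translate_def fun_eq_iff)
  then show ?thesis using translate_pairing_measurable[OF f bounded_lipschitz_one \<nu>, of t t] by simp
qed

text \<open>Second moment of the change of the translate when the later time moves from t to
  \<open>t'\<close>; it bounds the variance of the corresponding increment of the process up to the
  rate and the weight.\<close>

definition shift_increment :: "(real \<Rightarrow> real measure) \<Rightarrow> (real \<Rightarrow> real) \<Rightarrow> real \<Rightarrow> real \<Rightarrow> real \<Rightarrow> real" where
  "shift_increment \<nu> f u t t' = \<langle>\<lambda>y. (translate (t - u) f y - translate (t' - u) f y)\<^sup>2, \<nu> u\<rangle>"

lemma shift_increment_test:
  assumes f: "f \<in> \<C>" and \<nu>: "weakly_continuous \<nu>" and T: "0 < T"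
  shows "holder_bound T (shift_increment \<nu> f)"
proof -
  obtain D L where DL: "0 \<le> D" "0 \<le> L" "\<And>y. 0 \<le> y \<Longrightarrow> \<bar>f y\<bar> \<le> D"
    "\<And>x y. 0 \<le> x \<Longrightarrow> 0 \<le> y \<Longrightarrow> \<bar>f x - f y\<bar> \<le> L * \<bar>x - y\<bar>" using test_function_lipschitz[OF f] by blast
  have f0: "f 0 = 0" using f by (simp add: test_functions_def)
  obtain Z where Z: "0 \<le> Z" "\<And>s. 0 \<le> s \<Longrightarrow> s \<le> T \<Longrightarrow> measure (\<nu> s) {0..} \<le> Z"
    using weakly_continuous_mass_bound[OF \<nu>, of T] by blast
  \<comment> \<open>Because f 0 = 0, the cut-off in the translate is a clamp of the argument, which
    is 1-Lipschitz in the shift.\<close>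
  have tr: "translate x f y = f (max 0 (y - x))" for x y by (auto simp: translate_def f0 max_def)
  show ?thesis unfolding holder_bound_def
  proof (rule exI[of _ 1], rule exI[of _ "L\<^sup>2 * T * Z"], intro conjI allI impI)
    fix u t t' assume u: "0 \<le> u" "u \<le> t" "t \<le> t'" "t' \<le> T"
    have fm: "\<nu> u \<in> finite_measures" by (rule weakly_continuousD(1)[OF \<nu> u(1)])
    have "\<bar>(translate (t - u) f y - translate (t' - u) f y)\<^sup>2\<bar> \<le> L\<^sup>2 * T * (t' - t)" for y
    proof -
      have "\<bar>translate (t - u) f y - translate (t' - u) f y\<bar> \<le> L * \<bar>max 0 (y - (t - u)) - max 0 (y - (t' - u))\<bar>"
        unfolding tr by (rule DL(4)) auto
      also have "\<dots> \<le> L * (t' - t)" using u DL by (intro mult_left_mono) (auto simp: max_def)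
      finally have "\<bar>translate (t - u) f y - translate (t' - u) f y\<bar>\<^sup>2 \<le> (L * (t' - t))\<^sup>2" by (intro power_mono) auto
      also have "\<dots> = L\<^sup>2 * ((t' - t) * (t' - t))" by (simp add: power2_eq_square)
      \<comment> \<open>One of the two factors t' - t is bounded by T, leaving the exponent
        1.\<close>
      also have "\<dots> \<le> L\<^sup>2 * (T * (t' - t))" using u by (intro mult_left_mono mult_right_mono) auto
      finally show ?thesis by simp
    qed
    then have "\<bar>shift_increment \<nu> f u t t'\<bar> \<le> L\<^sup>2 * T * (t' - t) * measure (\<nu> u) {0..}"
      unfolding shift_increment_def
      by (intro finite_measures_integrable(2)[OF fm] borel_measurable_power borel_measurable_diff
          finite_measures_measurable_borel[OF fm] translate_measurable bounded_lipschitz_test f)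
    also have "\<dots> \<le> L\<^sup>2 * T * (t' - t) * Z" using u T Z by (intro mult_left_mono) auto
    finally show "shift_increment \<nu> f u t t' \<le> L\<^sup>2 * T * Z * (t' - t) powr 1" using u by (simp add: mult_ac)
  qed (use T Z(1) in auto)
qed

lemma shift_increment_one:
  assumes \<nu>: "weakly_continuous \<nu>" and h: "holder_bound T (\<lambda>u t t'. measure (\<nu> u) {t - u<..t' - u})"
  shows "holder_bound T (shift_increment \<nu> (\<lambda>_. 1))"
proof -
  have "shift_increment \<nu> (\<lambda>_. 1) u t t' = measure (\<nu> u) {t - u<..t' - u}"
    if u: "0 \<le> u" "u \<le> t" "t \<le> t'" for u t t'
  proof -
    have fm: "\<nu> u \<in> finite_measures" by (rule weakly_continuousD(1)[OF \<nu> u(1)])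
    have "(\<lambda>y. (translate (t - u) (\<lambda>_. 1) y - translate (t' - u) (\<lambda>_. 1) y)\<^sup>2) = indicator {t - u<..t' - u}"
      using u by (auto simp: translate_def indicator_def fun_eq_iff)
    moreover have "{t - u<..t' - u} \<inter> space (\<nu> u) = {t - u<..t' - u}"
      unfolding finite_measures_space[OF fm] using u by auto
    ultimately show ?thesis
      unfolding shift_increment_def using Bochner_Integration.integral_indicator[of "\<nu> u" "{t - u<..t' - u}"] by simp
  qed
  then show ?thesis using h unfolding holder_bound_def by simp
qed

section \<open>Covariances of mixtures\<close>

lemma triangle_iff: "(r, t) \<in> triangle T \<longleftrightarrow> 0 \<le> r \<and> r \<le> t \<and> t \<le> T"
  by (simp add: triangle_def)

lemma integrable_indicator_Icc: "integrable lborel (indicator {a..b} :: real \<Rightarrow> real)"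
  by (rule integrable_real_indicator) (simp_all add: emeasure_lborel_Icc_eq)

lemma integral_double_sum:
  fixes F :: "nat \<Rightarrow> nat \<Rightarrow> 'a \<Rightarrow> real" and N :: nat
  assumes i: "\<And>n m. n < N \<Longrightarrow> m < N \<Longrightarrow> integrable M (F n m)"
  shows "(\<integral>u. (\<Sum>n<N. \<Sum>m<N. F n m u) \<partial>M) = (\<Sum>n<N. \<Sum>m<N. \<integral>u. F n m u \<partial>M)"
proof -
  have "(\<integral>u. (\<Sum>n<N. \<Sum>m<N. F n m u) \<partial>M) = (\<Sum>n<N. \<integral>u. (\<Sum>m<N. F n m u) \<partial>M)"
    by (intro Bochner_Integration.integral_sum Bochner_Integration.integrable_sum i) auto
  also have "\<dots> = (\<Sum>n<N. \<Sum>m<N. \<integral>u. F n m u \<partial>M)"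
    by (intro sum.cong refl Bochner_Integration.integral_sum i) auto
  finally show ?thesis .
qed

text \<open>The quadratic form is the variance of \<open>\<Sum>\<^sub>n a\<^sub>n g\<^sub>n(y) 1{k = cl n}\<close> when \<open>(k, y)\<close> is drawn from
  the mixture that picks \<open>k\<close> and \<open>y\<close> according to \<open>q\<^sub>k \<xi>\<^sub>k(dy)\<close>.\<close>

lemma mixture_variance_nonneg:
  fixes N :: nat and g :: "nat \<Rightarrow> real \<Rightarrow> real" and cl :: "nat \<Rightarrow> 'k"
  assumes cls: "finite cls" "\<And>n. n < N \<Longrightarrow> cl n \<in> cls"
    and \<xi>: "\<And>k. k \<in> cls \<Longrightarrow> \<xi> k \<in> finite_measures" and q: "\<And>k. k \<in> cls \<Longrightarrow> 0 \<le> q k"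
    and mass: "(\<Sum>k\<in>cls. q k * measure (\<xi> k) {0..}) = 1"
    and g: "\<And>n. n < N \<Longrightarrow> g n \<in> borel_measurable borel" "\<And>n y. n < N \<Longrightarrow> \<bar>g n y\<bar> \<le> D"
  shows "0 \<le> (\<Sum>n<N. \<Sum>m<N. a n * a m * (of_bool (cl n = cl m) * (q (cl n) * \<langle>\<lambda>y. g n y * g m y, \<xi> (cl n)\<rangle>)
    - q (cl n) * \<langle>g n, \<xi> (cl n)\<rangle> * (q (cl m) * \<langle>g m, \<xi> (cl m)\<rangle>)))"
proof -
  \<comment> \<open>\<open>G k\<close> is the combined function on class k, and s below is its mean
    under the mixture.\<close>
  define G where "G = (\<lambda>k y. \<Sum>n<N. a n * of_bool (cl n = k) * g n y)"
  define s where "s = (\<Sum>n<N. a n * (q (cl n) * \<langle>g n, \<xi> (cl n)\<rangle>))"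
  have i1: "integrable (\<xi> k) (g n)" if "k \<in> cls" "n < N" for k n
    by (rule finite_measures_integrable(1)[OF \<xi>[OF that(1)] finite_measures_measurable_borel[OF \<xi>[OF that(1)] g(1)[OF that(2)]] g(2)[OF that(2)]])
  have i2: "integrable (\<xi> k) (\<lambda>y. g n y * g m y)" if "k \<in> cls" "n < N" "m < N" for k n m
  proof (rule finite_measures_integrable(1)[OF \<xi>[OF that(1)], where D="D * D"])
    show "(\<lambda>y. g n y * g m y) \<in> borel_measurable (\<xi> k)"
      using that(2,3) by (intro borel_measurable_times finite_measures_measurable_borel[OF \<xi>[OF that(1)]] g(1))
    show "\<bar>g n y * g m y\<bar> \<le> D * D" for y
      unfolding abs_mult using g(2)[OF that(2), of y] g(2)[OF that(3), of y]
      by (intro mult_mono) (auto intro: order_trans[OF abs_ge_zero])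
  qed
  have GG: "(\<lambda>y. (G k y)\<^sup>2) = (\<lambda>y. \<Sum>n<N. \<Sum>m<N. a n * of_bool (cl n = k) * (a m * of_bool (cl m = k)) * (g n y * g m y))" for k
    unfolding G_def power2_eq_square sum_product by (intro ext sum.cong refl) (simp only: mult_ac)
  have iGG: "integrable (\<xi> k) (\<lambda>y. (G k y)\<^sup>2)" if "k \<in> cls" for k
    unfolding GG using that by (intro Bochner_Integration.integrable_sum integrable_mult_right i2) auto
  have iG: "integrable (\<xi> k) (G k)" if "k \<in> cls" for k
    unfolding G_def using that by (intro Bochner_Integration.integrable_sum integrable_mult_right i1) auto
  have "(\<Sum>k\<in>cls. q k * \<langle>\<lambda>y. (G k y)\<^sup>2, \<xi> k\<rangle>)
      = (\<Sum>k\<in>cls. \<Sum>n<N. \<Sum>m<N. q k * (a n * of_bool (cl n = k) * (a m * of_bool (cl m = k)) * \<langle>\<lambda>y. g n y * g m y, \<xi> k\<rangle>))"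
  proof (intro sum.cong refl)
    fix k assume k: "k \<in> cls"
    show "q k * \<langle>\<lambda>y. (G k y)\<^sup>2, \<xi> k\<rangle>
      = (\<Sum>n<N. \<Sum>m<N. q k * (a n * of_bool (cl n = k) * (a m * of_bool (cl m = k)) * \<langle>\<lambda>y. g n y * g m y, \<xi> k\<rangle>))"
      unfolding GG by (subst integral_double_sum) (intro integrable_mult_right i2 k, simp_all add: sum_distrib_left)
  qed
  also have "\<dots> = (\<Sum>n<N. \<Sum>m<N. \<Sum>k\<in>cls. q k * (a n * of_bool (cl n = k) * (a m * of_bool (cl m = k)) * \<langle>\<lambda>y. g n y * g m y, \<xi> k\<rangle>))"
    by (subst sum.swap, intro sum.cong refl, subst sum.swap, rule refl)
  also have "\<dots> = (\<Sum>n<N. \<Sum>m<N. \<Sum>k\<in>cls. if k = cl n then of_bool (cl n = cl m) * (q (cl n) * (a n * a m * \<langle>\<lambda>y. g n y * g m y, \<xi> (cl n)\<rangle>)) else 0)"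
    by (intro sum.cong refl) auto
  also have "\<dots> = (\<Sum>n<N. \<Sum>m<N. of_bool (cl n = cl m) * (q (cl n) * (a n * a m * \<langle>\<lambda>y. g n y * g m y, \<xi> (cl n)\<rangle>)))"
    using cls by (intro sum.cong refl) simp
  also have "\<dots> = (\<Sum>n<N. \<Sum>m<N. a n * a m * (of_bool (cl n = cl m) * (q (cl n) * \<langle>\<lambda>y. g n y * g m y, \<xi> (cl n)\<rangle>)))"
    by (intro sum.cong refl) (simp only: mult_ac)
  finally have sq: "(\<Sum>k\<in>cls. q k * \<langle>\<lambda>y. (G k y)\<^sup>2, \<xi> k\<rangle>)
      = (\<Sum>n<N. \<Sum>m<N. a n * a m * (of_bool (cl n = cl m) * (q (cl n) * \<langle>\<lambda>y. g n y * g m y, \<xi> (cl n)\<rangle>)))" .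
  have "(\<Sum>k\<in>cls. q k * \<langle>G k, \<xi> k\<rangle>) = (\<Sum>k\<in>cls. \<Sum>n<N. q k * (a n * of_bool (cl n = k) * \<langle>g n, \<xi> k\<rangle>))"
    unfolding G_def by (intro sum.cong refl) (simp add: i1 Bochner_Integration.integral_sum sum_distrib_left)
  also have "\<dots> = (\<Sum>n<N. \<Sum>k\<in>cls. if k = cl n then a n * (q (cl n) * \<langle>g n, \<xi> (cl n)\<rangle>) else 0)"
    by (subst sum.swap, intro sum.cong refl) auto
  also have "\<dots> = s" unfolding s_def using cls by (intro sum.cong refl) simp
  finally have lin: "(\<Sum>k\<in>cls. q k * \<langle>G k, \<xi> k\<rangle>) = s" .
  have var: "\<langle>\<lambda>y. (G k y - s)\<^sup>2, \<xi> k\<rangle> = \<langle>\<lambda>y. (G k y)\<^sup>2, \<xi> k\<rangle> - 2 * s * \<langle>G k, \<xi> k\<rangle> + s\<^sup>2 * measure (\<xi> k) {0..}"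
    if k: "k \<in> cls" for k
  proof -
    interpret finite_measure "\<xi> k" using \<xi>[OF k] by (simp add: finite_measures_def)
    have "(\<lambda>y. (G k y - s)\<^sup>2) = (\<lambda>y. (G k y)\<^sup>2 - 2 * s * G k y + s\<^sup>2)"
      by (simp add: power2_diff algebra_simps)
    then show ?thesis using iG[OF k] iGG[OF k] by (simp add: finite_measures_space[OF \<xi>[OF k]])
  qed
  \<comment> \<open>Nonnegativity of a mean square deviation. Since the mixture has total mass 1,
    the linear and the constant term combine to minus the square of s.\<close>
  have "0 \<le> (\<Sum>k\<in>cls. q k * \<langle>\<lambda>y. (G k y - s)\<^sup>2, \<xi> k\<rangle>)"
    using q by (intro sum_nonneg mult_nonneg_nonneg Bochner_Integration.integral_nonneg) auto
  also have "\<dots> = (\<Sum>k\<in>cls. q k * \<langle>\<lambda>y. (G k y)\<^sup>2, \<xi> k\<rangle> - 2 * s * (q k * \<langle>G k, \<xi> k\<rangle>) + s\<^sup>2 * (q k * measure (\<xi> k) {0..}))"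
    by (intro sum.cong refl) (simp add: var algebra_simps)
  also have "\<dots> = (\<Sum>k\<in>cls. q k * \<langle>\<lambda>y. (G k y)\<^sup>2, \<xi> k\<rangle>) - s\<^sup>2"
    by (simp add: sum.distrib sum_subtractf lin mass power2_eq_square flip: sum_distrib_left)
  also have "\<dots> = (\<Sum>n<N. \<Sum>m<N. a n * a m * (of_bool (cl n = cl m) * (q (cl n) * \<langle>\<lambda>y. g n y * g m y, \<xi> (cl n)\<rangle>)
    - q (cl n) * \<langle>g n, \<xi> (cl n)\<rangle> * (q (cl m) * \<langle>g m, \<xi> (cl m)\<rangle>)))"
  proof -
    have "s\<^sup>2 = (\<Sum>n<N. \<Sum>m<N. a n * a m * (q (cl n) * \<langle>g n, \<xi> (cl n)\<rangle> * (q (cl m) * \<langle>g m, \<xi> (cl m)\<rangle>)))"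
      unfolding s_def power2_eq_square sum_product by (intro sum.cong refl) (simp only: mult_ac)
    then show ?thesis unfolding sq by (simp only: right_diff_distrib sum_subtractf)
  qed
  finally show ?thesis .
qed

text \<open>One framework for both sources of noise. \<open>blk c\<close> is the source of
  coordinate c, an arrival stream or a server; \<open>cl c\<close> is the class it observes and
  \<open>\<phi> c\<close> its test function. A source has rate \<open>w\<close>, and
  \<open>\<pi>\<close> times \<open>\<nu>\<close> is the joint law of class and work at time u. The
  constants are uniform in the coordinates.\<close>

locale mixture =
  fixes C :: "'c set" and cls :: "'k set" and blk :: "'c \<Rightarrow> 'b" and cl :: "'c \<Rightarrow> 'k"
    and \<phi> :: "'c \<Rightarrow> real \<Rightarrow> real" and \<pi> :: "'b \<Rightarrow> real \<Rightarrow> 'k \<Rightarrow> real"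
    and \<nu> :: "'b \<Rightarrow> real \<Rightarrow> 'k \<Rightarrow> real measure" and w :: "'b \<Rightarrow> real \<Rightarrow> real" and T D W h H :: real
  assumes finite_C: "finite C" and finite_cls: "finite cls" and T: "0 < T" and D: "0 \<le> D" and W: "0 \<le> W"
    and h: "0 < h" "h \<le> 1" and H: "0 \<le> H"
    and cl: "c \<in> C \<Longrightarrow> cl c \<in> cls"
    and \<nu>: "c \<in> C \<Longrightarrow> k \<in> cls \<Longrightarrow> weakly_continuous (\<lambda>u. \<nu> (blk c) u k)"
    and w: "c \<in> C \<Longrightarrow> 0 \<le> u \<Longrightarrow> u \<le> T \<Longrightarrow> 0 \<le> w (blk c) u" "c \<in> C \<Longrightarrow> 0 \<le> u \<Longrightarrow> u \<le> T \<Longrightarrow> w (blk c) u \<le> W"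
    and w_meas: "c \<in> C \<Longrightarrow> (\<lambda>u. indicator {0..T} u * w (blk c) u) \<in> borel_measurable borel"
    and \<pi>: "c \<in> C \<Longrightarrow> k \<in> cls \<Longrightarrow> 0 \<le> u \<Longrightarrow> u \<le> T \<Longrightarrow> 0 \<le> \<pi> (blk c) u k"
    and \<pi>_meas: "c \<in> C \<Longrightarrow> k \<in> cls \<Longrightarrow> (\<lambda>u. indicator {0..T} u * \<pi> (blk c) u k) \<in> borel_measurable borel"
    and mass: "c \<in> C \<Longrightarrow> 0 \<le> u \<Longrightarrow> u \<le> T \<Longrightarrow> (\<Sum>k\<in>cls. \<pi> (blk c) u k * measure (\<nu> (blk c) u k) {0..}) = 1"
    and \<phi>: "c \<in> C \<Longrightarrow> bounded_lipschitz (\<phi> c)" "c \<in> C \<Longrightarrow> 0 \<le> y \<Longrightarrow> \<bar>\<phi> c y\<bar> \<le> D"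
    and shift: "c \<in> C \<Longrightarrow> 0 \<le> u \<Longrightarrow> u \<le> t \<Longrightarrow> t \<le> t' \<Longrightarrow> t' \<le> T \<Longrightarrow>
      \<pi> (blk c) u (cl c) * shift_increment (\<lambda>u. \<nu> (blk c) u (cl c)) (\<phi> c) u t t' \<le> H * (t' - t) powr h"
begin

definition first :: "real \<Rightarrow> 'c \<Rightarrow> real \<Rightarrow> real" where
  "first u c t = \<langle>translate (t - u) (\<phi> c), \<nu> (blk c) u (cl c)\<rangle>"

definition second :: "real \<Rightarrow> 'c \<Rightarrow> real \<Rightarrow> 'c \<Rightarrow> real \<Rightarrow> real" where
  "second u c t c' t' = \<langle>\<lambda>y. translate (t - u) (\<phi> c) y * translate (t' - u) (\<phi> c') y, \<nu> (blk c) u (cl c)\<rangle>"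

text \<open>The density in u of the covariance: rate times the covariance of the two observed
  functions under the mixture. Coordinates of different sources are uncorrelated.\<close>

definition dens :: "real \<Rightarrow> 'c \<Rightarrow> real \<Rightarrow> 'c \<Rightarrow> real \<Rightarrow> real" where
  "dens u c t c' t' = (if blk c = blk c' then
     (of_bool (cl c = cl c') * (\<pi> (blk c) u (cl c) * second u c t c' t')
      - \<pi> (blk c) u (cl c) * first u c t * (\<pi> (blk c') u (cl c') * first u c' t')) * w (blk c) u else 0)"

definition kern :: "'c \<times> real \<times> real \<Rightarrow> 'c \<times> real \<times> real \<Rightarrow> real" where
  "kern = (\<lambda>(c, r, t) (c', r', t'). LINT u:{0..min r r'}|lborel. dens u c t c' t')"

lemma \<nu>_finite: "c \<in> C \<Longrightarrow> k \<in> cls \<Longrightarrow> 0 \<le> u \<Longrightarrow> \<nu> (blk c) u k \<in> finite_measures"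
  by (rule weakly_continuousD(1)[OF \<nu>])

lemma \<pi>_mass:
  assumes "c \<in> C" "k \<in> cls" "0 \<le> u" "u \<le> T"
  shows "\<pi> (blk c) u k * measure (\<nu> (blk c) u k) {0..} \<le> 1"
  using member_le_sum[of k cls "\<lambda>k. \<pi> (blk c) u k * measure (\<nu> (blk c) u k) {0..}"]
    mass[OF assms(1,3,4)] \<pi>[OF assms(1) _ assms(3,4)] assms(2) finite_cls by simp

lemma translate_\<phi>_bound: "c \<in> C \<Longrightarrow> \<bar>translate x (\<phi> c) y\<bar> \<le> D"
  by (rule translate_bound) (auto intro: \<phi>(2) D)

lemma first_bound:
  assumes "c \<in> C" "0 \<le> u" "u \<le> T"
  shows "\<bar>\<pi> (blk c) u (cl c) * first u c t\<bar> \<le> D"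
proof -
  note c = assms(1) cl[OF assms(1)]
  have "\<bar>first u c t\<bar> \<le> D * measure (\<nu> (blk c) u (cl c)) {0..}"
    unfolding first_def
    by (intro finite_measures_integrable(2) finite_measures_measurable_borel[OF \<nu>_finite[OF c assms(2)]]
        \<nu>_finite[OF c assms(2)] translate_measurable \<phi>(1) translate_\<phi>_bound c)
  then have "\<pi> (blk c) u (cl c) * \<bar>first u c t\<bar> \<le> \<pi> (blk c) u (cl c) * (D * measure (\<nu> (blk c) u (cl c)) {0..})"
    using \<pi>[OF c assms(2,3)] by (intro mult_left_mono)
  also have "\<dots> = D * (\<pi> (blk c) u (cl c) * measure (\<nu> (blk c) u (cl c)) {0..})" by simp
  also have "\<dots> \<le> D * 1" using \<pi>_mass[OF c assms(2,3)] D by (intro mult_left_mono)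
  finally show ?thesis using \<pi>[OF c assms(2,3)] by (simp add: abs_mult)
qed

lemma translate_mult_bound: "c \<in> C \<Longrightarrow> c' \<in> C \<Longrightarrow> \<bar>translate x (\<phi> c) y * translate x' (\<phi> c') y\<bar> \<le> D * D"
  unfolding abs_mult by (intro mult_mono translate_\<phi>_bound) (auto intro: D)

lemma second_bound:
  assumes "c \<in> C" "c' \<in> C" "0 \<le> u" "u \<le> T"
  shows "\<bar>\<pi> (blk c) u (cl c) * second u c t c' t'\<bar> \<le> D * D"
proof -
  note c = assms(1) cl[OF assms(1)]
  have "\<bar>second u c t c' t'\<bar> \<le> D * D * measure (\<nu> (blk c) u (cl c)) {0..}"
    unfolding second_def
    by (intro finite_measures_integrable(2) borel_measurable_times finite_measures_measurable_borel[OF \<nu>_finite[OF c assms(3)]]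
        \<nu>_finite[OF c assms(3)] translate_measurable \<phi>(1) translate_mult_bound c assms(2))
  then have "\<pi> (blk c) u (cl c) * \<bar>second u c t c' t'\<bar> \<le> \<pi> (blk c) u (cl c) * (D * D * measure (\<nu> (blk c) u (cl c)) {0..})"
    using \<pi>[OF c assms(3,4)] by (intro mult_left_mono)
  also have "\<dots> = D * D * (\<pi> (blk c) u (cl c) * measure (\<nu> (blk c) u (cl c)) {0..})" by simp
  also have "\<dots> \<le> D * D * 1" using \<pi>_mass[OF c assms(3,4)] D by (intro mult_left_mono) auto
  finally show ?thesis using \<pi>[OF c assms(3,4)] by (simp add: abs_mult)
qed

lemma dens_bound:
  assumes "c \<in> C" "c' \<in> C" "0 \<le> u" "u \<le> T"
  shows "\<bar>dens u c t c' t'\<bar> \<le> 2 * D\<^sup>2 * W"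
proof (cases "blk c = blk c'")
  case True
  have "\<bar>of_bool (cl c = cl c') * (\<pi> (blk c) u (cl c) * second u c t c' t')\<bar> \<le> D\<^sup>2"
    using second_bound[OF assms, of t t'] D by (cases "cl c = cl c'") (simp_all add: power2_eq_square)
  moreover have "\<bar>\<pi> (blk c) u (cl c) * first u c t * (\<pi> (blk c') u (cl c') * first u c' t')\<bar> \<le> D\<^sup>2"
    unfolding abs_mult[of "_ * first u c t"] power2_eq_square
    using first_bound[OF assms(1,3,4), of t] first_bound[OF assms(2,3,4), of t'] D by (intro mult_mono) auto
  ultimately have "\<bar>of_bool (cl c = cl c') * (\<pi> (blk c) u (cl c) * second u c t c' t')
      - \<pi> (blk c) u (cl c) * first u c t * (\<pi> (blk c') u (cl c') * first u c' t')\<bar> \<le> 2 * D\<^sup>2" by linarith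
  then show ?thesis
    using True w[OF assms(1,3,4)] D by (simp add: dens_def abs_mult mult_mono)
qed (use D W in \<open>simp add: dens_def\<close>)

lemma dens_sym: "dens u c t c' t' = dens u c' t' c t"
proof (cases "blk c = blk c' \<and> cl c = cl c'")
  case True
  then have "second u c t c' t' = second u c' t' c t" by (simp add: second_def mult.commute)
  then show ?thesis using True by (simp add: dens_def mult_ac)
qed (auto simp: dens_def)

lemma dens_measurable:
  assumes c: "c \<in> C" "c' \<in> C" and r: "r \<le> t" "r' \<le> t'" "t \<le> T" "t' \<le> T"
  shows "(\<lambda>u. indicator {0..min r r'} u * dens u c t c' t') \<in> borel_measurable borel"
proof (cases "blk c = blk c'")
  case True
  let ?i = "indicator {0..min r r'} :: real \<Rightarrow> real"
  note k = cl[OF c(1)] cl[OF c(2)]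
  have [measurable]: "?i \<in> borel_measurable borel" by simp
  note [measurable] = w_meas[OF c(1)] \<pi>_meas[OF c(1) k(1)] \<pi>_meas[OF c(2) k(2)]
    translate_pairing_measurable[OF \<phi>(1)[OF c(1)] \<phi>(1)[OF c(2)] \<nu>[OF c(1) k(1)], of t t', folded second_def]
    translate_pairing_measurable1[OF \<phi>(1)[OF c(1)] \<nu>[OF c(1) k(1)], of t, folded first_def]
    translate_pairing_measurable1[OF \<phi>(1)[OF c(2)] \<nu>[OF c(2) k(2)], of t', folded first_def]
  \<comment> \<open>Each factor carries its own indicator, because it is known to be measurable only
    after cutting to that interval; on [0, min r r'] all these indicators are 1.\<close>
  have eq: "(\<lambda>u. ?i u * dens u c t c' t') = (\<lambda>u. ?i u * (
      (of_bool (cl c = cl c') * ((indicator {0..T} u * \<pi> (blk c) u (cl c)) * (indicator {0..min t t'} u * second u c t c' t'))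
      - (indicator {0..T} u * \<pi> (blk c) u (cl c)) * (indicator {0..t} u * first u c t)
        * ((indicator {0..T} u * \<pi> (blk c') u (cl c')) * (indicator {0..t'} u * first u c' t'))) * (indicator {0..T} u * w (blk c) u)))"
    (is "_ = ?f")
  proof
    fix u
    show "?i u * dens u c t c' t' = ?f u"
    proof (cases "u \<in> {0..min r r'}")
      case True': True
      then have "u \<in> {0..T}" "u \<in> {0..t}" "u \<in> {0..t'}" "u \<in> {0..min t t'}" using r by auto
      then show ?thesis using True by (simp add: dens_def)
    qed simp
  qed
  show ?thesis unfolding eq by measurable
qed (simp add: dens_def)

lemma dens_integrable:
  assumes "c \<in> C" "c' \<in> C" "(r, t) \<in> triangle T" "(r', t') \<in> triangle T"
  shows "integrable lborel (\<lambda>u. indicator {0..min r r'} u * dens u c t c' t')"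
proof (rule Bochner_Integration.integrable_bound)
  show "integrable lborel (\<lambda>u. (2 * D\<^sup>2 * W) * indicator {0..T} u :: real)"
    by (intro integrable_mult_right integrable_indicator_Icc)
  show "(\<lambda>u. indicator {0..min r r'} u * dens u c t c' t') \<in> borel_measurable lborel"
    using dens_measurable[OF assms(1,2)] assms(3,4) by (simp add: triangle_iff)
  show "AE u in lborel. norm (indicator {0..min r r'} u * dens u c t c' t') \<le> norm ((2 * D\<^sup>2 * W) * indicator {0..T} u :: real)"
    using dens_bound[OF assms(1,2)] assms(3,4) D W
    by (intro AE_I2) (auto simp: triangle_iff indicator_def)
qed

lemma kern_eq: "kern (c, r, t) (c', r', t') = (\<integral>u. indicator {0..min r r'} u * dens u c t c' t' \<partial>lborel)"
  by (simp add: kern_def set_lebesgue_integral_def)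

text \<open>The quadratic form splits over the blocks, with coefficients outside a block replaced by
  0; within a block it is the rate times a variance.\<close>

lemma dens_psd:
  fixes N :: nat
  assumes c: "\<And>n. n < N \<Longrightarrow> c n \<in> C" and u: "0 \<le> u" "u \<le> T"
  shows "0 \<le> (\<Sum>n<N. \<Sum>m<N. a n * a m * dens u (c n) (t n) (c m) (t m))"
proof -
  \<comment> \<open>The block b is a parameter independent of n and m, so that one mixture serves
    all pairs. For two coordinates in block b this is their density without the rate.\<close>
  define X where "X = (\<lambda>b n m. of_bool (cl (c n) = cl (c m)) *
       (\<pi> b u (cl (c n)) * \<langle>\<lambda>y. translate (t n - u) (\<phi> (c n)) y * translate (t m - u) (\<phi> (c m)) y, \<nu> b u (cl (c n))\<rangle>)
      - \<pi> b u (cl (c n)) * \<langle>translate (t n - u) (\<phi> (c n)), \<nu> b u (cl (c n))\<rangle>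
       * (\<pi> b u (cl (c m)) * \<langle>translate (t m - u) (\<phi> (c m)), \<nu> b u (cl (c m))\<rangle>))"
  have nonneg: "0 \<le> (\<Sum>n<N. \<Sum>m<N. (a n * of_bool (blk (c n) = b)) * (a m * of_bool (blk (c m) = b)) * X b n m)"
    if b: "b \<in> blk ` C" for b
  proof -
    \<comment> \<open>The assumptions about a block are phrased through its coordinates, so a
      representative is needed.\<close>
    from b obtain c0 where c0: "c0 \<in> C" "b = blk c0" by blast
    show ?thesis unfolding X_def c0(2)
      by (rule mixture_variance_nonneg[OF finite_cls, where D=D])
        (use c cl \<nu>_finite[OF c0(1) _ u(1)] \<pi>[OF c0(1) _ u] mass[OF c0(1) u] translate_measurable \<phi>(1) translate_\<phi>_bound
          in auto)
  qed
  have "dens u (c n) (t n) (c m) (t m)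
      = (\<Sum>b\<in>blk ` C. w b u * (of_bool (blk (c n) = b) * of_bool (blk (c m) = b) * X b n m))"
    if "n < N" "m < N" for n m
  proof -
    have "(\<Sum>b\<in>blk ` C. w b u * (of_bool (blk (c n) = b) * of_bool (blk (c m) = b) * X b n m))
        = (\<Sum>b\<in>blk ` C. if b = blk (c n) then w b u * (of_bool (blk (c m) = b) * X b n m) else 0)"
      by (intro sum.cong) auto
    also have "\<dots> = w (blk (c n)) u * (of_bool (blk (c m) = blk (c n)) * X (blk (c n)) n m)"
      using finite_C c[OF that(1)] by simp
    also have "\<dots> = dens u (c n) (t n) (c m) (t m)"
      by (auto simp: dens_def X_def first_def second_def)
    finally show ?thesis by simp
  qed
  then have "(\<Sum>n<N. \<Sum>m<N. a n * a m * dens u (c n) (t n) (c m) (t m))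
      = (\<Sum>n<N. \<Sum>m<N. \<Sum>b\<in>blk ` C. w b u * ((a n * of_bool (blk (c n) = b)) * (a m * of_bool (blk (c m) = b)) * X b n m))"
    by (intro sum.cong refl) (simp add: sum_distrib_left mult_ac)
  also have "\<dots> = (\<Sum>n<N. \<Sum>b\<in>blk ` C. \<Sum>m<N. w b u * ((a n * of_bool (blk (c n) = b)) * (a m * of_bool (blk (c m) = b)) * X b n m))"
    by (intro sum.cong refl sum.swap)
  also have "\<dots> = (\<Sum>b\<in>blk ` C. \<Sum>n<N. \<Sum>m<N. w b u * ((a n * of_bool (blk (c n) = b)) * (a m * of_bool (blk (c m) = b)) * X b n m))"
    by (rule sum.swap)
  also have "\<dots> = (\<Sum>b\<in>blk ` C. w b u * (\<Sum>n<N. \<Sum>m<N. (a n * of_bool (blk (c n) = b)) * (a m * of_bool (blk (c m) = b)) * X b n m))"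
    by (simp add: sum_distrib_left)
  also have "\<dots> \<ge> 0"
  proof (rule sum_nonneg)
    fix b assume b: "b \<in> blk ` C"
    then have "0 \<le> w b u" using w(1) u by auto
    then show "0 \<le> w b u * (\<Sum>n<N. \<Sum>m<N. (a n * of_bool (blk (c n) = b)) * (a m * of_bool (blk (c m) = b)) * X b n m)"
      by (rule mult_nonneg_nonneg[OF _ nonneg[OF b]])
  qed
  finally show ?thesis .
qed

lemma kern_psd: "psd_on (C \<times> triangle T) kern"
  unfolding psd_on_def
proof (intro conjI ballI allI impI)
  fix q r
  show "kern q r = kern r q"
    by (cases q, cases r) (simp add: kern_def dens_sym min.commute)
next
  fix N :: nat and x :: "nat \<Rightarrow> 'c \<times> real \<times> real" and a :: "nat \<Rightarrow> real"
  assume x: "x ` {..<N} \<subseteq> C \<times> triangle T"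
  define c r t where "c = (\<lambda>n. fst (x n))" and "r = (\<lambda>n. fst (snd (x n)))" and "t = (\<lambda>n. snd (snd (x n)))"
  have xe: "x n = (c n, r n, t n)" for n by (simp add: c_def r_def t_def)
  have xc: "c n \<in> C" "(r n, t n) \<in> triangle T" if "n < N" for n
    using x that unfolding c_def r_def t_def by (auto simp: image_subset_iff mem_Times_iff)
  let ?k = "\<lambda>n m u. a n * a m * (indicator {0..min (r n) (r m)} u * dens u (c n) (t n) (c m) (t m))"
  have i: "integrable lborel (?k n m)" if "n < N" "m < N" for n m
    using that by (intro integrable_mult_right dens_integrable xc)
  have "(\<Sum>n<N. \<Sum>m<N. a n * a m * kern (x n) (x m)) = (\<Sum>n<N. \<Sum>m<N. \<integral>u. ?k n m u \<partial>lborel)"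
    unfolding xe kern_eq by simp
  also have "\<dots> = (\<integral>u. (\<Sum>n<N. \<Sum>m<N. ?k n m u) \<partial>lborel)"
    by (rule integral_double_sum[OF i, symmetric])
  \<comment> \<open>The indicator of [0, min r r'] is a product of two indicators. These go into the
    coefficients, and the form is nonnegative for each u separately.\<close>
  also have "\<dots> = (\<integral>u. (\<Sum>n<N. \<Sum>m<N. (a n * indicator {0..r n} u) * (a m * indicator {0..r m} u) * dens u (c n) (t n) (c m) (t m)) \<partial>lborel)"
    by (intro Bochner_Integration.integral_cong sum.cong refl) (auto simp: indicator_def)
  also have "\<dots> \<ge> 0"
  proof (intro Bochner_Integration.integral_nonneg)
    fix u
    show "0 \<le> (\<Sum>n<N. \<Sum>m<N. (a n * indicator {0..r n} u) * (a m * indicator {0..r m} u) * dens u (c n) (t n) (c m) (t m))"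
    proof (cases "0 \<le> u \<and> u \<le> T")
      case True
      then show ?thesis using xc by (intro dens_psd) auto
    next
      case False
      then have "indicator {0..r n} u = (0 :: real)" if "n < N" for n
        using xc(2)[OF that] by (auto simp: triangle_iff indicator_def)
      then show ?thesis by simp
    qed
  qed
  finally show "0 \<le> (\<Sum>n<N. \<Sum>m<N. a n * a m * kern (x n) (x m))" .
qed

lemma kern_diag:
  assumes "c \<in> C" "(r, t) \<in> triangle T"
  shows "kern (c, r, t) (c, r, t) \<le> 2 * D\<^sup>2 * W * T"
proof -
  have "kern (c, r, t) (c, r, t) \<le> (\<integral>u. (2 * D\<^sup>2 * W) * indicator {0..T} u \<partial>lborel)"
    unfolding kern_eq
  proof (rule integral_mono[OF dens_integrable[OF assms(1,1,2,2)]])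
    show "indicator {0..min r r} u * dens u c t c t \<le> 2 * D\<^sup>2 * W * indicator {0..T} u" for u
      using dens_bound[OF assms(1,1), of u t t] assms(2) D W by (auto simp: triangle_iff indicator_def)
  qed (intro integrable_mult_right integrable_indicator_Icc)
  also have "\<dots> = 2 * D\<^sup>2 * W * T" using T by simp
  finally show ?thesis .
qed

text \<open>The means enter with a minus sign as a complete square, so they only lower the variance;
  the second moment of the shift remains.\<close>

lemma dens_increment:
  assumes c: "c \<in> C" and u: "0 \<le> u" "u \<le> t" "u \<le> t'" and t: "t \<le> T" "t' \<le> T"
  shows "dens u c t c t + dens u c t' c t' - 2 * dens u c t c t' \<le> W * (H * \<bar>t - t'\<bar> powr h)"
proof -
  have *: "dens u c t c t + dens u c t' c t' - 2 * dens u c t c t' \<le> W * (H * (t' - t) powr h)"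
    if tt: "u \<le> t" "t \<le> t'" "t' \<le> T" for t t'
  proof -
    note k = cl[OF c]
    have uT: "u \<le> T" using tt by simp
    let ?g = "translate (t - u) (\<phi> c)" and ?g' = "translate (t' - u) (\<phi> c)"
    let ?\<nu> = "\<nu> (blk c) u (cl c)" and ?\<pi> = "\<pi> (blk c) u (cl c)"
    have fm: "?\<nu> \<in> finite_measures" by (rule \<nu>_finite[OF c k u(1)])
    have i: "integrable ?\<nu> (\<lambda>y. translate x (\<phi> c) y * translate x' (\<phi> c) y)" for x x'
      by (intro finite_measures_integrable(1)[OF fm _ translate_mult_bound] borel_measurable_times
          finite_measures_measurable_borel[OF fm] translate_measurable \<phi>(1) c)
    have "shift_increment (\<lambda>u. \<nu> (blk c) u (cl c)) (\<phi> c) u t t' = \<langle>\<lambda>y. ?g y * ?g y + ?g' y * ?g' y - 2 * (?g y * ?g' y), ?\<nu>\<rangle>"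
      unfolding shift_increment_def by (intro Bochner_Integration.integral_cong refl) (simp add: power2_eq_square algebra_simps)
    also have "\<dots> = second u c t c t + second u c t' c t' - 2 * second u c t c t'"
      using i by (simp add: second_def)
    finally have s: "second u c t c t + second u c t' c t' - 2 * second u c t c t'
        = shift_increment (\<lambda>u. \<nu> (blk c) u (cl c)) (\<phi> c) u t t'" by simp
    have "dens u c t c t + dens u c t' c t' - 2 * dens u c t c t'
        = w (blk c) u * (?\<pi> * (second u c t c t + second u c t' c t' - 2 * second u c t c t')
          - (?\<pi> * first u c t - ?\<pi> * first u c t')\<^sup>2)"
      by (simp add: dens_def power2_eq_square algebra_simps)
    also have "\<dots> \<le> w (blk c) u * (H * (t' - t) powr h)"
    proof (rule mult_left_mono[OF _ w(1)[OF c u(1) uT]])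
      show "?\<pi> * (second u c t c t + second u c t' c t' - 2 * second u c t c t')
          - (?\<pi> * first u c t - ?\<pi> * first u c t')\<^sup>2 \<le> H * (t' - t) powr h"
        unfolding s using shift[OF c u(1) tt] zero_le_power2[of "?\<pi> * first u c t - ?\<pi> * first u c t'"] by linarith
    qed
    also have "\<dots> \<le> W * (H * (t' - t) powr h)"
      using w(2)[OF c u(1) uT] H by (intro mult_right_mono) auto
    finally show ?thesis .
  qed
  show ?thesis
  proof (cases "t \<le> t'")
    case True
    then show ?thesis using *[of t t'] u t by (simp add: abs_real_def)
  next
    case False
    then show ?thesis using *[of t' t] u t dens_sym[of u c t c t'] by (simp add: abs_real_def)
  qed
qed

text \<open>Up to min r r' both integrals run, and only the change from t to \<open>t'\<close>
  counts. Between min and max the cross term and one variance have stopped, and the other variance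
  density is at most \<open>2 * D\<^sup>2 * W\<close>. Afterwards nothing is left.\<close>

lemma kern_increment:
  assumes c: "c \<in> C" and rt: "(r, t) \<in> triangle T" "(r', t') \<in> triangle T"
  shows "kern (c, r, t) (c, r, t) + kern (c, r', t') (c, r', t') - 2 * kern (c, r, t) (c, r', t')
    \<le> T * (W * (H * \<bar>t - t'\<bar> powr h)) + 2 * D\<^sup>2 * W * \<bar>r - r'\<bar>"
proof -
  let ?B = "W * (H * \<bar>t - t'\<bar> powr h)" and ?E = "2 * D\<^sup>2 * W"
  have B: "0 \<le> ?B" "0 \<le> ?E" using W H D by auto
  let ?f = "\<lambda>u. indicator {0..min r r} u * dens u c t c t + indicator {0..min r' r'} u * dens u c t' c t'
      - 2 * (indicator {0..min r r'} u * dens u c t c t')"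
  note i = dens_integrable[OF c c rt(1) rt(1)] dens_integrable[OF c c rt(2) rt(2)] dens_integrable[OF c c rt(1) rt(2)]
  have int: "integrable lborel ?f"
    by (intro Bochner_Integration.integrable_diff Bochner_Integration.integrable_add integrable_mult_right i)
  have "kern (c, r, t) (c, r, t) + kern (c, r', t') (c, r', t') - 2 * kern (c, r, t) (c, r', t') = (\<integral>u. ?f u \<partial>lborel)"
    unfolding kern_eq using i by simp
  also have "\<dots> \<le> (\<integral>u. ?B * indicator {0..T} u + ?E * indicator {min r r'..max r r'} u \<partial>lborel)"
  proof (rule integral_mono[OF int])
    fix u
    consider "u < 0" | "0 \<le> u" "u \<le> min r r'" | "0 \<le> u" "min r r' < u" "u \<le> max r r'" | "max r r' < u" by linarith
    then show "?f u \<le> ?B * indicator {0..T} u + ?E * indicator {min r r'..max r r'} u"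
    proof cases
      case 1
      then show ?thesis using B by (simp add: indicator_def)
    next
      case 2
      have "?f u = dens u c t c t + dens u c t' c t' - 2 * dens u c t c t'" using 2 by (simp add: indicator_def)
      also have "\<dots> \<le> ?B" using 2 rt by (intro dens_increment[OF c]) (auto simp: triangle_iff)
      finally have "?f u \<le> ?B" .
      moreover have "?B * indicator {0..T} u = ?B" using 2 rt by (simp add: triangle_iff)
      moreover have "0 \<le> ?E * indicator {min r r'..max r r'} u" by (rule mult_nonneg_nonneg[OF B(2)]) simp
      ultimately show ?thesis by linarith
    next
      case 3
      have "?f u \<le> ?E"
      proof (cases "r \<le> r'")
        case True
        then show ?thesis using 3 dens_bound[OF c c, of u t' t'] rt by (auto simp: indicator_def triangle_iff)
      next
        case False
        then show ?thesis using 3 dens_bound[OF c c, of u t t] rt by (auto simp: indicator_def triangle_iff)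
      qed
      moreover have "0 \<le> ?B * indicator {0..T} u" by (rule mult_nonneg_nonneg[OF B(1)]) simp
      moreover have "?E * indicator {min r r'..max r r'} u = ?E" using 3 by simp
      ultimately show ?thesis by linarith
    next
      case 4
      then have "?f u = 0" by (simp add: indicator_def)
      then show ?thesis using B by simp
    qed
  qed (intro Bochner_Integration.integrable_add integrable_mult_right integrable_indicator_Icc)
  also have "\<dots> = T * ?B + ?E * \<bar>r - r'\<bar>" using T by (simp add: max_def min_def)
  finally show ?thesis .
qed

text \<open>Clamping the first time to the second extends the kernel from the triangle to the square, which
  is stable under rounding down to a dyadic grid.\<close>

definition square_kern :: "'c \<times> real \<times> real \<Rightarrow> 'c \<times> real \<times> real \<Rightarrow> real" where
  "square_kern q q' = kern (fst q, min (fst (snd q)) (snd (snd q)), snd (snd q))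
     (fst q', min (fst (snd q')) (snd (snd q')), snd (snd q'))"

lemma clamp_triangle: "(r, t) \<in> square T \<Longrightarrow> (min r t, t) \<in> triangle T"
  by (auto simp: square_def triangle_iff)

lemma square_kern_psd: "psd_on (C \<times> square T) square_kern"
  unfolding psd_on_def
proof (intro conjI ballI allI impI)
  fix q r
  show "square_kern q r = square_kern r q"
    by (simp add: square_kern_def kern_def dens_sym min.commute)
next
  fix N :: nat and x :: "nat \<Rightarrow> 'c \<times> real \<times> real" and a :: "nat \<Rightarrow> real"
  assume x: "x ` {..<N} \<subseteq> C \<times> square T"
  show "0 \<le> (\<Sum>n<N. \<Sum>m<N. a n * a m * square_kern (x n) (x m))"
    unfolding square_kern_def
  proof (rule psd_onD[OF kern_psd, where x="\<lambda>n. (fst (x n), min (fst (snd (x n))) (snd (snd (x n))), snd (snd (x n)))"])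
    show "(\<lambda>n. (fst (x n), min (fst (snd (x n))) (snd (snd (x n))), snd (snd (x n)))) ` {..<N} \<subseteq> C \<times> triangle T"
    proof (clarify, intro conjI SigmaI)
      fix n assume "n < N"
      then have "x n \<in> C \<times> square T" using x by auto
      then show "fst (x n) \<in> C" "(min (fst (snd (x n))) (snd (snd (x n))), snd (snd (x n))) \<in> triangle T"
        using clamp_triangle by (auto simp: mem_Times_iff)
    qed
  qed
qed

lemma gaussian_field:
  assumes "inj (e :: nat \<Rightarrow> 'i)"
  shows "\<exists>(M :: ('i \<Rightarrow> real) measure) Y. prob_space M \<and>
    (\<forall>q\<in>C \<times> triangle T. Y q \<in> borel_measurable M) \<and>
    (\<forall>\<omega>\<in>space M. \<forall>c\<in>C. continuous_on (triangle T) (\<lambda>x. Y (c, x) \<omega>)) \<and>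
    (\<forall>S a. finite S \<longrightarrow> S \<subseteq> C \<times> triangle T \<longrightarrow>
      centred_gaussian M (\<lambda>\<omega>. \<Sum>q\<in>S. a q * Y q \<omega>) (\<Sum>q\<in>S. \<Sum>r\<in>S. a q * a r * kern q r))"
proof -
  \<comment> \<open>The summands bound the change in the second time, the change in the first time
    and the variance, in this order. The factor max 1 (2 * T) lowers the exponent 1 to h for
    distances up to 2 * T.\<close>
  define B where "B = T * (W * H) + 2 * D\<^sup>2 * W * (max 1 (2 * T)) + 2 * D\<^sup>2 * W * T"
  have B: "0 \<le> B" using T W H D by (simp add: B_def)
  have diag: "square_kern q q \<le> B" if q: "q \<in> C \<times> square T" for q
  proof -
    obtain c r t where qe: "q = (c, r, t)" by (metis prod_cases3)
    have "square_kern q q \<le> 2 * D\<^sup>2 * W * T"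
      unfolding square_kern_def qe using q qe by (auto intro!: kern_diag clamp_triangle)
    also have "\<dots> \<le> B" using T W H D by (simp add: B_def)
    finally show ?thesis .
  qed
  have inc: "square_kern (c, x) (c, x) + square_kern (c, y) (c, y) - 2 * square_kern (c, x) (c, y)
      \<le> B * (\<bar>fst x - fst y\<bar> + \<bar>snd x - snd y\<bar>) powr h"
    if c: "c \<in> C" and x: "x \<in> square T" and y: "y \<in> square T" for c x y
  proof -
    obtain r t r' t' where xy: "x = (r, t)" "y = (r', t')" by (metis prod.exhaust)
    define s where "s = \<bar>r - r'\<bar> + \<bar>t - t'\<bar>"
    have s: "0 \<le> s" "s \<le> 2 * T" using x y xy by (auto simp: s_def square_def)
    have "square_kern (c, x) (c, x) + square_kern (c, y) (c, y) - 2 * square_kern (c, x) (c, y)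
        \<le> T * (W * (H * \<bar>t - t'\<bar> powr h)) + 2 * D\<^sup>2 * W * \<bar>min r t - min r' t'\<bar>"
      unfolding square_kern_def xy using kern_increment[OF c clamp_triangle clamp_triangle, of r t r' t'] x y xy by simp
    also have "\<dots> \<le> T * (W * (H * s powr h)) + 2 * D\<^sup>2 * W * (max 1 (2 * T) * s powr h)"
    proof (intro add_mono mult_left_mono)
      show "\<bar>t - t'\<bar> powr h \<le> s powr h" using h by (intro powr_mono2) (auto simp: s_def)
      have "\<bar>min r t - min r' t'\<bar> \<le> s" by (auto simp: s_def min_def)
      also have "\<dots> = s powr 1" using s by simp
      also have "\<dots> \<le> max 1 (2 * T) * s powr h" using s h by (intro powr_le_powr_smaller) auto
      finally show "\<bar>min r t - min r' t'\<bar> \<le> max 1 (2 * T) * s powr h" .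
    qed (use T W H D in auto)
    also have "\<dots> = (T * (W * H) + 2 * D\<^sup>2 * W * (max 1 (2 * T))) * s powr h" by (simp add: algebra_simps)
    also have "\<dots> \<le> B * s powr h" using T W D by (intro mult_right_mono) (auto simp: B_def)
    finally show ?thesis by (simp add: s_def xy)
  qed
  have "\<exists>(M :: ('i \<Rightarrow> real) measure) Y. prob_space M \<and> (\<forall>q\<in>C \<times> square T. Y q \<in> borel_measurable M) \<and>
    (\<forall>\<omega>\<in>space M. \<forall>c\<in>C. continuous_on (square T) (\<lambda>x. Y (c, x) \<omega>)) \<and>
    (\<forall>S a. finite S \<longrightarrow> S \<subseteq> C \<times> square T \<longrightarrow>
      centred_gaussian M (\<lambda>\<omega>. \<Sum>q\<in>S. a q * Y q \<omega>) (\<Sum>q\<in>S. \<Sum>r\<in>S. a q * a r * square_kern q r))"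
    by (rule continuous_gaussian_field[OF assms finite_C less_imp_le[OF T] square_kern_psd h(1) B]) (fact diag, fact inc)
  then obtain M :: "('i \<Rightarrow> real) measure" and Y where
    *: "prob_space M \<and> (\<forall>q\<in>C \<times> square T. Y q \<in> borel_measurable M) \<and>
    (\<forall>\<omega>\<in>space M. \<forall>c\<in>C. continuous_on (square T) (\<lambda>x. Y (c, x) \<omega>)) \<and>
    (\<forall>S a. finite S \<longrightarrow> S \<subseteq> C \<times> square T \<longrightarrow>
      centred_gaussian M (\<lambda>\<omega>. \<Sum>q\<in>S. a q * Y q \<omega>) (\<Sum>q\<in>S. \<Sum>r\<in>S. a q * a r * square_kern q r))"
    by (elim exE) (rule that)
  have sub: "triangle T \<subseteq> square T" by (auto simp: triangle_def square_def)
  then have CS: "C \<times> triangle T \<subseteq> C \<times> square T" by auto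
  \<comment> \<open>On the triangle the clamping is the identity.\<close>
  have eq: "square_kern q r = kern q r" if "q \<in> C \<times> triangle T" "r \<in> C \<times> triangle T" for q r
    using that by (auto simp: square_kern_def triangle_iff min_absorb1)
  have "centred_gaussian M (\<lambda>\<omega>. \<Sum>q\<in>S. a q * Y q \<omega>) (\<Sum>q\<in>S. \<Sum>r\<in>S. a q * a r * kern q r)"
    if "finite S" "S \<subseteq> C \<times> triangle T" for S a
  proof -
    have "(\<Sum>q\<in>S. \<Sum>r\<in>S. a q * a r * kern q r) = (\<Sum>q\<in>S. \<Sum>r\<in>S. a q * a r * square_kern q r)"
    proof (intro sum.cong refl)
      fix q r assume "q \<in> S" "r \<in> S"
      then have "kern q r = square_kern q r" using that(2) by (intro eq[symmetric] subsetD[OF that(2)])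
      then show "a q * a r * kern q r = a q * a r * square_kern q r" by simp
    qed
    moreover have "S \<subseteq> C \<times> square T" using that CS by blast
    ultimately show ?thesis using * that(1) by simp
  qed
  note gaussian = this
  show ?thesis
  proof (rule exI[of _ M], rule exI[of _ Y], intro conjI ballI allI impI)
    show "continuous_on (triangle T) (\<lambda>x. Y (c, x) \<omega>)" if "\<omega> \<in> space M" "c \<in> C" for \<omega> c
      using * that by (intro continuous_on_subset[OF _ sub]) blast
    show "Y q \<in> borel_measurable M" if "q \<in> C \<times> triangle T" for q
      using * subsetD[OF CS that] by blast
    show "prob_space M" using * by blast
  qed (rule gaussian)
qed

end

section \<open>The limit process\<close>

lemma limit_process_unique:
  assumes Y: "limit_process J K \<alpha> \<mu> p \<theta> \<zeta> T n f M Y" and Y': "limit_process J K \<alpha> \<mu> p \<theta> \<zeta> T n f M' Y'"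
  shows "path_law n J K T M Y = path_law n J K T M' Y'"
proof (rule path_law_unique)
  note y = Y[unfolded limit_process_def] and y' = Y'[unfolded limit_process_def]
  show M: "prob_space M" "prob_space M'" using y y' by blast+
  show "\<And>q. q \<in> coords n J K \<times> triangle T \<Longrightarrow> Y q \<in> borel_measurable M" using y by blast
  show "\<And>q. q \<in> coords n J K \<times> triangle T \<Longrightarrow> Y' q \<in> borel_measurable M'" using y' by blast
  show "\<And>\<omega>. \<omega> \<in> space M \<Longrightarrow> continuous_map (index_space n J K T) euclidean (\<lambda>q. Y q \<omega>)" using y by blast
  show "\<And>\<omega>. \<omega> \<in> space M' \<Longrightarrow> continuous_map (index_space n J K T) euclidean (\<lambda>q. Y' q \<omega>)" using y' by blast
  fix S and c :: "coord \<times> real \<times> real \<Rightarrow> real"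
  assume S: "finite S" "S \<subseteq> coords n J K \<times> triangle T"
  let ?k = "limit_cov J \<alpha> \<mu> p \<theta> \<zeta> f"
  have "centred_gaussian M (\<lambda>\<omega>. \<Sum>q\<in>S. c q * Y q \<omega>) (\<Sum>q\<in>S. \<Sum>r\<in>S. c q * c r * ?k q r)"
    by (rule prob_space.gaussian_process_centred[OF M(1) _ _ _ S]) (use y in blast)+
  moreover have "centred_gaussian M' (\<lambda>\<omega>. \<Sum>q\<in>S. c q * Y' q \<omega>) (\<Sum>q\<in>S. \<Sum>r\<in>S. c q * c r * ?k q r)"
    by (rule prob_space.gaussian_process_centred[OF M(2) _ _ _ S]) (use y' in blast)+
  ultimately show "char (distr M borel (\<lambda>\<omega>. \<Sum>q\<in>S. c q * Y q \<omega>)) 1 = char (distr M' borel (\<lambda>\<omega>. \<Sum>q\<in>S. c q * Y' q \<omega>)) 1"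
    by (simp add: centred_gaussian_def)
qed

lemma holder_bound_mult:
  assumes F: "holder_bound T F" and \<rho>: "\<And>u. 0 \<le> u \<Longrightarrow> u \<le> T \<Longrightarrow> 0 \<le> \<rho> u" "\<And>u. 0 \<le> u \<Longrightarrow> u \<le> T \<Longrightarrow> \<rho> u \<le> P"
  shows "holder_bound T (\<lambda>u t t'. \<rho> u * F u t t')"
proof -
  obtain h H where h: "0 < h" "h \<le> 1" "0 \<le> H"
    "\<And>u t t'. 0 \<le> u \<Longrightarrow> u \<le> t \<Longrightarrow> t \<le> t' \<Longrightarrow> t' \<le> T \<Longrightarrow> F u t t' \<le> H * (t' - t) powr h"
    using F unfolding holder_bound_def by blast
  show ?thesis unfolding holder_bound_def
  proof (rule exI[of _ h], rule exI[of _ "\<bar>P\<bar> * H"], intro conjI allI impI)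
    fix u t t' assume u: "0 \<le> u" "u \<le> t" "t \<le> t'" "t' \<le> T"
    have "\<rho> u * F u t t' \<le> \<rho> u * (H * (t' - t) powr h)" using h(4)[OF u] \<rho>(1) u by (intro mult_left_mono) auto
    also have "\<dots> \<le> \<bar>P\<bar> * (H * (t' - t) powr h)" using \<rho>(2)[of u] u h(3) by (intro mult_right_mono) auto
    finally show "\<rho> u * F u t t' \<le> \<bar>P\<bar> * H * (t' - t) powr h" by (simp add: mult.assoc)
  qed (use h(1-3) in auto)
qed

text \<open>The indices erased here (set to 0) are those across which coordinates may be correlated:
  the test function and, for services, the class. What remains names one arrival stream or one
  server.\<close>

primrec block :: "coord \<Rightarrow> coord" where
  "block (Arr a j) = Arr 0 j"
| "block (Srv a j k i) = Srv 0 j k 0"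

primrec cls_of :: "coord \<Rightarrow> nat" where
  "cls_of (Arr a j) = j"
| "cls_of (Srv a j k i) = i"

primrec fn_of :: "coord \<Rightarrow> nat" where
  "fn_of (Arr a j) = a"
| "fn_of (Srv a j k i) = a"

context fluid
begin

text \<open>In an arrival block all mass sits in one class; in a service block the mixture is the law of the
  class and the residual work of a job picked with weights \<open>p\<^sub>c z\<^sub>c(u)\<close>.\<close>

definition mix_weight :: "coord \<Rightarrow> real \<Rightarrow> nat \<Rightarrow> real" where
  "mix_weight b u c = (case b of Arr _ j \<Rightarrow> of_bool (c = j) | Srv _ _ _ _ \<Rightarrow> p c / Lp J p (masses (\<zeta> u)))"

definition mix_measure :: "coord \<Rightarrow> real \<Rightarrow> nat \<Rightarrow> real measure" where
  "mix_measure b u c = (case b of Arr _ _ \<Rightarrow> \<theta> c | Srv _ _ _ _ \<Rightarrow> \<zeta> u c)"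

definition mix_rate :: "coord \<Rightarrow> real \<Rightarrow> real" where
  "mix_rate b u = (case b of Arr _ j \<Rightarrow> \<alpha> j
     | Srv _ j _ _ \<Rightarrow> p j * masses (\<zeta> u) j / Lpmu J \<mu> p (masses (\<zeta> u)))"

lemma Lp_continuous: "continuous_on {0..} (\<lambda>u. Lp J p (masses (\<zeta> u)))"
  unfolding Lp_def using masses_continuous by (intro continuous_intros) auto

lemma Lpmu_continuous: "continuous_on {0..} (\<lambda>u. Lpmu J \<mu> p (masses (\<zeta> u)))"
  unfolding Lpmu_def using masses_continuous by (intro continuous_intros) auto

text \<open>The j-th summand of the denominator is the numerator divided by
  \<open>\<mu> j\<close>.\<close>

lemma service_rate_bound:
  assumes j: "j \<in> {1..J}" and u: "0 \<le> u"
  shows "p j * masses (\<zeta> u) j / Lpmu J \<mu> p (masses (\<zeta> u)) \<le> \<mu> j"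
proof -
  have "p j / \<mu> j * masses (\<zeta> u) j \<le> Lpmu J \<mu> p (masses (\<zeta> u))"
    unfolding Lpmu_def
    by (rule member_le_sum[OF j]) (use pos masses_nonneg in \<open>auto intro!: mult_nonneg_nonneg divide_nonneg_nonneg simp: less_imp_le\<close>)
  then show ?thesis using Lpmu_pos[OF u] pos(2)[OF j] by (simp add: field_simps)
qed

lemma indicator_measurable:
  fixes g :: "real \<Rightarrow> real"
  assumes "continuous_on {0..} g"
  shows "(\<lambda>u. indicator {0..T} u * g u) \<in> borel_measurable borel"
  using borel_measurable_continuous_on_indicator[of "{0..T}" g] continuous_on_subset[OF assms, of "{0..T}"] by simp

text \<open>The service weights stay bounded because the normalising sum \<open>Lp\<close> is
  continuous and positive, hence bounded below on [0, T] by compactness. A bounded weight preserves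
  the Hoelder bound, and finitely many coordinates share one exponent.\<close>

lemma mixture_fluid:
  assumes T: "0 < T"
    and f: "\<And>a. a \<in> {1..n} \<Longrightarrow> bounded_lipschitz (f a)"
    and \<theta>_shift: "\<And>a j. a \<in> {1..n} \<Longrightarrow> j \<in> {1..J} \<Longrightarrow> holder_bound T (shift_increment (\<lambda>_. \<theta> j) (f a))"
    and \<zeta>_shift: "\<And>a j. a \<in> {1..n} \<Longrightarrow> j \<in> {1..J} \<Longrightarrow> holder_bound T (shift_increment (\<lambda>u. \<zeta> u j) (f a))"
  shows "\<exists>D W h H. mixture (coords n J K) {1..J} block cls_of (\<lambda>c. f (fn_of c)) mix_weight mix_measure mix_rate T D W h H"
proof -
  let ?C = "coords n J K"
  have C: "cls_of c \<in> {1..J}" "fn_of c \<in> {1..n}" if "c \<in> ?C" for c using that by (auto simp: coords_def)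
  have "\<forall>a\<in>{1..n}. \<exists>D\<ge>0. \<forall>y\<ge>0. \<bar>f a y\<bar> \<le> D" using f unfolding bounded_lipschitz_def by blast
  then obtain d where d: "\<And>a. a \<in> {1..n} \<Longrightarrow> 0 \<le> d a" "\<And>a y. a \<in> {1..n} \<Longrightarrow> 0 \<le> y \<Longrightarrow> \<bar>f a y\<bar> \<le> d a"
    by metis
  define D where "D = (\<Sum>a=1..n. d a)"
  have D0: "0 \<le> D" unfolding D_def using d(1) by (intro sum_nonneg) auto
  have D: "\<bar>f a y\<bar> \<le> D" if "a \<in> {1..n}" "0 \<le> y" for a y
  proof -
    have "d a \<le> D" unfolding D_def using that(1) d(1) by (intro member_le_sum) auto
    then show ?thesis using d(2)[OF that] by simp
  qed
  \<comment> \<open>W dominates both kinds of rate: \<open>\<alpha> j\<close> for arrivals, and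
    \<open>\<mu> j\<close>, which bounds the service rate of class j.\<close>
  define W where "W = (\<Sum>j=1..J. \<alpha> j + \<mu> j)"
  have Wj: "\<alpha> j \<le> W" "\<mu> j \<le> W" if "j \<in> {1..J}" for j
  proof -
    have "\<alpha> j + \<mu> j \<le> W" unfolding W_def
      by (rule member_le_sum[OF that]) (use pos in \<open>auto simp: less_imp_le add_nonneg_nonneg\<close>)
    then show "\<alpha> j \<le> W" "\<mu> j \<le> W" using pos(1,2)[OF that] by auto
  qed
  have W0: "0 \<le> W" unfolding W_def using pos by (intro sum_nonneg) (auto simp: less_imp_le add_nonneg_nonneg)
  obtain l where l: "0 < l" "\<And>u. 0 \<le> u \<Longrightarrow> u \<le> T \<Longrightarrow> l \<le> Lp J p (masses (\<zeta> u))"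
  proof -
    have "\<exists>x\<in>{0..T}. \<forall>u\<in>{0..T}. Lp J p (masses (\<zeta> x)) \<le> Lp J p (masses (\<zeta> u))"
      using T by (intro continuous_attains_inf continuous_on_subset[OF Lp_continuous]) auto
    then obtain x where "x \<in> {0..T}" "\<forall>u\<in>{0..T}. Lp J p (masses (\<zeta> x)) \<le> Lp J p (masses (\<zeta> u))" by blast
    then show ?thesis using Lp_pos[of x] by (intro that[of "Lp J p (masses (\<zeta> x))"]) auto
  qed
  have hb: "holder_bound T (\<lambda>u t t'. mix_weight (block c) u (cls_of c) *
      shift_increment (\<lambda>u. mix_measure (block c) u (cls_of c)) (f (fn_of c)) u t t')" if c: "c \<in> ?C" for c
  proof (cases c)
    case (Arr a j)
    then show ?thesis using \<theta>_shift[OF C(2)[OF c] C(1)[OF c]] by (simp add: mix_weight_def mix_measure_def)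
  next
    case (Srv a j k i)
    have "holder_bound T (\<lambda>u t t'. p i / Lp J p (masses (\<zeta> u)) * shift_increment (\<lambda>u. \<zeta> u i) (f a) u t t')"
    proof (rule holder_bound_mult[where P="p i / l"])
      show "holder_bound T (shift_increment (\<lambda>u. \<zeta> u i) (f a))"
        using \<zeta>_shift[OF C(2)[OF c] C(1)[OF c]] Srv by simp
      have pi: "0 < p i" using pos(3)[OF C(1)[OF c]] Srv by simp
      show "0 \<le> p i / Lp J p (masses (\<zeta> u))" if "0 \<le> u" for u using pi Lp_pos[OF that] by simp
      show "p i / Lp J p (masses (\<zeta> u)) \<le> p i / l" if "0 \<le> u" "u \<le> T" for u
        using pi l(1) l(2)[OF that] by (intro divide_left_mono mult_pos_pos) auto
    qed
    then show ?thesis using Srv by (simp add: mix_weight_def mix_measure_def)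
  qed
  have "\<exists>h H. 0 < h \<and> h \<le> 1 \<and> 0 \<le> H \<and>
    (\<forall>c\<in>?C. \<forall>u t t'. 0 \<le> u \<longrightarrow> u \<le> t \<longrightarrow> t \<le> t' \<longrightarrow> t' \<le> T \<longrightarrow> mix_weight (block c) u (cls_of c) *
      shift_increment (\<lambda>u. mix_measure (block c) u (cls_of c)) (f (fn_of c)) u t t' \<le> H * (t' - t) powr h)"
    by (rule holder_bound_finite[OF finite_coords]) (rule hb)
  then obtain h H where h: "0 < h" "h \<le> 1" "0 \<le> H"
    and H: "\<forall>c\<in>?C. \<forall>u t t'. 0 \<le> u \<longrightarrow> u \<le> t \<longrightarrow> t \<le> t' \<longrightarrow> t' \<le> T \<longrightarrow> mix_weight (block c) u (cls_of c) *
      shift_increment (\<lambda>u. mix_measure (block c) u (cls_of c)) (f (fn_of c)) u t t' \<le> H * (t' - t) powr h"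
    by blast
  have "mixture ?C {1..J} block cls_of (\<lambda>c. f (fn_of c)) mix_weight mix_measure mix_rate T D W h H"
  \<comment> \<open>The numbers follow the locale assumptions: 10 is weak continuity, 11 to 13
    concern the rate, 14 and 15 the weights, 16 the total mass, 19 the shift bound.\<close>
  proof (unfold_locales, goal_cases)
    case (10 c k)
    then show ?case using \<zeta>_weakly_continuous[of k] weakly_continuous_const[OF \<theta>(1)[of k]]
      by (cases c) (simp_all add: mix_measure_def)
  next
    case (11 c u)
    then show ?case using pos Lpmu_pos[of u] masses_nonneg
      by (cases c) (auto simp: mix_rate_def coords_def less_imp_le)
  next
    case (12 c u)
    then show ?case using Wj service_rate_bound[of _ u]
      by (cases c) (auto simp: mix_rate_def coords_def intro: order_trans)
  next
    case (13 c)
    show ?case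
    proof (cases c)
      case (Srv a j k i)
      then have j: "j \<in> {1..J}" using 13 by (auto simp: coords_def)
      have "continuous_on {0..} (\<lambda>u. p j * masses (\<zeta> u) j / Lpmu J \<mu> p (masses (\<zeta> u)))"
        using Lpmu_pos by (intro continuous_intros masses_continuous Lpmu_continuous j) (auto simp: less_imp_neq[symmetric])
      then show ?thesis unfolding mix_rate_def Srv block.simps coord.case by (rule indicator_measurable)
    qed (simp add: mix_rate_def)
  next
    case (14 c k u)
    then show ?case using pos(3)[of k] Lp_pos[of u] by (cases c) (auto simp: mix_weight_def less_imp_le)
  next
    case (15 c k)
    have "continuous_on {0..} (\<lambda>u. p k / Lp J p (masses (\<zeta> u)))"
      using Lp_pos by (intro continuous_intros Lp_continuous) (auto simp: less_imp_neq[symmetric])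
    from indicator_measurable[OF this] show ?case
      by (cases c) (simp_all only: mix_weight_def block.simps coord.case, simp)
  next
    case (16 c u)
    show ?case
    proof (cases c)
      case (Arr a j)
      then have j: "j \<in> {1..J}" using 16 by (auto simp: coords_def)
      have "(\<Sum>k=1..J. of_bool (k = j) * measure (\<theta> k) {0..}) = (\<Sum>k=1..J. if k = j then 1 else 0)"
        using \<theta>(2) by (intro sum.cong) auto
      then show ?thesis using Arr j by (simp add: mix_weight_def mix_measure_def)
    next
      case (Srv a j k i)
      have "(\<Sum>k=1..J. p k / Lp J p (masses (\<zeta> u)) * measure (\<zeta> u k) {0..})
          = (\<Sum>k=1..J. p k * masses (\<zeta> u) k / Lp J p (masses (\<zeta> u)))"
        using 16 by (intro sum.cong) (auto simp: masses_eq)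
      also have "\<dots> = Lp J p (masses (\<zeta> u)) / Lp J p (masses (\<zeta> u))"
        by (simp add: Lp_def flip: sum_divide_distrib)
      also have "\<dots> = 1" using Lp_pos[of u] 16 by simp
      finally show ?thesis using Srv by (simp add: mix_weight_def mix_measure_def)
    qed
  next
    case (19 c u t t')
    then show ?case using H by blast
  qed (use T D0 W0 h C f D in auto)
  then show ?thesis by blast
qed

lemma limit_process_exists:
  assumes T: "0 < T"
    and f: "\<And>a. a \<in> {1..n} \<Longrightarrow> bounded_lipschitz (f a)"
    and \<theta>_shift: "\<And>a j. a \<in> {1..n} \<Longrightarrow> j \<in> {1..J} \<Longrightarrow> holder_bound T (shift_increment (\<lambda>_. \<theta> j) (f a))"
    and \<zeta>_shift: "\<And>a j. a \<in> {1..n} \<Longrightarrow> j \<in> {1..J} \<Longrightarrow> holder_bound T (shift_increment (\<lambda>u. \<zeta> u j) (f a))"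
  shows "\<exists>(M :: (coord \<times> real \<times> real \<Rightarrow> real) measure) Y. limit_process J K \<alpha> \<mu> p \<theta> \<zeta> T n f M Y"
proof -
  let ?C = "coords n J K" and ?k = "limit_cov J \<alpha> \<mu> p \<theta> \<zeta> f"
  have "\<exists>D W h H. mixture ?C {1..J} block cls_of (\<lambda>c. f (fn_of c)) mix_weight mix_measure mix_rate T D W h H"
    by (rule mixture_fluid[OF T f \<theta>_shift \<zeta>_shift])
  then obtain D W h H where "mixture ?C {1..J} block cls_of (\<lambda>c. f (fn_of c)) mix_weight mix_measure mix_rate T D W h H"
    by blast
  then interpret mix: mixture ?C "{1..J}" block cls_of "\<lambda>c. f (fn_of c)" mix_weight mix_measure mix_rate T D W h H .
  \<comment> \<open>The densities are the integrands of the theorem. For arrivals the weight is 1;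
    for services the squared denominator comes from the two weights.\<close>
  have dens: "mix.dens u (Arr a j) t (Arr b j') t' = (if j = j' then
      \<alpha> j * (\<langle>\<lambda>y. translate (t - u) (f a) y * translate (t' - u) (f b) y, \<theta> j\<rangle>
        - \<langle>translate (t - u) (f a), \<theta> j\<rangle> * \<langle>translate (t' - u) (f b), \<theta> j\<rangle>) else 0)"
    "mix.dens u (Srv a j k c) t (Srv b j' k' d) t' = (if j = j' \<and> k = k' then
      (of_bool (c = d) * (p c * \<langle>\<lambda>y. translate (t - u) (f a) y * translate (t' - u) (f b) y, \<zeta> u c\<rangle>
             / Lp J p (masses (\<zeta> u)))
        - p c * p d * \<langle>translate (t - u) (f a), \<zeta> u c\<rangle> * \<langle>translate (t' - u) (f b), \<zeta> u d\<rangle>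
             / (Lp J p (masses (\<zeta> u)))\<^sup>2)
       * (p j * masses (\<zeta> u) j / Lpmu J \<mu> p (masses (\<zeta> u))) else 0)"
    "mix.dens u (Arr a j) t (Srv b j' k' d) t' = 0"
    "mix.dens u (Srv a j k c) t (Arr b j') t' = 0"
    for u a b j j' k k' c d t t'
    by (simp_all add: mix.dens_def mix.first_def mix.second_def mix_weight_def mix_measure_def mix_rate_def
        power2_eq_square mult_ac)
  have if_integral: "(LINT u:A|lborel. if P then X u else 0) = (if P then LINT u:A|lborel. X u else (0 :: real))"
    for A P and X :: "real \<Rightarrow> real" by simp
  have kern: "mix.kern q q' = ?k q q'" for q q'
  proof -
    obtain c r t c' r' t' where q: "q = (c, r, t)" "q' = (c', r', t')" by (metis prod_cases3)
    show ?thesis unfolding q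
      by (cases c; cases c') (simp_all only: mix.kern_def dens arrival_cov_def service_cov_def if_integral limit_cov.simps prod.case, simp_all)
  qed
  \<comment> \<open>Any embedding of the naturals into the index type of the prescribed sample space
    will do.\<close>
  have "inj (\<lambda>m. (Arr m 0, 0 :: real, 0 :: real))" by (auto simp: inj_def)
  from mix.gaussian_field[OF this]
  obtain M :: "(coord \<times> real \<times> real \<Rightarrow> real) measure" and Y where
    *: "prob_space M \<and> (\<forall>q\<in>?C \<times> triangle T. Y q \<in> borel_measurable M) \<and>
    (\<forall>\<omega>\<in>space M. \<forall>c\<in>?C. continuous_on (triangle T) (\<lambda>x. Y (c, x) \<omega>)) \<and>
    (\<forall>S a. finite S \<longrightarrow> S \<subseteq> ?C \<times> triangle T \<longrightarrow>
      centred_gaussian M (\<lambda>\<omega>. \<Sum>q\<in>S. a q * Y q \<omega>) (\<Sum>q\<in>S. \<Sum>r\<in>S. a q * a r * mix.kern q r))"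
    by (elim exE) (rule that)
  then have M: "prob_space M" by blast
  have G: "centred_gaussian M (\<lambda>\<omega>. \<Sum>q\<in>S. a q * Y q \<omega>) (\<Sum>q\<in>S. \<Sum>r\<in>S. a q * a r * mix.kern q r)"
    if "finite S" "S \<subseteq> ?C \<times> triangle T" for S a
    using * that by blast
  have sym: "mix.kern q r = mix.kern r q" if "q \<in> ?C \<times> triangle T" "r \<in> ?C \<times> triangle T" for q r
    using mix.kern_psd that unfolding psd_on_def by blast
  have "limit_process J K \<alpha> \<mu> p \<theta> \<zeta> T n f M Y"
    unfolding limit_process_def
  proof (intro conjI ballI)
    show "prob_space M" by (rule M)
    show "Y q \<in> borel_measurable M" if "q \<in> ?C \<times> triangle T" for q using * that by blast
    show "continuous_map (index_space n J K T) euclidean (\<lambda>q. Y q \<omega>)" if "\<omega> \<in> space M" for \<omega>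
      unfolding continuous_map_index_space using * that by blast
    show "gaussian_process M (?C \<times> triangle T) Y" 
      by (rule prob_space.centred_gaussian_process(1)[where k=mix.kern, OF M]) (rule G sym; assumption)+
    show "integral\<^sup>L M (Y q) = 0" if "q \<in> ?C \<times> triangle T" for q 
      by (rule prob_space.centred_gaussian_process(2)[where k=mix.kern, OF M _ _ that]) (rule G sym; assumption)+
    show "covariance M (Y q) (Y r) = ?k q r" if "q \<in> ?C \<times> triangle T" "r \<in> ?C \<times> triangle T" for q r
      unfolding kern[symmetric] 
      by (rule prob_space.centred_gaussian_process(3)[where k=mix.kern, OF M _ _ that]) (rule G sym; assumption)+
  qed
  then show ?thesis by blast
qed

end

theorem theorem3p1:
  fixes J K :: nat
    and \<alpha> \<mu> p :: "nat \<Rightarrow> real"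
    and \<theta> \<zeta>\<^sub>0 :: "nat \<Rightarrow> real measure"
    and \<zeta> :: "real \<Rightarrow> nat \<Rightarrow> real measure"
    and T :: real
  assumes "fluid_params J K \<alpha> \<mu> p \<theta>"
    and "traffic_intensity J K \<alpha> \<mu> > 1"
    and "fluid_solution J K \<alpha> \<mu> p \<theta> \<zeta>\<^sub>0 \<zeta>"
    and "nonzero_measures J \<zeta>\<^sub>0"
    and "T > 0"
  shows
    "(\<forall>n f. (\<forall>a\<in>{1..n}. f a \<in> \<C>) \<longrightarrow>
        (\<exists>(M :: (coord \<times> real \<times> real \<Rightarrow> real) measure) Y.
           limit_process J K \<alpha> \<mu> p \<theta> \<zeta> T n f M Y) \<and>
        (\<forall>(M :: 'w1 measure) Y (M' :: 'w2 measure) Y'.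
           limit_process J K \<alpha> \<mu> p \<theta> \<zeta> T n f M Y \<and> limit_process J K \<alpha> \<mu> p \<theta> \<zeta> T n f M' Y' \<longrightarrow>
           path_law n J K T M Y = path_law n J K T M' Y')) \<and>
     ((\<forall>j\<in>{1..J}. holder_cdf (\<theta> j) \<and> holder_cdf (\<zeta> 0 j)) \<longrightarrow>
      (\<forall>n f. (\<forall>a\<in>{1..n}. f a \<in> \<C> \<union> {\<lambda>_. 1}) \<longrightarrow>
        (\<exists>(M :: (coord \<times> real \<times> real \<Rightarrow> real) measure) Y.
           limit_process J K \<alpha> \<mu> p \<theta> \<zeta> T n f M Y) \<and>
        (\<forall>(M :: 'w1 measure) Y (M' :: 'w2 measure) Y'.
           limit_process J K \<alpha> \<mu> p \<theta> \<zeta> T n f M Y \<and> limit_process J K \<alpha> \<mu> p \<theta> \<zeta> T n f M' Y' \<longrightarrow>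
           path_law n J K T M Y = path_law n J K T M' Y')))"
proof (intro conjI allI impI)
  interpret fluid J K \<alpha> \<mu> p \<theta> \<zeta>\<^sub>0 \<zeta> using assms(1-4) by unfold_locales
  note T = \<open>T > 0\<close>
  fix n and f :: "nat \<Rightarrow> real \<Rightarrow> real"
  {
    assume f: "\<forall>a\<in>{1..n}. f a \<in> \<C>"
    \<comment> \<open>Test functions vanish at 0, so weak continuity alone bounds their increments;
      for \<theta> it is applied to a constant family.\<close>
    show "\<exists>(M :: (coord \<times> real \<times> real \<Rightarrow> real) measure) Y. limit_process J K \<alpha> \<mu> p \<theta> \<zeta> T n f M Y"
      using f by (intro limit_process_exists[OF T] bounded_lipschitz_test shift_increment_test[OF _ _ T]
          weakly_continuous_const \<theta>(1) \<zeta>_weakly_continuous) auto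
  next
    assume h: "\<forall>j\<in>{1..J}. holder_cdf (\<theta> j) \<and> holder_cdf (\<zeta> 0 j)"
      and f: "\<forall>a\<in>{1..n}. f a \<in> \<C> \<union> {\<lambda>_. 1}"
    have f_cases: "f a \<in> \<C> \<or> f a = (\<lambda>_. 1)" if "a \<in> {1..n}" for a using f that by blast
    show "\<exists>(M :: (coord \<times> real \<times> real \<Rightarrow> real) measure) Y. limit_process J K \<alpha> \<mu> p \<theta> \<zeta> T n f M Y"
    proof (rule limit_process_exists[OF T])
      show "bounded_lipschitz (f a)" if "a \<in> {1..n}" for a
        using f_cases[OF that] bounded_lipschitz_test bounded_lipschitz_one by auto
      show "holder_bound T (shift_increment (\<lambda>_. \<theta> j) (f a))" if a: "a \<in> {1..n}" and j: "j \<in> {1..J}" for a j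
      proof -
        have wc: "weakly_continuous (\<lambda>_. \<theta> j)" by (rule weakly_continuous_const[OF \<theta>(1)[OF j]])
        have "holder_bound T (shift_increment (\<lambda>_. \<theta> j) (\<lambda>_. 1))"
          using h j by (intro shift_increment_one[OF wc] interval_holder_bound(1)[OF j _ _ T]) auto
        then show ?thesis using f_cases[OF a] shift_increment_test[OF _ wc T] by auto
      qed
      show "holder_bound T (shift_increment (\<lambda>u. \<zeta> u j) (f a))" if a: "a \<in> {1..n}" and j: "j \<in> {1..J}" for a j
      proof -
        have "holder_bound T (shift_increment (\<lambda>u. \<zeta> u j) (\<lambda>_. 1))"
          using h j by (intro shift_increment_one[OF \<zeta>_weakly_continuous[OF j]] interval_holder_bound(2)[OF j _ _ T]) auto
        then show ?thesis using f_cases[OF a] shift_increment_test[OF _ \<zeta>_weakly_continuous[OF j] T] by auto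
      qed
    qed
  }
\<comment> \<open>In both parts the law is determined by the prescribed covariance and the
  continuity of the paths.\<close>
qed (use limit_process_unique in blast)+

end
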